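(* Let $\kappa\in\mathbb R$ and $\tau>0$ with $\kappa\neq\tau^2$, and for $\theta\in[0,\pi]$ put $\lambda(\theta)=\kappa\sin^2\theta+\tau^2\cos^2\theta$ and $\mu(\theta)=\frac{\tau^2-\kappa}{2\tau^2}\sin^2\theta$. A unit-speed geodesic $\gamma(t)$ on $M^3(\kappa,\tau)$ starting at the origin with slope angle $\theta$ admits conjugate points to the origin if and only if $\lambda(\theta)>0$. Moreover: (i) The conjugate points to the origin along the Hopf fibers (that is, when $\theta\in\{0,\pi\}$) are at $t=\frac{2\pi p}{\tau}$, $p\in\mathbb N$; their multiplicity is $2$ and they are not isotropic. (ii) For $\theta\in\,]0,\pi[$ with $\lambda(\theta)>0$, the conjugate points to the origin along $\gamma$ are all the points $\gamma\big(\frac{s}{\sqrt{\lambda(\theta)}}\big)$, $s>0$, where either 1. $s=2p\pi$ with $p\in\mathbb N$, or 2. $s$ is a solution of the equation $\tan\frac s2=\mu(\theta)\,s$. In the first case they are strictly isotropic and in the second case they are not isotropic. In both cases their multiplicity is $1$.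
   Context: $M^3(\kappa,\tau)$ denotes the connected, simply connected 3-dimensional Lie group whose Lie algebra has a basis $\{u_1,u_2,u_3\}$ with $[u_1,u_2]=\tau u_3$, $[u_2,u_3]=\frac{\kappa}{\tau}u_1$, $[u_3,u_1]=\frac{\kappa}{\tau}u_2$, equipped with the left-invariant Riemannian metric for which $\{u_1,u_2,u_3\}$ is orthonormal. The origin $o$ is the identity, and $\xi=u_3$ is the Hopf vector field (a unit Killing field); its integral curves, which are geodesics, are the Hopf fibers. The slope angle of a unit-speed geodesic $\gamma$ is the (constant) angle $\theta\in[0,\pi]$ between $\gamma'$ and $\xi$. $\mathbb N=\{1,2,\dots\}$. Conjugate points along a geodesic $\gamma$ with $\gamma(0)=o$ are considered at parameters $t>0$: $\gamma(t)$ is conjugate to $o$ along $\gamma$ if there is a nonzero Jacobi field along $\gamma$ vanishing at $0$ and $t$; its multiplicity is the dimension of the space of such Jacobi fields. A Jacobi field along $\gamma$ is isotropic if it is the restriction to $\gamma$ of a Killing vector field. The conjugate point $\gamma(t)$ is isotropic (along $\gamma$) if some nonzero isotropic Jacobi field along $\gamma$ vanishes at $0$ and $t$, and strictly isotropic if every Jacobi field along $\gamma$ vanishing at $0$ and $t$ is isotropic. *)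

theory Defs
  imports
    "HOL-Analysis.Analysis"
    "HOL-Algebra.Group"
    "HOL-Library.Function_Algebras"
begin

section \<open>Pointwise real vector spaces of functions\<close>

text \<open>
  Together with Function_Algebras this makes tangent vectors, vector fields and vector fields
  along a curve elements of real vector spaces, so that the library's \<^const>\<open>span\<close>,
  \<^const>\<open>independent\<close> and \<^const>\<open>dim\<close> apply to them.
\<close>

instantiation "fun" :: (type, scaleR) scaleR
begin

definition scaleR_fun :: "real \<Rightarrow> ('a \<Rightarrow> 'b) \<Rightarrow> 'a \<Rightarrow> 'b"
  where "scaleR_fun c f = (\<lambda>x. c *\<^sub>R f x)"

instance ..

end

instance "fun" :: (type, real_vector) real_vector
  by standard (simp_all add: scaleR_fun_def plus_fun_def fun_eq_iff scaleR_add_right scaleR_add_left)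


section \<open>Smooth manifolds\<close>

text \<open>All sets \<open>S\<close> below are meant to be open.\<close>

primrec Ck_on :: "nat \<Rightarrow> 'e::real_normed_vector set \<Rightarrow> ('e \<Rightarrow> 'f::real_normed_vector) \<Rightarrow> bool"
  where
    "Ck_on 0 S f \<longleftrightarrow> continuous_on S f"
  | "Ck_on (Suc k) S f \<longleftrightarrow>
       (\<forall>x\<in>S. f differentiable (at x)) \<and>
       (\<forall>v. Ck_on k S (\<lambda>x. frechet_derivative f (at x) v))"

definition smooth_on :: "'e::real_normed_vector set \<Rightarrow> ('e \<Rightarrow> 'f::real_normed_vector) \<Rightarrow> bool"
  where "smooth_on S f \<longleftrightarrow> (\<forall>k. Ck_on k S f)"

text \<open>The underlying set of a manifold is a whole type; a chart is a pair (domain, coordinate map).\<close>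

type_synonym ('a, 'e) atlas = "('a set \<times> ('a \<Rightarrow> 'e)) set"

definition smooth_atlas ::
    "('a::{t2_space, second_countable_topology}, 'e::euclidean_space) atlas \<Rightarrow> bool"
  where
    "smooth_atlas A \<longleftrightarrow>
       (\<Union>(U, \<phi>)\<in>A. U) = UNIV \<and>
       (\<forall>(U, \<phi>)\<in>A. open U \<and> open (\<phi> ` U) \<and> homeomorphism U (\<phi> ` U) \<phi> (inv_into U \<phi>)) \<and>
       (\<forall>(U, \<phi>)\<in>A. \<forall>(V, \<psi>)\<in>A. smooth_on (\<phi> ` (U \<inter> V)) (\<psi> \<circ> inv_into U \<phi>))"

definition std_atlas :: "('e, 'e) atlas"
  where "std_atlas = {(UNIV, \<lambda>x. x)}"

definition prod_atlas :: "('a, 'e) atlas \<Rightarrow> ('b, 'f) atlas \<Rightarrow> ('a \<times> 'b, 'e \<times> 'f) atlas"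
  where "prod_atlas A B = {(U \<times> V, map_prod \<phi> \<psi>) | U \<phi> V \<psi>. (U, \<phi>) \<in> A \<and> (V, \<psi>) \<in> B}"

definition smooth_map_on ::
    "('a::topological_space, 'e::euclidean_space) atlas \<Rightarrow>
     ('b::topological_space, 'f::euclidean_space) atlas \<Rightarrow> 'a set \<Rightarrow> ('a \<Rightarrow> 'b) \<Rightarrow> bool"
  where
    "smooth_map_on A B S F \<longleftrightarrow>
       continuous_on S F \<and>
       (\<forall>(U, \<phi>)\<in>A. \<forall>(V, \<psi>)\<in>B. smooth_on (\<phi> ` (U \<inter> S \<inter> F -` V)) (\<psi> \<circ> F \<circ> inv_into U \<phi>))"

abbreviation smooth_fun_on ::
    "('a::topological_space, 'e::euclidean_space) atlas \<Rightarrow> 'a set \<Rightarrow> ('a \<Rightarrow> real) \<Rightarrow> bool"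
  where "smooth_fun_on A S f \<equiv> smooth_map_on A std_atlas S f"

definition smooth_near ::
    "('a::topological_space, 'e::euclidean_space) atlas \<Rightarrow> 'a \<Rightarrow> ('a \<Rightarrow> real) \<Rightarrow> bool"
  where "smooth_near A p f \<longleftrightarrow> (\<exists>W. open W \<and> p \<in> W \<and> smooth_fun_on A W f)"

definition smooth_curve ::
    "('a::topological_space, 'e::euclidean_space) atlas \<Rightarrow> (real \<Rightarrow> 'a) \<Rightarrow> bool"
  where "smooth_curve A \<gamma> \<longleftrightarrow> smooth_map_on std_atlas A UNIV \<gamma>"


section \<open>Tangent vectors and vector fields\<close>

text \<open>
  A tangent vector at \<open>p\<close> is identified with the directional derivative it induces on functions
  that are smooth near \<open>p\<close>. It is set to 0 on all other functions, so that equality of tangent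
  vectors is equality of functionals.
\<close>

type_synonym 'a tvec = "('a \<Rightarrow> real) \<Rightarrow> real"
type_synonym 'a vfield = "'a \<Rightarrow> 'a tvec"
type_synonym 'a curve_vfield = "real \<Rightarrow> 'a tvec"
type_synonym 'a metric = "'a \<Rightarrow> 'a tvec \<Rightarrow> 'a tvec \<Rightarrow> real"
type_synonym 'a connection = "'a vfield \<Rightarrow> 'a vfield \<Rightarrow> 'a vfield"

definition tangent_space ::
    "('a::topological_space, 'e::euclidean_space) atlas \<Rightarrow> 'a \<Rightarrow> 'a tvec set"
  where
    "tangent_space A p =
       {(\<lambda>f. if smooth_near A p f
              then frechet_derivative (f \<circ> inv_into U \<phi>) (at (\<phi> p)) c else 0)
         | U \<phi> c. (U, \<phi>) \<in> A \<and> p \<in> U}"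

definition vector_fields ::
    "('a::topological_space, 'e::euclidean_space) atlas \<Rightarrow> 'a vfield set"
  where
    "vector_fields A =
       {X. (\<forall>p. X p \<in> tangent_space A p) \<and>
           (\<forall>W f. open W \<and> smooth_fun_on A W f \<longrightarrow> smooth_fun_on A W (\<lambda>p. X p f))}"

definition fmult :: "('b \<Rightarrow> real) \<Rightarrow> ('b \<Rightarrow> 'a tvec) \<Rightarrow> 'b \<Rightarrow> 'a tvec"
  where "fmult f X = (\<lambda>p. f p *\<^sub>R X p)"

definition lie_bracket ::
    "('a::topological_space, 'e::euclidean_space) atlas \<Rightarrow> 'a vfield \<Rightarrow> 'a vfield \<Rightarrow> 'a vfield"
  where
    "lie_bracket A X Y =
       (\<lambda>p f. if smooth_near A p f then X p (\<lambda>q. Y q f) - Y p (\<lambda>q. X q f) else 0)"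

definition velocity ::
    "('a::topological_space, 'e::euclidean_space) atlas \<Rightarrow> (real \<Rightarrow> 'a) \<Rightarrow> 'a curve_vfield"
  where
    "velocity A \<gamma> = (\<lambda>t f. if smooth_near A (\<gamma> t) f then deriv (f \<circ> \<gamma>) t else 0)"

definition vector_fields_along ::
    "('a::topological_space, 'e::euclidean_space) atlas \<Rightarrow> (real \<Rightarrow> 'a) \<Rightarrow> 'a curve_vfield set"
  where
    "vector_fields_along A \<gamma> =
       {V. (\<forall>t. V t \<in> tangent_space A (\<gamma> t)) \<and>
           (\<forall>W f. open W \<and> smooth_fun_on A W f \<longrightarrow> smooth_on (\<gamma> -` W) (\<lambda>t. V t f))}"


section \<open>Riemannian metrics and the Levi-Civita connection\<close>

definition riemannian_metric ::
    "('a::topological_space, 'e::euclidean_space) atlas \<Rightarrow> 'a metric \<Rightarrow> bool"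
  where
    "riemannian_metric A g \<longleftrightarrow>
       (\<forall>p. \<forall>v\<in>tangent_space A p. \<forall>w\<in>tangent_space A p.
          g p v w = g p w v \<and>
          (\<forall>x\<in>tangent_space A p. \<forall>a b. g p (a *\<^sub>R v + b *\<^sub>R w) x = a * g p v x + b * g p w x) \<and>
          (v \<noteq> 0 \<longrightarrow> g p v v > 0)) \<and>
       (\<forall>X\<in>vector_fields A. \<forall>Y\<in>vector_fields A. smooth_fun_on A UNIV (\<lambda>p. g p (X p) (Y p)))"

definition affine_connection ::
    "('a::topological_space, 'e::euclidean_space) atlas \<Rightarrow> 'a connection \<Rightarrow> bool"
  where
    "affine_connection A D \<longleftrightarrow>
       (\<forall>X\<in>vector_fields A. \<forall>Y\<in>vector_fields A. D X Y \<in> vector_fields A) \<and>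
       (\<forall>X\<in>vector_fields A. \<forall>X'\<in>vector_fields A. \<forall>Y\<in>vector_fields A.
          D (X + X') Y = D X Y + D X' Y \<and> D Y (X + X') = D Y X + D Y X') \<and>
       (\<forall>f. \<forall>X\<in>vector_fields A. \<forall>Y\<in>vector_fields A. smooth_fun_on A UNIV f \<longrightarrow>
          D (fmult f X) Y = fmult f (D X Y) \<and>
          D X (fmult f Y) = fmult (\<lambda>p. X p f) Y + fmult f (D X Y))"

definition torsion_free ::
    "('a::topological_space, 'e::euclidean_space) atlas \<Rightarrow> 'a connection \<Rightarrow> bool"
  where
    "torsion_free A D \<longleftrightarrow>
       (\<forall>X\<in>vector_fields A. \<forall>Y\<in>vector_fields A. D X Y - D Y X = lie_bracket A X Y)"

definition metric_connection ::
    "('a::topological_space, 'e::euclidean_space) atlas \<Rightarrow> 'a metric \<Rightarrow> 'a connection \<Rightarrow> bool"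
  where
    "metric_connection A g D \<longleftrightarrow>
       (\<forall>X\<in>vector_fields A. \<forall>Y\<in>vector_fields A. \<forall>Z\<in>vector_fields A. \<forall>p.
          X p (\<lambda>q. g q (Y q) (Z q)) = g p (D X Y p) (Z p) + g p (Y p) (D X Z p))"

text \<open>
  The last condition only normalises the operator outside the smooth vector fields, which makes
  the description definite.
\<close>

definition levi_civita ::
    "('a::topological_space, 'e::euclidean_space) atlas \<Rightarrow> 'a metric \<Rightarrow> 'a connection"
  where
    "levi_civita A g =
       (THE D. affine_connection A D \<and> torsion_free A D \<and> metric_connection A g D \<and>
               (\<forall>X Y. X \<notin> vector_fields A \<or> Y \<notin> vector_fields A \<longrightarrow> D X Y = 0))"

text \<open>\<open>connection_at A D p v X\<close> is the derivative of \<open>X\<close> in the direction of the vector \<open>v\<close> at \<open>p\<close>.\<close>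

definition connection_at ::
    "('a::topological_space, 'e::euclidean_space) atlas \<Rightarrow> 'a connection \<Rightarrow>
     'a \<Rightarrow> 'a tvec \<Rightarrow> 'a vfield \<Rightarrow> 'a tvec"
  where
    "connection_at A D p v X = (THE w. \<exists>Y\<in>vector_fields A. Y p = v \<and> w = D Y X p)"

definition curvature ::
    "('a::topological_space, 'e::euclidean_space) atlas \<Rightarrow> 'a connection \<Rightarrow>
     'a vfield \<Rightarrow> 'a vfield \<Rightarrow> 'a vfield \<Rightarrow> 'a vfield"
  where
    "curvature A D X Y Z = D X (D Y Z) - D Y (D X Z) - D (lie_bracket A X Y) Z"

definition curvature_at ::
    "('a::topological_space, 'e::euclidean_space) atlas \<Rightarrow> 'a connection \<Rightarrow>
     'a \<Rightarrow> 'a tvec \<Rightarrow> 'a tvec \<Rightarrow> 'a tvec \<Rightarrow> 'a tvec"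
  where
    "curvature_at A D p x y z =
       (THE w. \<exists>X\<in>vector_fields A. \<exists>Y\<in>vector_fields A. \<exists>Z\<in>vector_fields A.
          X p = x \<and> Y p = y \<and> Z p = z \<and> w = curvature A D X Y Z p)"

text \<open>
  The covariant derivative along a curve is the unique additive operator on the smooth vector
  fields along the curve that satisfies the product rule and agrees with the connection on
  restrictions of vector fields of the manifold.
\<close>

definition is_covariant_derivative_along ::
    "('a::topological_space, 'e::euclidean_space) atlas \<Rightarrow> 'a connection \<Rightarrow> (real \<Rightarrow> 'a) \<Rightarrow>
     ('a curve_vfield \<Rightarrow> 'a curve_vfield) \<Rightarrow> bool"
  where
    "is_covariant_derivative_along A D \<gamma> Dt \<longleftrightarrow>
       (\<forall>V\<in>vector_fields_along A \<gamma>. Dt V \<in> vector_fields_along A \<gamma>) \<and>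
       (\<forall>V\<in>vector_fields_along A \<gamma>. \<forall>W\<in>vector_fields_along A \<gamma>. Dt (V + W) = Dt V + Dt W) \<and>
       (\<forall>f. \<forall>V\<in>vector_fields_along A \<gamma>. smooth_on UNIV f \<longrightarrow>
          Dt (fmult f V) = fmult (deriv f) V + fmult f (Dt V)) \<and>
       (\<forall>X\<in>vector_fields A. \<forall>t. Dt (\<lambda>t. X (\<gamma> t)) t = connection_at A D (\<gamma> t) (velocity A \<gamma> t) X) \<and>
       (\<forall>V. V \<notin> vector_fields_along A \<gamma> \<longrightarrow> Dt V = 0)"

definition covariant_derivative_along ::
    "('a::topological_space, 'e::euclidean_space) atlas \<Rightarrow> 'a metric \<Rightarrow> (real \<Rightarrow> 'a) \<Rightarrow>
     'a curve_vfield \<Rightarrow> 'a curve_vfield"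
  where
    "covariant_derivative_along A g \<gamma> =
       (THE Dt. is_covariant_derivative_along A (levi_civita A g) \<gamma> Dt)"


section \<open>Geodesics, Jacobi fields, Killing fields and conjugate points\<close>

definition geodesic ::
    "('a::topological_space, 'e::euclidean_space) atlas \<Rightarrow> 'a metric \<Rightarrow> (real \<Rightarrow> 'a) \<Rightarrow> bool"
  where
    "geodesic A g \<gamma> \<longleftrightarrow>
       smooth_curve A \<gamma> \<and> covariant_derivative_along A g \<gamma> (velocity A \<gamma>) = 0"

definition unit_speed ::
    "('a::topological_space, 'e::euclidean_space) atlas \<Rightarrow> 'a metric \<Rightarrow> (real \<Rightarrow> 'a) \<Rightarrow> bool"
  where
    "unit_speed A g \<gamma> \<longleftrightarrow> (\<forall>t. g (\<gamma> t) (velocity A \<gamma> t) (velocity A \<gamma> t) = 1)"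

definition jacobi_field ::
    "('a::topological_space, 'e::euclidean_space) atlas \<Rightarrow> 'a metric \<Rightarrow> (real \<Rightarrow> 'a) \<Rightarrow>
     'a curve_vfield \<Rightarrow> bool"
  where
    "jacobi_field A g \<gamma> J \<longleftrightarrow>
       J \<in> vector_fields_along A \<gamma> \<and>
       (\<forall>t. covariant_derivative_along A g \<gamma> (covariant_derivative_along A g \<gamma> J) t +
            curvature_at A (levi_civita A g) (\<gamma> t) (J t) (velocity A \<gamma> t) (velocity A \<gamma> t) = 0)"

text \<open>A Killing field is a vector field along which the Lie derivative of the metric vanishes.\<close>

definition killing_field ::
    "('a::topological_space, 'e::euclidean_space) atlas \<Rightarrow> 'a metric \<Rightarrow> 'a vfield \<Rightarrow> bool"
  where
    "killing_field A g K \<longleftrightarrow>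
       K \<in> vector_fields A \<and>
       (\<forall>X\<in>vector_fields A. \<forall>Y\<in>vector_fields A. \<forall>p.
          K p (\<lambda>q. g q (X q) (Y q)) =
          g p (lie_bracket A K X p) (Y p) + g p (X p) (lie_bracket A K Y p))"

definition isotropic_jacobi_field ::
    "('a::topological_space, 'e::euclidean_space) atlas \<Rightarrow> 'a metric \<Rightarrow> (real \<Rightarrow> 'a) \<Rightarrow>
     'a curve_vfield \<Rightarrow> bool"
  where
    "isotropic_jacobi_field A g \<gamma> J \<longleftrightarrow>
       jacobi_field A g \<gamma> J \<and> (\<exists>K. killing_field A g K \<and> J = (\<lambda>t. K (\<gamma> t)))"

definition vanishing_jacobi_fields ::
    "('a::topological_space, 'e::euclidean_space) atlas \<Rightarrow> 'a metric \<Rightarrow> (real \<Rightarrow> 'a) \<Rightarrow> real \<Rightarrow>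
     'a curve_vfield set"
  where
    "vanishing_jacobi_fields A g \<gamma> t = {J. jacobi_field A g \<gamma> J \<and> J 0 = 0 \<and> J t = 0}"

text \<open>Conjugacy always refers to the initial point \<open>\<gamma> 0\<close>.\<close>

definition conjugate_at ::
    "('a::topological_space, 'e::euclidean_space) atlas \<Rightarrow> 'a metric \<Rightarrow> (real \<Rightarrow> 'a) \<Rightarrow> real \<Rightarrow> bool"
  where
    "conjugate_at A g \<gamma> t \<longleftrightarrow> t > 0 \<and> (\<exists>J\<in>vanishing_jacobi_fields A g \<gamma> t. J \<noteq> 0)"

definition conj_mult ::
    "('a::topological_space, 'e::euclidean_space) atlas \<Rightarrow> 'a metric \<Rightarrow> (real \<Rightarrow> 'a) \<Rightarrow> real \<Rightarrow> nat"
  where "conj_mult A g \<gamma> t = dim (vanishing_jacobi_fields A g \<gamma> t)"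

definition isotropic_at ::
    "('a::topological_space, 'e::euclidean_space) atlas \<Rightarrow> 'a metric \<Rightarrow> (real \<Rightarrow> 'a) \<Rightarrow> real \<Rightarrow> bool"
  where
    "isotropic_at A g \<gamma> t \<longleftrightarrow>
       conjugate_at A g \<gamma> t \<and>
       (\<exists>J\<in>vanishing_jacobi_fields A g \<gamma> t. J \<noteq> 0 \<and> isotropic_jacobi_field A g \<gamma> J)"

definition strictly_isotropic_at ::
    "('a::topological_space, 'e::euclidean_space) atlas \<Rightarrow> 'a metric \<Rightarrow> (real \<Rightarrow> 'a) \<Rightarrow> real \<Rightarrow> bool"
  where
    "strictly_isotropic_at A g \<gamma> t \<longleftrightarrow>
       conjugate_at A g \<gamma> t \<and>
       (\<forall>J\<in>vanishing_jacobi_fields A g \<gamma> t. isotropic_jacobi_field A g \<gamma> J)"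


section \<open>The Lie groups with left-invariant metric\<close>

definition lie_group ::
    "('a::{t2_space, second_countable_topology}, 'e::euclidean_space) atlas \<Rightarrow> 'a monoid \<Rightarrow> bool"
  where
    "lie_group A G \<longleftrightarrow>
       smooth_atlas A \<and> group G \<and> carrier G = UNIV \<and>
       smooth_map_on (prod_atlas A A) A UNIV (\<lambda>(x, y). x \<otimes>\<^bsub>G\<^esub> y) \<and>
       smooth_map_on A A UNIV (\<lambda>x. inv\<^bsub>G\<^esub> x)"

text \<open>
  The differential of the left translation by \<open>a\<close>. It respects the normalisation of tangent
  vectors because a left translation is a diffeomorphism.
\<close>

definition left_push :: "'a monoid \<Rightarrow> 'a \<Rightarrow> 'a tvec \<Rightarrow> 'a tvec"
  where "left_push G a v = (\<lambda>f. v (\<lambda>q. f (a \<otimes>\<^bsub>G\<^esub> q)))"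

definition lie_algebra ::
    "('a::topological_space, 'e::euclidean_space) atlas \<Rightarrow> 'a monoid \<Rightarrow> 'a vfield set"
  where
    "lie_algebra A G = {X \<in> vector_fields A. \<forall>a p. X (a \<otimes>\<^bsub>G\<^esub> p) = left_push G a (X p)}"

definition left_invariant_metric ::
    "('a::topological_space, 'e::euclidean_space) atlas \<Rightarrow> 'a monoid \<Rightarrow> 'a metric \<Rightarrow> bool"
  where
    "left_invariant_metric A G g \<longleftrightarrow>
       riemannian_metric A g \<and>
       (\<forall>a p. \<forall>v\<in>tangent_space A p. \<forall>w\<in>tangent_space A p.
          g (a \<otimes>\<^bsub>G\<^esub> p) (left_push G a v) (left_push G a w) = g p v w)"

text \<open>
  The space is determined by \<open>\<kappa>\<close> and \<open>\<tau>\<close> only up to isometric isomorphism; the predicate holds for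
  every realisation of it.
\<close>

definition M3 ::
    "real \<Rightarrow> real \<Rightarrow> ('a::{t2_space, second_countable_topology}, real^3) atlas \<Rightarrow> 'a monoid \<Rightarrow>
     'a vfield \<Rightarrow> 'a vfield \<Rightarrow> 'a vfield \<Rightarrow> 'a metric \<Rightarrow> bool"
  where
    "M3 \<kappa> \<tau> A G u1 u2 u3 g \<longleftrightarrow>
       lie_group A G \<and> connected (UNIV :: 'a set) \<and> simply_connected (UNIV :: 'a set) \<and>
       distinct [u1, u2, u3] \<and> independent {u1, u2, u3} \<and> span {u1, u2, u3} = lie_algebra A G \<and>
       lie_bracket A u1 u2 = \<tau> *\<^sub>R u3 \<and>
       lie_bracket A u2 u3 = (\<kappa> / \<tau>) *\<^sub>R u1 \<and>
       lie_bracket A u3 u1 = (\<kappa> / \<tau>) *\<^sub>R u2 \<and>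
       left_invariant_metric A G g \<and>
       (\<forall>p. g p (u1 p) (u1 p) = 1 \<and> g p (u2 p) (u2 p) = 1 \<and> g p (u3 p) (u3 p) = 1 \<and>
            g p (u1 p) (u2 p) = 0 \<and> g p (u2 p) (u3 p) = 0 \<and> g p (u3 p) (u1 p) = 0)"

text \<open>
  For a geodesic the angle with the Killing field \<open>\<xi>\<close> (of constant length) does not depend on the
  parameter, so it is read off at 0.
\<close>

definition slope_angle ::
    "('a::topological_space, 'e::euclidean_space) atlas \<Rightarrow> 'a metric \<Rightarrow> 'a vfield \<Rightarrow>
     (real \<Rightarrow> 'a) \<Rightarrow> real"
  where
    "slope_angle A g \<xi> \<gamma> =
       (let p = \<gamma> 0; v = velocity A \<gamma> 0
        in arccos (g p v (\<xi> p) / (sqrt (g p v v) * sqrt (g p (\<xi> p) (\<xi> p)))))"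

definition slope_lambda :: "real \<Rightarrow> real \<Rightarrow> real \<Rightarrow> real"
  where "slope_lambda \<kappa> \<tau> \<theta> = \<kappa> * (sin \<theta>)\<^sup>2 + \<tau>\<^sup>2 * (cos \<theta>)\<^sup>2"

definition slope_mu :: "real \<Rightarrow> real \<Rightarrow> real \<Rightarrow> real"
  where "slope_mu \<kappa> \<tau> \<theta> = (\<tau>\<^sup>2 - \<kappa>) / (2 * \<tau>\<^sup>2) * (sin \<theta>)\<^sup>2"

text \<open>
  Solutions of \<open>tan (s/2) = m s\<close>. Since \<^const>\<open>tan\<close> is totalised by 0 at its poles, these are
  excluded explicitly.
\<close>

definition tan_solution :: "real \<Rightarrow> real \<Rightarrow> bool"
  where "tan_solution m s \<longleftrightarrow> cos (s / 2) \<noteq> 0 \<and> tan (s / 2) = m * s"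

end

theory Submission
  imports Defs
begin

text \<open>
  With \<open>c = \<kappa> / \<tau>\<close>, \<open>S = sin \<theta>\<close>, \<open>C = cos \<theta>\<close>, the Jacobi equation along \<open>\<gamma>\<close>, written in a frame that
  rotates with the horizontal part of \<open>\<gamma>'\<close>, has constant coefficients and two first integrals. A
  Jacobi field vanishing at \<open>0\<close> and at a second point is orthogonal to \<open>\<gamma>'\<close>, and is then given by
  functions \<open>q\<close>, \<open>\<rho>\<close> with \<open>q'' + \<lambda> q = \<tau> w\<close> and \<open>\<rho>' = w - \<tau> q\<close>, where \<open>w\<close> is constant. For \<open>\<lambda> \<le> 0\<close> a
  monotone quantity excludes conjugate points. For \<open>\<lambda> > 0\<close> the solutions are explicit, and vanishing
  at \<open>s / \<surd>\<lambda>\<close> is a linear \<open>2 \<times> 2\<close> system of determinant \<open>- 4 sin (s/2) (sin (s/2) - \<mu> s cos (s/2))\<close>.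

  The isotropic Jacobi fields are those with \<open>w = 0\<close> and \<open>q' (0)\<close> a multiple of \<open>S\<close>: since \<open>\<kappa> \<noteq> \<tau>\<^sup>2\<close>,
  every Killing field commutes with \<open>\<xi>\<close>, and there is a Killing field that rotates about \<open>\<xi>\<close> and
  vanishes at the origin.
\<close>

section \<open>Calculus of smooth maps\<close>

text \<open>\<open>M3\<close> supplies no coordinates, only a Lie group with a left-invariant
  orthonormal frame and its brackets. As the frame is global, every field is a triple of smooth
  coefficients and every tangent vector extends with constant coefficients. The definite
  descriptions behind connection, curvature and covariant derivative can thus be evaluated without
  cut-off functions, and the geometry becomes algebra of cross products. The constant
  \<open>w\<close> has a meaning. Since \<open>\<xi>\<close> is Killing, its product with the
  velocity is constant along each geodesic. The first variation of that product is the first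
  integral \<open>a = r' + \<tau> S q\<close>, and \<open>a = S w\<close> for Jacobi fields
  orthogonal to the geodesic. So for \<open>S \<noteq> 0\<close>, \<open>w = 0\<close> says that the
  slope angle is unchanged to first order. Rotations about \<open>\<xi>\<close> have this property.
  For \<open>S \<noteq> 0\<close> it holds for the solutions belonging to
  \<open>sin (s/2) = 0\<close> and fails for those of the tangent equation. Right-invariant fields
  are Killing because their flows are left translations. The rotation about \<open>\<xi>\<close>
  vanishes at the identity, so it is not among them and has to be assembled from them.\<close>

lemma Ck_on_Suc_has_derivative:
  "Ck_on (Suc k) S f \<Longrightarrow> x \<in> S \<Longrightarrow> (f has_derivative frechet_derivative f (at x)) (at x)"
  by (simp add: frechet_derivative_works)

lemma Ck_on_subset: "Ck_on k S f \<Longrightarrow> T \<subseteq> S \<Longrightarrow> Ck_on k T f"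
  by (induction k arbitrary: f) (auto intro: continuous_on_subset)

text \<open>On an open set, agreement on \<open>S\<close> is agreement near each of its points, so
  the derivatives agree as well. Derivative formulas that are valid only on \<open>S\<close> enter
  the inductions below through this.\<close>

lemma Ck_on_cong:
  assumes "open S" "\<And>x. x \<in> S \<Longrightarrow> f x = g x" "Ck_on k S f"
  shows "Ck_on k S g"
  using assms(2,3)
proof (induction k arbitrary: f g)
  case 0
  then show ?case
    using continuous_on_cong[of S S f g] by simp
next
  case (Suc k)
  have d: "(g has_derivative frechet_derivative f (at x)) (at x)" if "x \<in> S" for x
    by (rule has_derivative_transform_within_open[OF Ck_on_Suc_has_derivative[OF Suc.prems(2) that]
          assms(1) that Suc.prems(1)])
  have e: "frechet_derivative g (at x) = frechet_derivative f (at x)" if "x \<in> S" for x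
    using frechet_derivative_at[OF d[OF that]] by simp
  have "Ck_on k S (\<lambda>x. frechet_derivative g (at x) v)" for v
    by (rule Suc.IH[of "\<lambda>x. frechet_derivative f (at x) v"]) (use Suc.prems(2) e in auto)
  then show ?case
    using d by (auto simp: differentiable_def)
qed

lemma Ck_on_Suc_imp: "Ck_on (Suc k) S f \<Longrightarrow> Ck_on k S f"
proof (induction k arbitrary: f)
  case 0
  then show ?case
    by (auto intro!: continuous_at_imp_continuous_on differentiable_imp_continuous_within)
next
  case (Suc k)
  then show ?case
    unfolding Ck_on.simps(2)[of _ S f] by blast
qed

text \<open>\<open>frechet_derivative f (at x)\<close> refers to full neighbourhoods and never to
  \<open>S\<close>, so the pieces \<open>T\<close> share one derivative function and smoothness
  glues.\<close>

lemma Ck_on_local: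
  assumes "\<And>x. x \<in> S \<Longrightarrow> \<exists>T. open T \<and> x \<in> T \<and> Ck_on k T f"
  shows "Ck_on k S f"
  using assms
proof (induction k arbitrary: f)
  case 0
  show ?case
    unfolding Ck_on.simps
  proof (intro continuous_at_imp_continuous_on ballI)
    fix x assume "x \<in> S"
    with 0 obtain T where "open T" "x \<in> T" "continuous_on T f"
      by auto
    then show "isCont f x"
      using continuous_on_eq_continuous_at by blast
  qed
next
  case (Suc k)
  have "Ck_on k S (\<lambda>x. frechet_derivative f (at x) v)" for v
    using Suc.prems by (intro Suc.IH) fastforce
  then show ?case
    using Suc.prems by fastforce
qed

lemma Ck_on_const: "Ck_on k S (\<lambda>x. c)"
  by (induction k arbitrary: c) auto

lemma Ck_on_bounded_linear:
  assumes "open S" "bounded_linear h" "Ck_on k S f"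
  shows "Ck_on k S (\<lambda>x. h (f x))"
  using assms(3)
proof (induction k arbitrary: f)
  case 0
  then show ?case
    using bounded_linear.continuous_on[OF assms(2)] by simp
next
  case (Suc k)
  have d: "((\<lambda>x. h (f x)) has_derivative (\<lambda>v. h (frechet_derivative f (at x) v))) (at x)"
    if "x \<in> S" for x
    by (rule bounded_linear.has_derivative[OF assms(2) Ck_on_Suc_has_derivative[OF Suc.prems that]])
  have "Ck_on k S (\<lambda>x. frechet_derivative (\<lambda>x. h (f x)) (at x) v)" for v
    by (rule Ck_on_cong[OF assms(1), of "\<lambda>x. h (frechet_derivative f (at x) v)"])
      (use Suc frechet_derivative_at[OF d] in \<open>auto dest: fun_cong\<close>)
  then show ?case
    using d by (auto simp: differentiable_def)
qed

lemma Ck_on_add: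
  assumes "open S" "Ck_on k S f" "Ck_on k S g"
  shows "Ck_on k S (\<lambda>x. f x + g x)"
  using assms(2,3)
proof (induction k arbitrary: f g)
  case 0
  then show ?case
    by (auto intro: continuous_intros)
next
  case (Suc k)
  have d: "((\<lambda>x. f x + g x) has_derivative
      (\<lambda>v. frechet_derivative f (at x) v + frechet_derivative g (at x) v)) (at x)"
    if "x \<in> S" for x
    using Suc.prems that by (auto intro!: has_derivative_add simp: frechet_derivative_works)
  have "Ck_on k S (\<lambda>x. frechet_derivative (\<lambda>x. f x + g x) (at x) v)" for v
    by (rule Ck_on_cong[OF assms(1), of
          "\<lambda>x. frechet_derivative f (at x) v + frechet_derivative g (at x) v"])
      (use Suc frechet_derivative_at[OF d] in \<open>auto dest: fun_cong\<close>)
  then show ?case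
    using d by (auto simp: differentiable_def)
qed

lemma Ck_on_bounded_bilinear:
  assumes "open S" "bounded_bilinear h" "Ck_on k S f" "Ck_on k S g"
  shows "Ck_on k S (\<lambda>x. h (f x) (g x))"
  using assms(3,4)
proof (induction k arbitrary: f g)
  case 0
  then show ?case
    using bounded_bilinear.continuous_on[OF assms(2)] by simp
next
  case (Suc k)
  have d: "((\<lambda>x. h (f x) (g x)) has_derivative
      (\<lambda>v. h (f x) (frechet_derivative g (at x) v) + h (frechet_derivative f (at x) v) (g x))) (at x)"
    if "x \<in> S" for x
    using Suc.prems that
    by (intro bounded_bilinear.FDERIV[OF assms(2)]) (auto simp: frechet_derivative_works)
  have "Ck_on k S (\<lambda>x. frechet_derivative (\<lambda>x. h (f x) (g x)) (at x) v)" for v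
  proof (rule Ck_on_cong[OF assms(1)])
    show "Ck_on k S (\<lambda>x. h (f x) (frechet_derivative g (at x) v) +
        h (frechet_derivative f (at x) v) (g x))"
      using Suc.prems Ck_on_Suc_imp[OF Suc.prems(1)] Ck_on_Suc_imp[OF Suc.prems(2)]
      by (intro Ck_on_add[OF assms(1)] Suc.IH) auto
  qed (use frechet_derivative_at[OF d] in \<open>auto dest: fun_cong\<close>)
  then show ?case
    using d by (auto simp: differentiable_def)
qed

lemma Ck_on_sum:
  assumes "open S" "finite I" "\<And>i. i \<in> I \<Longrightarrow> Ck_on k S (f i)"
  shows "Ck_on k S (\<lambda>x. \<Sum>i\<in>I. f i x)"
  using assms(2,3) by (induction I) (auto intro!: Ck_on_const Ck_on_add[OF assms(1)])

text \<open>In the chain rule the outer derivative is applied to a vector that varies with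
  \<open>x\<close>, while the induction hypothesis speaks of fixed directions. Expanding that vector
  in \<open>Basis\<close> separates the two: each summand is a scalar function times
  \<open>frechet_derivative g _ b\<close> composed with \<open>f\<close>.\<close>

lemma Ck_on_compose:
  fixes f :: "'e::euclidean_space \<Rightarrow> 'f::euclidean_space" and g :: "'f \<Rightarrow> 'g::real_normed_vector"
  assumes "open S" "open T" "f ` S \<subseteq> T" "Ck_on k S f" "Ck_on k T g"
  shows "Ck_on k S (\<lambda>x. g (f x))"
  using assms(4,5)
proof (induction k arbitrary: g)
  case 0
  then show ?case
    using continuous_on_compose2[of T g S f] assms(3) by auto
next
  case (Suc k)
  have d: "((\<lambda>x. g (f x)) has_derivative
      (\<lambda>v. frechet_derivative g (at (f x)) (frechet_derivative f (at x) v))) (at x)"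
    if "x \<in> S" for x
    using Suc.prems that assms(3) diff_chain_at[of f "frechet_derivative f (at x)" x g
        "frechet_derivative g (at (f x))"]
    by (auto simp: frechet_derivative_works o_def image_subset_iff)
  have lin: "linear (frechet_derivative g (at (f x)))" if "x \<in> S" for x
    using Suc.prems(2) that assms(3) by (intro linear_frechet_derivative) (auto simp: image_subset_iff)
  have "Ck_on k S (\<lambda>x. frechet_derivative (\<lambda>x. g (f x)) (at x) v)" for v
  proof (rule Ck_on_cong[OF assms(1)])
    show "Ck_on k S (\<lambda>x. \<Sum>b\<in>Basis. (frechet_derivative f (at x) v \<bullet> b) *\<^sub>R
        frechet_derivative g (at (f x)) b)"
      using Suc.prems Ck_on_Suc_imp[OF Suc.prems(1)]
      by (intro Ck_on_sum[OF assms(1)] Ck_on_bounded_bilinear[OF assms(1) bounded_bilinear_scaleR]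
          Ck_on_bounded_linear[OF assms(1) bounded_linear_inner_left] Suc.IH) auto
    fix x assume x: "x \<in> S"
    have "frechet_derivative (\<lambda>x. g (f x)) (at x) v
        = frechet_derivative g (at (f x)) (frechet_derivative f (at x) v)"
      using frechet_derivative_at[OF d[OF x]] by (metis)
    also have "\<dots> = frechet_derivative g (at (f x))
        (\<Sum>b\<in>Basis. (frechet_derivative f (at x) v \<bullet> b) *\<^sub>R b)"
      by (simp add: euclidean_representation)
    also have "\<dots> = (\<Sum>b\<in>Basis. (frechet_derivative f (at x) v \<bullet> b) *\<^sub>R
        frechet_derivative g (at (f x)) b)"
      by (simp add: linear_sum[OF lin[OF x]] linear_scale[OF lin[OF x]])
    finally show "(\<Sum>b\<in>Basis. (frechet_derivative f (at x) v \<bullet> b) *\<^sub>R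
        frechet_derivative g (at (f x)) b) = frechet_derivative (\<lambda>x. g (f x)) (at x) v" ..
  qed
  then show ?case
    using d by (auto simp: differentiable_def)
qed

lemma Ck_on_inverse:
  fixes f :: "'e::real_normed_vector \<Rightarrow> real"
  assumes "open S" "Ck_on k S f" "\<And>x. x \<in> S \<Longrightarrow> f x \<noteq> 0"
  shows "Ck_on k S (\<lambda>x. inverse (f x))"
  using assms(2)
proof (induction k)
  case 0
  then show ?case
    using assms(3) by (auto intro!: continuous_intros)
next
  case (Suc k)
  have d: "((\<lambda>x. inverse (f x)) has_derivative
      (\<lambda>v. - (inverse (f x) * frechet_derivative f (at x) v * inverse (f x)))) (at x)"
    if "x \<in> S" for x
    using Suc.prems that assms(3)
    by (intro Deriv.has_derivative_inverse) (auto simp: frechet_derivative_works)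
  have "Ck_on k S (\<lambda>x. frechet_derivative (\<lambda>x. inverse (f x)) (at x) v)" for v
  proof (rule Ck_on_cong[OF assms(1)])
    \<comment> \<open>The derivative contains \<open>inverse (f x)\<close> itself; at order
      \<open>k\<close> it is covered by the induction hypothesis.\<close>
    have "Ck_on k S (\<lambda>x. inverse (f x))"
      using Suc Ck_on_Suc_imp by blast
    then show "Ck_on k S (\<lambda>x. - (inverse (f x) * frechet_derivative f (at x) v * inverse (f x)))"
      using Suc.prems
      by (intro Ck_on_bounded_linear[OF assms(1) bounded_linear_minus[OF bounded_linear_ident]]
          Ck_on_bounded_bilinear[OF assms(1) bounded_bilinear_mult]) auto
  qed (use frechet_derivative_at[OF d] in \<open>auto dest: fun_cong\<close>)
  then show ?case
    using d by (auto simp: differentiable_def)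
qed

section \<open>Smooth functions on open sets\<close>

lemma smooth_on_subset: "smooth_on S f \<Longrightarrow> T \<subseteq> S \<Longrightarrow> smooth_on T f"
  unfolding smooth_on_def using Ck_on_subset by blast

lemma smooth_on_cong: "open S \<Longrightarrow> (\<And>x. x \<in> S \<Longrightarrow> f x = g x) \<Longrightarrow> smooth_on S f \<Longrightarrow> smooth_on S g"
  unfolding smooth_on_def using Ck_on_cong by blast

lemma smooth_on_local:
  assumes "\<And>x. x \<in> S \<Longrightarrow> \<exists>T. open T \<and> x \<in> T \<and> smooth_on T f"
  shows "smooth_on S f"
  using assms unfolding smooth_on_def by (intro allI Ck_on_local) blast

lemma smooth_on_const: "smooth_on S (\<lambda>x. c)"
  by (simp add: smooth_on_def Ck_on_const)

lemma smooth_on_ident: "smooth_on S (\<lambda>x. x)"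
  unfolding smooth_on_def
proof
  fix k show "Ck_on k S (\<lambda>x. x)"
    by (cases k) (auto simp: frechet_derivative_ident Ck_on_const)
qed

lemma smooth_on_bounded_linear:
  "open S \<Longrightarrow> bounded_linear h \<Longrightarrow> smooth_on S f \<Longrightarrow> smooth_on S (\<lambda>x. h (f x))"
  by (simp add: smooth_on_def Ck_on_bounded_linear)

lemma smooth_on_add: "open S \<Longrightarrow> smooth_on S f \<Longrightarrow> smooth_on S g \<Longrightarrow> smooth_on S (\<lambda>x. f x + g x)"
  by (simp add: smooth_on_def Ck_on_add)

lemma smooth_on_minus: "open S \<Longrightarrow> smooth_on S f \<Longrightarrow> smooth_on S (\<lambda>x. - f x)"
  using smooth_on_bounded_linear[OF _ bounded_linear_minus[OF bounded_linear_ident]] .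

lemma smooth_on_diff: "open S \<Longrightarrow> smooth_on S f \<Longrightarrow> smooth_on S g \<Longrightarrow> smooth_on S (\<lambda>x. f x - g x)"
  using smooth_on_add[of S f "\<lambda>x. - g x"] smooth_on_minus by auto

lemma smooth_on_mult:
  fixes f g :: "'e::real_normed_vector \<Rightarrow> real"
  shows "open S \<Longrightarrow> smooth_on S f \<Longrightarrow> smooth_on S g \<Longrightarrow> smooth_on S (\<lambda>x. f x * g x)"
  by (simp add: smooth_on_def Ck_on_bounded_bilinear[OF _ bounded_bilinear_mult])

lemma smooth_on_inverse:
  fixes f :: "'e::real_normed_vector \<Rightarrow> real"
  shows "open S \<Longrightarrow> smooth_on S f \<Longrightarrow> (\<And>x. x \<in> S \<Longrightarrow> f x \<noteq> 0) \<Longrightarrow> smooth_on S (\<lambda>x. inverse (f x))"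
  by (simp add: smooth_on_def Ck_on_inverse)

lemma smooth_on_compose:
  fixes f :: "'e::euclidean_space \<Rightarrow> 'f::euclidean_space"
  shows "open S \<Longrightarrow> open T \<Longrightarrow> smooth_on S f \<Longrightarrow> smooth_on T g \<Longrightarrow> f ` S \<subseteq> T \<Longrightarrow>
    smooth_on S (\<lambda>x. g (f x))"
  by (simp add: smooth_on_def Ck_on_compose)

lemma smooth_on_imp_differentiable: "smooth_on S f \<Longrightarrow> x \<in> S \<Longrightarrow> f differentiable (at x)"
  unfolding smooth_on_def using Ck_on.simps(2)[of 0 S f] by blast

lemma smooth_on_imp_continuous_on: "smooth_on S f \<Longrightarrow> continuous_on S f"
  unfolding smooth_on_def using Ck_on.simps(1)[of S f] by blast

lemma smooth_on_frechet_derivative: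
  "smooth_on S f \<Longrightarrow> smooth_on S (\<lambda>x. frechet_derivative f (at x) v)"
  unfolding smooth_on_def using Ck_on.simps(2)[of _ S f] by blast

lemma smooth_on_Pair:
  fixes f :: "'e::real_normed_vector \<Rightarrow> 'f::euclidean_space"
    and g :: "'e::real_normed_vector \<Rightarrow> 'g::euclidean_space"
  assumes "open S" "smooth_on S f" "smooth_on S g"
  shows "smooth_on S (\<lambda>x. (f x, g x))"
proof -
  have "bounded_linear (\<lambda>y. (y, 0::'g))" "bounded_linear (\<lambda>y. (0::'f, y))"
    by (intro bounded_linear_Pair bounded_linear_ident bounded_linear_zero)+
  then have "smooth_on S (\<lambda>x. (f x, 0) + (0, g x))"
    using assms by (intro smooth_on_add) (auto intro: smooth_on_bounded_linear)
  then show ?thesis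
    by simp
qed

section \<open>Functions of one real variable\<close>

lemma frechet_derivative_real:
  fixes f :: "real \<Rightarrow> 'a::real_normed_vector"
  assumes "f differentiable (at t)"
  shows "frechet_derivative f (at t) v = v *\<^sub>R frechet_derivative f (at t) 1"
  using linear_scale[OF linear_frechet_derivative[OF assms], of v 1] by simp

lemma frechet_derivative_eq_deriv:
  fixes f :: "real \<Rightarrow> real"
  assumes "f differentiable (at t)"
  shows "frechet_derivative f (at t) 1 = deriv f t"
proof -
  have "(\<lambda>v. frechet_derivative f (at t) 1 * v) = frechet_derivative f (at t)"
    by (rule ext, subst (2) frechet_derivative_real[OF assms]) simp
  then have "(f has_derivative (\<lambda>v. frechet_derivative f (at t) 1 * v)) (at t)"
    using assms unfolding frechet_derivative_works by simp
  then have "(f has_field_derivative frechet_derivative f (at t) 1) (at t)"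
    by (simp add: has_field_derivative_def)
  then show ?thesis
    by (simp add: DERIV_imp_deriv)
qed

lemma smooth_on_has_field_derivative:
  fixes f :: "real \<Rightarrow> real"
  assumes "smooth_on S f" "t \<in> S"
  shows "(f has_field_derivative deriv f t) (at t)"
  using smooth_on_imp_differentiable[OF assms]
  by (simp add: DERIV_deriv_iff_real_differentiable)

lemma smooth_on_deriv:
  fixes f :: "real \<Rightarrow> real"
  assumes "open S" "smooth_on S f"
  shows "smooth_on S (deriv f)"
  by (rule smooth_on_cong[OF assms(1) _ smooth_on_frechet_derivative[OF assms(2), of 1]])
    (simp add: frechet_derivative_eq_deriv smooth_on_imp_differentiable[OF assms(2)])

lemma Ck_on_Suc_real:
  fixes f f' :: "real \<Rightarrow> real"
  assumes "open S" "\<And>t. t \<in> S \<Longrightarrow> (f has_field_derivative f' t) (at t)" "Ck_on k S f'"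
  shows "Ck_on (Suc k) S f"
proof -
  have e: "frechet_derivative f (at t) v = v * f' t" if "t \<in> S" for t v
    using frechet_derivative_at[OF assms(2)[OF that, unfolded has_field_derivative_def]]
    by (metis mult.commute)
  have "Ck_on k S (\<lambda>x. frechet_derivative f (at x) v)" for v
    by (rule Ck_on_cong[OF assms(1) _ Ck_on_bounded_linear[OF assms(1) bounded_linear_mult_right[of v] assms(3)]])
      (simp add: e)
  then show ?thesis
    using assms(2) real_differentiable_def by auto
qed

text \<open>Each of the two functions is the derivative of the other up to a factor, so the
  induction runs on both at once. The affine argument serves the rotating frame and the explicit
  Jacobi fields.\<close>

lemma smooth_on_sin_cos:
  fixes a b :: real
  assumes "open S"
  shows "smooth_on S (\<lambda>t. sin (a * t + b))" "smooth_on S (\<lambda>t. cos (a * t + b))"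
proof -
  have "Ck_on k S (\<lambda>t. sin (a * t + b)) \<and> Ck_on k S (\<lambda>t. cos (a * t + b))" for k
  proof (induction k)
    case 0
    then show ?case
      by (auto intro!: continuous_intros)
  next
    case (Suc k)
    have "Ck_on (Suc k) S (\<lambda>t. sin (a * t + b))"
      by (rule Ck_on_Suc_real[where f' = "\<lambda>t. a * cos (a * t + b)"])
        (auto intro!: derivative_eq_intros assms
          Ck_on_bounded_linear[OF assms bounded_linear_mult_right[of a] conjunct2[OF Suc]])
    moreover have "Ck_on (Suc k) S (\<lambda>t. cos (a * t + b))"
      by (rule Ck_on_Suc_real[where f' = "\<lambda>t. (- a) * sin (a * t + b)"])
        (auto intro!: derivative_eq_intros assms
          Ck_on_bounded_linear[OF assms bounded_linear_mult_right[of "- a"] conjunct1[OF Suc], simplified])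
    ultimately show ?case ..
  qed
  then show "smooth_on S (\<lambda>t. sin (a * t + b))" "smooth_on S (\<lambda>t. cos (a * t + b))"
    by (simp_all add: smooth_on_def)
qed

text \<open>Two applications of the mean value theorem to the second difference over the
  parallelogram spanned by \<open>h v\<close> and \<open>h w\<close>.\<close>

lemma second_difference:
  fixes F :: "'e::real_normed_vector \<Rightarrow> real"
  assumes "h > 0"
    and "\<And>s t. 0 \<le> s \<Longrightarrow> s \<le> h \<Longrightarrow> 0 \<le> t \<Longrightarrow> t \<le> h \<Longrightarrow> x + s *\<^sub>R v + t *\<^sub>R w \<in> S"
    and "smooth_on S F"
  shows "\<exists>s t. 0 < s \<and> s < h \<and> 0 < t \<and> t < h \<and>
    F (x + h *\<^sub>R v + h *\<^sub>R w) - F (x + h *\<^sub>R v) - F (x + h *\<^sub>R w) + F x =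
    h * (h * frechet_derivative (\<lambda>y. frechet_derivative F (at y) v) (at (x + s *\<^sub>R v + t *\<^sub>R w)) w)"
proof -
  have line: "((\<lambda>s. H (a + s *\<^sub>R u)) has_field_derivative frechet_derivative H (at (a + s *\<^sub>R u)) u) (at s)"
    if "smooth_on S H" "a + s *\<^sub>R u \<in> S" for H :: "'e \<Rightarrow> real" and a u s
  proof -
    have H: "(H has_derivative frechet_derivative H (at (a + s *\<^sub>R u))) (at (a + s *\<^sub>R u))"
      using smooth_on_imp_differentiable[OF that] frechet_derivative_works by blast
    have "((\<lambda>s. a + s *\<^sub>R u) has_derivative (\<lambda>s. s *\<^sub>R u)) (at s)"
      by (auto intro!: derivative_eq_intros)
    from diff_chain_at[OF this H] have "((\<lambda>s. H (a + s *\<^sub>R u)) has_derivative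
        (\<lambda>r. frechet_derivative H (at (a + s *\<^sub>R u)) (r *\<^sub>R u))) (at s)"
      by (simp add: o_def)
    then show ?thesis
      unfolding has_field_derivative_def
      by (rule has_derivative_eq_rhs)
        (simp add: fun_eq_iff linear_scale[OF linear_frechet_derivative[OF smooth_on_imp_differentiable[OF that]]])
  qed
  define D where "D y = frechet_derivative F (at y) v" for y
  have sD: "smooth_on S D"
    unfolding D_def by (rule smooth_on_frechet_derivative[OF assms(3)])
  define \<phi> where "\<phi> s = F ((x + h *\<^sub>R w) + s *\<^sub>R v) - F (x + s *\<^sub>R v)" for s
  have "\<exists>s. 0 < s \<and> s < h \<and> \<phi> h - \<phi> 0 = (h - 0) * (D ((x + h *\<^sub>R w) + s *\<^sub>R v) - D (x + s *\<^sub>R v))"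
  proof (rule MVT2[OF assms(1)])
    fix s assume s: "0 \<le> s" "s \<le> h"
    have "(x + h *\<^sub>R w) + s *\<^sub>R v \<in> S" "x + s *\<^sub>R v \<in> S"
      using assms(2)[OF s, of h] assms(2)[OF s, of 0] assms(1) by (auto simp: algebra_simps)
    from line[OF assms(3) this(1)] line[OF assms(3) this(2)]
    show "DERIV \<phi> s :> D ((x + h *\<^sub>R w) + s *\<^sub>R v) - D (x + s *\<^sub>R v)"
      unfolding \<phi>_def D_def by (rule DERIV_diff)
  qed
  then obtain s where s: "0 < s" "s < h"
    "\<phi> h - \<phi> 0 = h * (D ((x + h *\<^sub>R w) + s *\<^sub>R v) - D (x + s *\<^sub>R v))"
    by auto
  have "\<exists>t. 0 < t \<and> t < h \<and> D ((x + s *\<^sub>R v) + h *\<^sub>R w) - D ((x + s *\<^sub>R v) + 0 *\<^sub>R w) =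
      (h - 0) * frechet_derivative D (at ((x + s *\<^sub>R v) + t *\<^sub>R w)) w"
    using s assms(1,2) by (intro MVT2 line[OF sD]) auto
  then obtain t where "0 < t" "t < h"
    "D ((x + s *\<^sub>R v) + h *\<^sub>R w) - D (x + s *\<^sub>R v) = h * frechet_derivative D (at (x + s *\<^sub>R v + t *\<^sub>R w)) w"
    by auto
  with s show ?thesis
    unfolding \<phi>_def D_def by (intro exI[of _ s] exI[of _ t]) (auto simp: algebra_simps)
qed

text \<open>The second difference over a parallelogram does not change when \<open>v\<close> and
  \<open>w\<close> are exchanged. It is \<open>h\<^sup>2\<close> times either mixed derivative at
  some nearby point, and both are continuous.\<close>

lemma smooth_on_second_derivative_symmetric:
  fixes F :: "'e::real_normed_vector \<Rightarrow> real"
  assumes "open S" "smooth_on S F" "x \<in> S"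
  shows "frechet_derivative (\<lambda>y. frechet_derivative F (at y) v) (at x) w =
    frechet_derivative (\<lambda>y. frechet_derivative F (at y) w) (at x) v"
proof (rule ccontr)
  define A where "A y = frechet_derivative (\<lambda>y. frechet_derivative F (at y) v) (at y) w" for y
  define B where "B y = frechet_derivative (\<lambda>y. frechet_derivative F (at y) w) (at y) v" for y
  assume "\<not> ?thesis"
  then have ne: "A x \<noteq> B x"
    by (simp add: A_def B_def)
  \<comment> \<open>Half the gap: values within \<open>e\<close> of \<open>A x\<close> and of
    \<open>B x\<close> cannot coincide.\<close>
  define e where "e = \<bar>A x - B x\<bar> / 2"
  have e: "e > 0"
    using ne by (simp add: e_def)
  have "isCont A x" "isCont B x"
    using smooth_on_imp_continuous_on[OF smooth_on_frechet_derivative[OF smooth_on_frechet_derivative[OF assms(2)]]]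
      assms(1,3) continuous_on_eq_continuous_at unfolding A_def B_def by blast+
  then have "\<forall>\<^sub>F y in nhds x. dist (A y) (A x) < e" "\<forall>\<^sub>F y in nhds x. dist (B y) (B x) < e"
    using e by (auto simp: isCont_def tendsto_at_iff_tendsto_nhds dest: tendstoD)
  moreover have "\<forall>\<^sub>F y in nhds x. y \<in> S"
    using assms(1,3) eventually_nhds_in_open by blast
  ultimately have "\<forall>\<^sub>F y in nhds x. y \<in> S \<and> dist (A y) (A x) < e \<and> dist (B y) (B x) < e"
    by (simp add: eventually_conj_iff)
  then obtain d where d: "d > 0" "\<And>y. dist y x < d \<Longrightarrow> y \<in> S \<and> dist (A y) (A x) < e \<and> dist (B y) (B x) < e"
    unfolding eventually_nhds_metric by blast
  \<comment> \<open>Keeps the whole parallelogram inside the ball of radius \<open>d\<close>; the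
    summand 1 avoids a zero denominator.\<close>
  define h where "h = d / (2 * (norm v + norm w + 1))"
  have pos: "norm v + norm w + 1 > 0"
    by (smt (verit) norm_ge_zero)
  have h: "h > 0"
    using d(1) pos by (simp add: h_def)
  have near: "dist (x + s *\<^sub>R v + t *\<^sub>R w) x < d" if "0 \<le> s" "s \<le> h" "0 \<le> t" "t \<le> h" for s t
  proof -
    have "dist (x + s *\<^sub>R v + t *\<^sub>R w) x = norm (s *\<^sub>R v + t *\<^sub>R w)"
      by (simp add: dist_norm algebra_simps)
    also have "\<dots> \<le> s * norm v + t * norm w"
      using that by (metis abs_of_nonneg norm_scaleR norm_triangle_ineq)
    also have "\<dots> \<le> h * norm v + h * norm w"
      using that by (intro add_mono mult_right_mono) auto
    also have "\<dots> \<le> h * (norm v + norm w + 1)"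
      using h by (simp add: algebra_simps)
    also have "\<dots> = d / 2"
      using pos by (simp add: h_def field_simps)
    finally show ?thesis
      using d(1) by simp
  qed
  obtain s t where 1: "0 < s" "s < h" "0 < t" "t < h"
    "F (x + h *\<^sub>R v + h *\<^sub>R w) - F (x + h *\<^sub>R v) - F (x + h *\<^sub>R w) + F x = h * (h * A (x + s *\<^sub>R v + t *\<^sub>R w))"
    using second_difference[OF h _ assms(2), of x v w] near d(2) unfolding A_def by blast
  have near': "dist (x + s *\<^sub>R w + t *\<^sub>R v) x < d" if "0 \<le> s" "s \<le> h" "0 \<le> t" "t \<le> h" for s t
    using near[OF that(3,4) that(1,2)] by (simp add: algebra_simps)
  obtain s' t' where 2: "0 < s'" "s' < h" "0 < t'" "t' < h"
    "F (x + h *\<^sub>R w + h *\<^sub>R v) - F (x + h *\<^sub>R w) - F (x + h *\<^sub>R v) + F x = h * (h * B (x + s' *\<^sub>R w + t' *\<^sub>R v))"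
    using second_difference[OF h _ assms(2), of x w v] near' d(2) unfolding B_def by blast
  have "h * (h * A (x + s *\<^sub>R v + t *\<^sub>R w)) = h * (h * B (x + s' *\<^sub>R w + t' *\<^sub>R v))"
    using 1(5) 2(5) by (simp add: algebra_simps)
  then have "A (x + s *\<^sub>R v + t *\<^sub>R w) = B (x + s' *\<^sub>R w + t' *\<^sub>R v)"
    using h by simp
  moreover have "dist (A (x + s *\<^sub>R v + t *\<^sub>R w)) (A x) < e"
    using near[of s t] d(2) 1 by simp
  moreover have "dist (B (x + s' *\<^sub>R w + t' *\<^sub>R v)) (B x) < e"
    using near'[of s' t'] d(2) 2 by simp
  ultimately show False
    by (simp add: e_def dist_real_def abs_if split: if_splits)
qed


section \<open>Smooth manifolds\<close>

text \<open>The generic element of \<open>tangent_space\<close>, with chart and coordinate vector as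
  arguments so that the chart can be held fixed.\<close>

definition chart_vector ::
    "('a::topological_space, 'e::euclidean_space) atlas \<Rightarrow> 'a set \<Rightarrow> ('a \<Rightarrow> 'e) \<Rightarrow> 'a \<Rightarrow> 'e \<Rightarrow> 'a tvec"
  where "chart_vector A U \<phi> p c =
    (\<lambda>f. if smooth_near A p f then frechet_derivative (f \<circ> inv_into U \<phi>) (at (\<phi> p)) c else 0)"

locale smooth_manifold =
  fixes A :: "('a::{t2_space, second_countable_topology}, 'e::euclidean_space) atlas"
  assumes smooth_atlas: "smooth_atlas A"
begin

lemma chart_ex: obtains U \<phi> where "(U, \<phi>) \<in> A" "p \<in> U"
proof -
  have "p \<in> (\<Union>(U, \<phi>)\<in>A. U)"
    using smooth_atlas unfolding smooth_atlas_def by simp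
  then show ?thesis
    using that by auto
qed

lemma
  assumes "(U, \<phi>) \<in> A"
  shows chart_open: "open U" "open (\<phi> ` U)"
    and chart_homeomorphism: "homeomorphism U (\<phi> ` U) \<phi> (inv_into U \<phi>)"
  using assms smooth_atlas unfolding smooth_atlas_def by auto

lemma
  assumes "(U, \<phi>) \<in> A"
  shows chart_inv: "p \<in> U \<Longrightarrow> inv_into U \<phi> (\<phi> p) = p"
    and chart_inv': "x \<in> \<phi> ` U \<Longrightarrow> \<phi> (inv_into U \<phi> x) = x"
    and chart_inv_in: "x \<in> \<phi> ` U \<Longrightarrow> inv_into U \<phi> x \<in> U"
    and chart_continuous: "continuous_on U \<phi>"
    and chart_inv_continuous: "continuous_on (\<phi> ` U) (inv_into U \<phi>)"
  using chart_homeomorphism[OF assms] unfolding homeomorphism_def by (auto simp: inv_into_into)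

lemma chart_image:
  assumes "(U, \<phi>) \<in> A"
  shows "\<phi> ` (U \<inter> W) = \<phi> ` U \<inter> inv_into U \<phi> -` W"
  using chart_inv[OF assms] by (force simp: image_iff)

lemma chart_image_open:
  assumes "(U, \<phi>) \<in> A" "open W"
  shows "open (\<phi> ` (U \<inter> W))"
  unfolding chart_image[OF assms(1)]
  using continuous_open_preimage[OF chart_inv_continuous[OF assms(1)] chart_open(2)[OF assms(1)] assms(2)] .

lemma chart_trans:
  assumes "(U, \<phi>) \<in> A" "(V, \<psi>) \<in> A"
  shows "smooth_on (\<phi> ` (U \<inter> V)) (\<lambda>x. \<psi> (inv_into U \<phi> x))"
  using assms smooth_atlas unfolding smooth_atlas_def by (auto simp: o_def)

section \<open>Smooth functions on a manifold\<close>

lemma smooth_fun_on_iff: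
  "smooth_fun_on A W f \<longleftrightarrow>
    continuous_on W f \<and> (\<forall>(U, \<phi>)\<in>A. smooth_on (\<phi> ` (U \<inter> W)) (\<lambda>x. f (inv_into U \<phi> x)))"
  by (simp add: smooth_map_on_def std_atlas_def o_def)

text \<open>Transition maps are smooth, so smoothness in one chart around \<open>p\<close> carries
  over to all others. From here on a single chart suffices.\<close>

lemma smooth_near_chart:
  assumes "(U, \<phi>) \<in> A" "p \<in> U"
  shows "smooth_near A p f \<longleftrightarrow> (\<exists>T. open T \<and> \<phi> p \<in> T \<and> smooth_on T (\<lambda>x. f (inv_into U \<phi> x)))"
proof
  assume "smooth_near A p f"
  then obtain W where W: "open W" "p \<in> W" "smooth_fun_on A W f"
    unfolding smooth_near_def by blast
  show "\<exists>T. open T \<and> \<phi> p \<in> T \<and> smooth_on T (\<lambda>x. f (inv_into U \<phi> x))"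
    using W assms chart_image_open[OF assms(1) W(1)] unfolding smooth_fun_on_iff
    by (intro exI[of _ "\<phi> ` (U \<inter> W)"]) auto
next
  assume "\<exists>T. open T \<and> \<phi> p \<in> T \<and> smooth_on T (\<lambda>x. f (inv_into U \<phi> x))"
  then obtain T where T: "open T" "\<phi> p \<in> T" "smooth_on T (\<lambda>x. f (inv_into U \<phi> x))"
    by blast
  define W where "W = U \<inter> \<phi> -` T"
  have W: "open W"
    unfolding W_def
    using continuous_open_preimage[OF chart_continuous chart_open(1) T(1), OF assms(1) assms(1)] .
  have "continuous_on W f"
  proof -
    have "continuous_on W (\<lambda>q. f (inv_into U \<phi> (\<phi> q)))"
      by (rule continuous_on_compose2[OF smooth_on_imp_continuous_on[OF T(3)]])
        (auto simp: W_def intro: continuous_on_subset[OF chart_continuous[OF assms(1)]])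
    then show ?thesis
      by (rule continuous_on_eq) (auto simp: W_def chart_inv[OF assms(1)])
  qed
  moreover have "smooth_on (\<psi> ` (V \<inter> W)) (\<lambda>x. f (inv_into V \<psi> x))" if V: "(V, \<psi>) \<in> A" for V \<psi>
  proof (rule smooth_on_cong)
    show o: "open (\<psi> ` (V \<inter> W))"
      by (rule chart_image_open[OF V W])
    have "smooth_on (\<psi> ` (V \<inter> W)) (\<lambda>x. \<phi> (inv_into V \<psi> x))"
      by (rule smooth_on_subset[OF chart_trans[OF V assms(1)]]) (auto simp: W_def)
    then show "smooth_on (\<psi> ` (V \<inter> W)) (\<lambda>x. f (inv_into U \<phi> (\<phi> (inv_into V \<psi> x))))"
      by (rule smooth_on_compose[OF o T(1) _ T(3)]) (auto simp: W_def chart_inv[OF V])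
  qed (auto simp: W_def chart_inv[OF V] chart_inv[OF assms(1)])
  ultimately show "smooth_near A p f"
    unfolding smooth_near_def smooth_fun_on_iff
    using W assms T(2) by (intro exI[of _ W]) (auto simp: W_def)
qed

text \<open>Gluing by \<open>smooth_on_local\<close>; afterwards smoothness can be handled point by
  point.\<close>

lemma smooth_fun_on_iff_smooth_near:
  assumes "open W"
  shows "smooth_fun_on A W f \<longleftrightarrow> (\<forall>p\<in>W. smooth_near A p f)"
proof
  assume "smooth_fun_on A W f"
  then show "\<forall>p\<in>W. smooth_near A p f"
    using assms unfolding smooth_near_def by blast
next
  assume *: "\<forall>p\<in>W. smooth_near A p f"
  have "continuous_on W f"
  proof (intro continuous_at_imp_continuous_on ballI)
    fix p assume "p \<in> W"
    then obtain W' where "open W'" "p \<in> W'" "smooth_fun_on A W' f"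
      using * unfolding smooth_near_def by blast
    then show "isCont f p"
      unfolding smooth_fun_on_iff using continuous_on_eq_continuous_at by blast
  qed
  moreover have "smooth_on (\<phi> ` (U \<inter> W)) (\<lambda>x. f (inv_into U \<phi> x))" if U: "(U, \<phi>) \<in> A" for U \<phi>
  proof (rule smooth_on_local)
    fix x assume "x \<in> \<phi> ` (U \<inter> W)"
    then obtain p where "p \<in> U" "p \<in> W" "x = \<phi> p"
      by blast
    then show "\<exists>T. open T \<and> x \<in> T \<and> smooth_on T (\<lambda>x. f (inv_into U \<phi> x))"
      using * smooth_near_chart[OF U] by blast
  qed
  ultimately show "smooth_fun_on A W f"
    unfolding smooth_fun_on_iff by blast
qed

lemma smooth_near_eventually:
  assumes "smooth_near A p f"
  obtains W where "open W" "p \<in> W" "\<And>q. q \<in> W \<Longrightarrow> smooth_near A q f"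
  using assms unfolding smooth_near_def by blast

lemma smooth_near_cong:
  assumes "open W" "p \<in> W" "\<And>q. q \<in> W \<Longrightarrow> f q = h q" "smooth_near A p f"
  shows "smooth_near A p h"
proof -
  obtain U \<phi> where U: "(U, \<phi>) \<in> A" "p \<in> U"
    by (rule chart_ex)
  obtain T where T: "open T" "\<phi> p \<in> T" "smooth_on T (\<lambda>x. f (inv_into U \<phi> x))"
    using assms(4) smooth_near_chart[OF U] by blast
  have "open (T \<inter> \<phi> ` (U \<inter> W))"
    using T(1) chart_image_open[OF U(1) assms(1)] by blast
  moreover have "smooth_on (T \<inter> \<phi> ` (U \<inter> W)) (\<lambda>x. h (inv_into U \<phi> x))"
    by (rule smooth_on_cong[OF calculation _ smooth_on_subset[OF T(3)]])
      (auto simp: assms(3) chart_inv[OF U(1)])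
  ultimately show ?thesis
    using smooth_near_chart[OF U] T(2) U(2) assms(2) by blast
qed

lemma smooth_near_const: "smooth_near A p (\<lambda>q. k)"
proof -
  obtain U \<phi> where U: "(U, \<phi>) \<in> A" "p \<in> U"
    by (rule chart_ex)
  show ?thesis
    unfolding smooth_near_chart[OF U] using smooth_on_const by (intro exI[of _ UNIV]) simp
qed

lemma smooth_near_binop:
  assumes "\<And>S f h. open S \<Longrightarrow> smooth_on S f \<Longrightarrow> smooth_on S h \<Longrightarrow> smooth_on S (\<lambda>x::'e. b (f x) (h x))"
    and "smooth_near A p f" "smooth_near A p h"
  shows "smooth_near A p (\<lambda>q. b (f q) (h q))"
proof -
  obtain U \<phi> where U: "(U, \<phi>) \<in> A" "p \<in> U"
    by (rule chart_ex)
  obtain T where T: "open T" "\<phi> p \<in> T" "smooth_on T (\<lambda>x. f (inv_into U \<phi> x))"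
    using assms(2) smooth_near_chart[OF U] by blast
  obtain T' where T': "open T'" "\<phi> p \<in> T'" "smooth_on T' (\<lambda>x. h (inv_into U \<phi> x))"
    using assms(3) smooth_near_chart[OF U] by blast
  have "smooth_on (T \<inter> T') (\<lambda>x. b (f (inv_into U \<phi> x)) (h (inv_into U \<phi> x)))"
    using T T' by (intro assms(1)) (auto intro: smooth_on_subset)
  then show ?thesis
    using T T' smooth_near_chart[OF U] by (meson IntI open_Int)
qed

lemma smooth_near_add: "smooth_near A p f \<Longrightarrow> smooth_near A p h \<Longrightarrow> smooth_near A p (\<lambda>q. f q + h q)"
  by (rule smooth_near_binop[where b = "(+)"]) (rule smooth_on_add)

lemma smooth_near_diff: "smooth_near A p f \<Longrightarrow> smooth_near A p h \<Longrightarrow> smooth_near A p (\<lambda>q. f q - h q)"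
  by (rule smooth_near_binop[where b = "(-)"]) (rule smooth_on_diff)

lemma smooth_near_mult: "smooth_near A p f \<Longrightarrow> smooth_near A p h \<Longrightarrow> smooth_near A p (\<lambda>q. f q * h q)"
  by (rule smooth_near_binop[where b = "(*)"]) (rule smooth_on_mult)

lemma smooth_near_minus: "smooth_near A p f \<Longrightarrow> smooth_near A p (\<lambda>q. - f q)"
  using smooth_near_diff[OF smooth_near_const[of p 0]] by simp

lemma smooth_near_inverse:
  assumes "smooth_near A p f" "f p \<noteq> 0"
  shows "smooth_near A p (\<lambda>q. inverse (f q))"
proof -
  obtain U \<phi> where U: "(U, \<phi>) \<in> A" "p \<in> U"
    by (rule chart_ex)
  define F where "F = (\<lambda>x. f (inv_into U \<phi> x))"
  obtain T where T: "open T" "\<phi> p \<in> T" "smooth_on T F"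
    using assms(1) smooth_near_chart[OF U] unfolding F_def by blast
  have o: "open (T \<inter> F -` (- {0}))"
    by (rule continuous_open_preimage[OF smooth_on_imp_continuous_on[OF T(3)] T(1)]) auto
  have "smooth_on (T \<inter> F -` (- {0})) (\<lambda>x. inverse (F x))"
    by (rule smooth_on_inverse[OF o smooth_on_subset[OF T(3)]]) auto
  moreover have "\<phi> p \<in> T \<inter> F -` (- {0})"
    using T(2) assms(2) chart_inv[OF U] by (simp add: F_def)
  ultimately show ?thesis
    unfolding smooth_near_chart[OF U] using o
    by (intro exI[of _ "T \<inter> F -` (- {0})"] conjI) (auto simp: F_def)
qed

lemmas smooth_near_intros =
  smooth_near_const smooth_near_add smooth_near_diff smooth_near_mult smooth_near_minus

lemma smooth_near_differentiable:
  assumes "(U, \<phi>) \<in> A" "p \<in> U" "smooth_near A p f"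
  shows "(\<lambda>x. f (inv_into U \<phi> x)) differentiable (at (\<phi> p))"
proof -
  obtain T where "\<phi> p \<in> T" "smooth_on T (\<lambda>x. f (inv_into U \<phi> x))"
    using assms(3) unfolding smooth_near_chart[OF assms(1,2)] by blast
  then show ?thesis
    by (rule smooth_on_imp_differentiable[rotated])
qed

lemma smooth_near_coord:
  assumes "(U, \<phi>) \<in> A" "p \<in> U"
  shows "smooth_near A p (\<lambda>q. \<phi> q \<bullet> b)"
  unfolding smooth_near_chart[OF assms]
proof (intro exI conjI)
  show o: "open (\<phi> ` U)"
    by (rule chart_open[OF assms(1)])
  show "smooth_on (\<phi> ` U) (\<lambda>x. \<phi> (inv_into U \<phi> x) \<bullet> b)"
    using chart_trans[OF assms(1) assms(1)]
    by (intro smooth_on_bounded_linear[OF o bounded_linear_inner_left]) simp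
qed (use assms in simp)

text \<open>The velocity of a map from a normed space into the manifold is a tangent vector. This covers
  changes of charts, velocities of curves, and differentials of translations.\<close>

lemma push_chart_vector:
  fixes h :: "'n::real_normed_vector \<Rightarrow> 'a"
  assumes V: "(V, \<psi>) \<in> A" "h x \<in> V"
    and "continuous (at x) h"
    and diff: "\<And>f. smooth_near A (h x) f \<Longrightarrow> (\<lambda>y. f (h y)) differentiable (at x)"
  shows "(\<lambda>f. if smooth_near A (h x) f then frechet_derivative (\<lambda>y. f (h y)) (at x) c else 0) =
    chart_vector A V \<psi> (h x) (frechet_derivative (\<lambda>y. \<psi> (h y)) (at x) c)"
proof
  fix f
  \<comment> \<open>\<open>diff\<close> covers real-valued functions only; \<open>\<psi>\<close> is
    reached through its coordinates, which are smooth near \<open>h x\<close>.\<close>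
  have d1: "(\<lambda>y. \<psi> (h y)) differentiable (at x)"
    by (rule iffD2[OF differentiable_componentwise_within[of _ x UNIV]], rule ballI,
        rule diff[OF smooth_near_coord[OF V]])
  show "(if smooth_near A (h x) f then frechet_derivative (\<lambda>y. f (h y)) (at x) c else 0) =
      chart_vector A V \<psi> (h x) (frechet_derivative (\<lambda>y. \<psi> (h y)) (at x) c) f"
  proof (cases "smooth_near A (h x) f")
    case True
    obtain S where S: "open S" "x \<in> S" "\<And>y. y \<in> S \<Longrightarrow> h y \<in> V"
      using continuous_at_open[of x h] assms(3) V chart_open(1)[OF V(1)] by blast
    have "((\<lambda>x. f (inv_into V \<psi> x)) \<circ> (\<lambda>y. \<psi> (h y)) has_derivative
        frechet_derivative (\<lambda>x. f (inv_into V \<psi> x)) (at (\<psi> (h x))) \<circ>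
        frechet_derivative (\<lambda>y. \<psi> (h y)) (at x)) (at x)"
      by (rule diff_chain_at)
        (use d1 smooth_near_differentiable[OF V True] in \<open>auto simp: frechet_derivative_works\<close>)
    then have "((\<lambda>y. f (h y)) has_derivative
        frechet_derivative (\<lambda>x. f (inv_into V \<psi> x)) (at (\<psi> (h x))) \<circ>
        frechet_derivative (\<lambda>y. \<psi> (h y)) (at x)) (at x)"
      by (rule has_derivative_transform_within_open[OF _ S(1,2)]) (simp add: S(3) chart_inv[OF V(1)])
    from fun_cong[OF frechet_derivative_at[OF this], of c] show ?thesis
      using True by (simp add: chart_vector_def o_def)
  qed (simp add: chart_vector_def)
qed

text \<open>The definition admits every chart around \<open>p\<close>. A vector given in another
  chart \<open>\<psi>\<close> is the push of a coordinate vector along the inverse of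
  \<open>\<psi>\<close>, so one chart yields all of them, and with it the vector space
  structure.\<close>

lemma tangent_space_chart:
  assumes "(U, \<phi>) \<in> A" "p \<in> U"
  shows "tangent_space A p = range (chart_vector A U \<phi> p)"
proof -
  have "chart_vector A V \<psi> p c \<in> range (chart_vector A U \<phi> p)" if V: "(V, \<psi>) \<in> A" "p \<in> V" for V \<psi> c
  proof -
    have e: "inv_into V \<psi> (\<psi> p) = p"
      by (rule chart_inv[OF V])
    have "continuous (at (\<psi> p)) (inv_into V \<psi>)"
      using chart_inv_continuous[OF V(1)] chart_open(2)[OF V(1)] V(2) continuous_on_eq_continuous_at
      by blast
    have "chart_vector A V \<psi> p c =
        (\<lambda>f. if smooth_near A (inv_into V \<psi> (\<psi> p)) f
          then frechet_derivative (\<lambda>y. f (inv_into V \<psi> y)) (at (\<psi> p)) c else 0)"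
      unfolding chart_vector_def o_def e ..
    also have "\<dots> = chart_vector A U \<phi> (inv_into V \<psi> (\<psi> p))
        (frechet_derivative (\<lambda>y. \<phi> (inv_into V \<psi> y)) (at (\<psi> p)) c)"
      using assms(2) smooth_near_differentiable[OF V]
      by (intro push_chart_vector[OF assms(1) _ \<open>continuous _ _\<close>]) (simp_all add: e)
    finally show ?thesis
      by (simp add: e)
  qed
  then show ?thesis
    using assms unfolding tangent_space_def chart_vector_def by blast
qed

lemma push_tangent_space:
  fixes h :: "'n::real_normed_vector \<Rightarrow> 'a"
  assumes "continuous (at x) h"
    and "\<And>f. smooth_near A (h x) f \<Longrightarrow> (\<lambda>y. f (h y)) differentiable (at x)"
  shows "(\<lambda>f. if smooth_near A (h x) f then frechet_derivative (\<lambda>y. f (h y)) (at x) c else 0)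
    \<in> tangent_space A (h x)"
proof -
  obtain V \<psi> where V: "(V, \<psi>) \<in> A" "h x \<in> V"
    by (rule chart_ex)
  show ?thesis
    using push_chart_vector[OF V assms] tangent_space_chart[OF V] by blast
qed

section \<open>Locality and product rule of tangent vectors\<close>

lemma tangent_not_smooth: "v \<in> tangent_space A p \<Longrightarrow> \<not> smooth_near A p f \<Longrightarrow> v f = 0"
  unfolding tangent_space_def by auto

text \<open>Being smooth near \<open>p\<close> depends only on the germ, so not only the derivative
  but also the default value 0 is local. Identities that hold merely near \<open>p\<close>, such as
  an unfolded bracket, may thus be differentiated.\<close>

lemma tangent_cong:
  assumes "v \<in> tangent_space A p" "open W" "p \<in> W" "\<And>q. q \<in> W \<Longrightarrow> f q = h q"
  shows "v f = v h"
proof (cases "smooth_near A p f")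
  case True
  then have h: "smooth_near A p h"
    using smooth_near_cong[of W p f h] assms(2-4) by blast
  obtain U \<phi> where U: "(U, \<phi>) \<in> A" "p \<in> U"
    by (rule chart_ex)
  then obtain c where c: "v = chart_vector A U \<phi> p c"
    using assms(1) tangent_space_chart by auto
  have "((\<lambda>x. h (inv_into U \<phi> x)) has_derivative
      frechet_derivative (\<lambda>x. f (inv_into U \<phi> x)) (at (\<phi> p))) (at (\<phi> p))"
    by (rule has_derivative_transform_within_open[OF _ chart_image_open[OF U(1) assms(2)], of "\<lambda>x. f (inv_into U \<phi> x)"])
      (use smooth_near_differentiable[OF U True] U(2) assms(3,4) chart_inv[OF U(1)]
        in \<open>auto simp: frechet_derivative_works\<close>)
  from frechet_derivative_at[OF this] show ?thesis
    using True h by (simp add: c chart_vector_def o_def)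
next
  case False
  then have "\<not> smooth_near A p h"
    using smooth_near_cong[OF assms(2,3), of h f] assms(4) by metis
  then show ?thesis
    using False tangent_not_smooth[OF assms(1)] by simp
qed

lemma
  assumes v: "v \<in> tangent_space A p" and f: "smooth_near A p f" and h: "smooth_near A p h"
  shows tangent_add: "v (\<lambda>q. f q + h q) = v f + v h"
    and tangent_diff: "v (\<lambda>q. f q - h q) = v f - v h"
    and tangent_mult: "v (\<lambda>q. f q * h q) = f p * v h + v f * h p"
proof -
  obtain U \<phi> where U: "(U, \<phi>) \<in> A" "p \<in> U"
    by (rule chart_ex)
  then obtain c where c: "v = chart_vector A U \<phi> p c"
    using v tangent_space_chart by auto
  note d = smooth_near_differentiable[OF U f, unfolded frechet_derivative_works]
    smooth_near_differentiable[OF U h, unfolded frechet_derivative_works]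
  note s = smooth_near_add[OF f h] smooth_near_diff[OF f h] smooth_near_mult[OF f h]
  show "v (\<lambda>q. f q + h q) = v f + v h"
    using fun_cong[OF frechet_derivative_at[OF has_derivative_add[OF d]], of c] f h s
    by (simp add: c chart_vector_def o_def)
  show "v (\<lambda>q. f q - h q) = v f - v h"
    using fun_cong[OF frechet_derivative_at[OF has_derivative_diff[OF d]], of c] f h s
    by (simp add: c chart_vector_def o_def)
  show "v (\<lambda>q. f q * h q) = f p * v h + v f * h p"
    using fun_cong[OF frechet_derivative_at[OF has_derivative_mult[OF d]], of c] f h s chart_inv[OF U]
    by (simp add: c chart_vector_def o_def)
qed

lemma tangent_const: "v \<in> tangent_space A p \<Longrightarrow> v (\<lambda>q. k) = 0"
  unfolding tangent_space_def by (auto simp: o_def frechet_derivative_const)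

lemma tangent_minus: "v \<in> tangent_space A p \<Longrightarrow> smooth_near A p f \<Longrightarrow> v (\<lambda>q. - f q) = - v f"
  using tangent_diff[OF _ smooth_near_const, of v p f 0] by (simp add: tangent_const)

lemma tangent_cmult: "v \<in> tangent_space A p \<Longrightarrow> smooth_near A p f \<Longrightarrow> v (\<lambda>q. k * f q) = k * v f"
  by (simp add: tangent_mult[OF _ smooth_near_const] tangent_const)

lemma chart_vector_linear:
  assumes "(U, \<phi>) \<in> A" "p \<in> U"
  shows "chart_vector A U \<phi> p (a *\<^sub>R c + b *\<^sub>R d) =
    a *\<^sub>R chart_vector A U \<phi> p c + b *\<^sub>R chart_vector A U \<phi> p d"
proof
  fix f
  show "chart_vector A U \<phi> p (a *\<^sub>R c + b *\<^sub>R d) f =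
      (a *\<^sub>R chart_vector A U \<phi> p c + b *\<^sub>R chart_vector A U \<phi> p d) f"
  proof (cases "smooth_near A p f")
    case True
    from linear_frechet_derivative[OF smooth_near_differentiable[OF assms True]]
    show ?thesis
      using True by (simp add: chart_vector_def o_def scaleR_fun_def linear_add linear_scale)
  qed (simp add: chart_vector_def scaleR_fun_def)
qed

text \<open>The coordinate functions read off \<open>c\<close>. They are the test functions that
  turn an equation between tangent vectors into a linear system.\<close>

lemma chart_vector_coord:
  assumes "(U, \<phi>) \<in> A" "p \<in> U"
  shows "chart_vector A U \<phi> p c (\<lambda>q. \<phi> q \<bullet> b) = c \<bullet> b"
proof -
  have "((\<lambda>x. \<phi> (inv_into U \<phi> x) \<bullet> b) has_derivative (\<lambda>x. x \<bullet> b)) (at (\<phi> p))"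
    by (rule has_derivative_transform_within_open[OF _ chart_open(2)[OF assms(1)], of "\<lambda>x. x \<bullet> b"])
      (use assms chart_inv'[OF assms(1)] in \<open>auto intro!: derivative_eq_intros\<close>)
  from fun_cong[OF frechet_derivative_at[OF this], of c] show ?thesis
    using smooth_near_coord[OF assms] by (simp add: chart_vector_def o_def)
qed

lemma tangent_space_scaleR_add:
  assumes "v \<in> tangent_space A p" "w \<in> tangent_space A p"
  shows "a *\<^sub>R v + b *\<^sub>R w \<in> tangent_space A p"
proof -
  obtain U \<phi> where U: "(U, \<phi>) \<in> A" "p \<in> U"
    by (rule chart_ex)
  obtain c d where "v = chart_vector A U \<phi> p c" "w = chart_vector A U \<phi> p d"
    using assms unfolding tangent_space_chart[OF U] by blast
  then show ?thesis
    unfolding tangent_space_chart[OF U] by (simp flip: chart_vector_linear[OF U])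
qed

lemma tangent_space_add: "v \<in> tangent_space A p \<Longrightarrow> w \<in> tangent_space A p \<Longrightarrow> v + w \<in> tangent_space A p"
  using tangent_space_scaleR_add[of v p w 1 1] by simp

lemma tangent_space_scaleR: "v \<in> tangent_space A p \<Longrightarrow> a *\<^sub>R v \<in> tangent_space A p"
  using tangent_space_scaleR_add[of v p v a 0] by simp

section \<open>Vector fields\<close>

lemma vector_field_tangent: "X \<in> vector_fields A \<Longrightarrow> X p \<in> tangent_space A p"
  by (simp add: vector_fields_def)

lemma vector_field_smooth:
  assumes "X \<in> vector_fields A" "smooth_near A p f"
  shows "smooth_near A p (\<lambda>q. X q f)"
proof -
  obtain W where "open W" "p \<in> W" "smooth_fun_on A W f"
    using assms(2) unfolding smooth_near_def by blast
  then show ?thesis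
    using assms(1) unfolding vector_fields_def smooth_near_def by (intro exI[of _ W]) simp
qed

lemma vector_fieldsI:
  assumes "\<And>p. X p \<in> tangent_space A p"
    and "\<And>p f. smooth_near A p f \<Longrightarrow> smooth_near A p (\<lambda>q. X q f)"
  shows "X \<in> vector_fields A"
proof -
  have "smooth_fun_on A W (\<lambda>p. X p f)" if "open W" "smooth_fun_on A W f" for W f
    using that(2) assms(2) unfolding smooth_fun_on_iff_smooth_near[OF that(1)] by blast
  then show ?thesis
    using assms(1) unfolding vector_fields_def by blast
qed

lemma vector_field_add:
  assumes "X \<in> vector_fields A" "Y \<in> vector_fields A"
  shows "X + Y \<in> vector_fields A"
proof (rule vector_fieldsI)
  show "(X + Y) p \<in> tangent_space A p" for p
    unfolding plus_fun_apply[of X Y]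
    by (rule tangent_space_add[OF vector_field_tangent[OF assms(1)] vector_field_tangent[OF assms(2)]])
  show "smooth_near A p (\<lambda>q. (X + Y) q f)" if "smooth_near A p f" for p f
    unfolding plus_fun_apply
    by (rule smooth_near_add[OF vector_field_smooth[OF assms(1) that] vector_field_smooth[OF assms(2) that]])
qed

lemma vector_field_fmult:
  assumes "X \<in> vector_fields A" "\<And>p. smooth_near A p f"
  shows "fmult f X \<in> vector_fields A"
proof (rule vector_fieldsI)
  show "fmult f X p \<in> tangent_space A p" for p
    unfolding fmult_def by (rule tangent_space_scaleR[OF vector_field_tangent[OF assms(1)]])
  show "smooth_near A p (\<lambda>q. fmult f X q h)" if "smooth_near A p h" for p h
    using smooth_near_mult[OF assms(2) vector_field_smooth[OF assms(1) that]]
    by (simp add: fmult_def scaleR_fun_def)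
qed

end


section \<open>Orthonormal frames and the Levi-Civita connection\<close>

context smooth_manifold
begin

lemma
  assumes X: "X \<in> vector_fields A" and f: "smooth_near A p f" and h: "smooth_near A p h"
  shows vector_field_apply_add: "X p (\<lambda>q. f q + h q) = X p f + X p h"
    and vector_field_apply_diff: "X p (\<lambda>q. f q - h q) = X p f - X p h"
    and vector_field_apply_mult: "X p (\<lambda>q. f q * h q) = f p * X p h + X p f * h p"
  by (rule tangent_add[OF vector_field_tangent[OF X] f h] tangent_diff[OF vector_field_tangent[OF X] f h]
      tangent_mult[OF vector_field_tangent[OF X] f h])+

lemma vector_field_apply_minus:
  "X \<in> vector_fields A \<Longrightarrow> smooth_near A p f \<Longrightarrow> X p (\<lambda>q. - f q) = - X p f"
  by (rule tangent_minus[OF vector_field_tangent])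

lemma vector_field_apply_cmult:
  "X \<in> vector_fields A \<Longrightarrow> smooth_near A p f \<Longrightarrow> X p (\<lambda>q. k * f q) = k * X p f"
  by (rule tangent_cmult[OF vector_field_tangent])

lemma vector_field_apply_const: "X \<in> vector_fields A \<Longrightarrow> X p (\<lambda>q. k) = 0"
  by (rule tangent_const[OF vector_field_tangent])

lemmas vector_field_apply = vector_field_apply_add vector_field_apply_diff vector_field_apply_cmult
  vector_field_apply_mult vector_field_apply_minus

end

text \<open>Dimension count in \<open>real^3\<close>, applied later to the chart coordinates of the
  frame.\<close>

lemma exists_coefficients_3:
  fixes c1 c2 c3 :: "real^3"
  assumes ind: "\<And>a1 a2 a3. a1 *\<^sub>R c1 + a2 *\<^sub>R c2 + a3 *\<^sub>R c3 = 0 \<Longrightarrow> a1 = 0 \<and> a2 = 0 \<and> a3 = 0"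
  shows "\<exists>a1 a2 a3. c = a1 *\<^sub>R c1 + a2 *\<^sub>R c2 + a3 *\<^sub>R c3"
proof -
  have ne: "c1 \<noteq> c2" "c1 \<noteq> c3" "c2 \<noteq> c3"
    using ind[of 1 "-1" 0] ind[of 1 0 "-1"] ind[of 0 1 "-1"] by auto
  have "independent {c1, c2, c3}"
  proof (rule independent_if_scalars_zero)
    fix f x assume "(\<Sum>x\<in>{c1, c2, c3}. f x *\<^sub>R x) = 0" "x \<in> {c1, c2, c3}"
    then show "f x = 0"
      using ne ind[of "f c1" "f c2" "f c3"] by (auto simp: add.assoc)
  qed simp
  then have "UNIV \<subseteq> span {c1, c2, c3}"
    using ne by (intro card_ge_dim_independent) (auto simp: dim_UNIV)
  then have "c \<in> span {c1, c2, c3}"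
    by blast
  then obtain a1 a2 a3 where "c - a1 *\<^sub>R c1 - a2 *\<^sub>R c2 - a3 *\<^sub>R c3 = 0"
    unfolding span_breakdown_eq span_empty by auto
  then have "c = a1 *\<^sub>R c1 + a2 *\<^sub>R c2 + a3 *\<^sub>R c3"
    by (simp add: algebra_simps)
  then show ?thesis
    by blast
qed

text \<open>A global orthonormal frame with constant structure coefficients is all that the metric
  geometry needs; here \<open>c\<close> stands for \<open>\<kappa> / \<tau>\<close>.\<close>

locale M3_frame = smooth_manifold A
  for A :: "('a::{t2_space, second_countable_topology}, real^3) atlas" +
  fixes g :: "'a metric" and u1 u2 u3 :: "'a vfield" and \<tau> c :: real
  assumes metric: "riemannian_metric A g"
    and frame_vf: "u1 \<in> vector_fields A" "u2 \<in> vector_fields A" "u3 \<in> vector_fields A"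
    and orthonormal: "g p (u1 p) (u1 p) = 1" "g p (u2 p) (u2 p) = 1" "g p (u3 p) (u3 p) = 1"
      "g p (u1 p) (u2 p) = 0" "g p (u2 p) (u3 p) = 0" "g p (u3 p) (u1 p) = 0"
    and brackets: "lie_bracket A u1 u2 = \<tau> *\<^sub>R u3" "lie_bracket A u2 u3 = c *\<^sub>R u1"
      "lie_bracket A u3 u1 = c *\<^sub>R u2"
begin

section \<open>Components in the orthonormal frame\<close>

definition fr :: "'a \<Rightarrow> real \<Rightarrow> real \<Rightarrow> real \<Rightarrow> 'a tvec"
  where "fr p x y z = x *\<^sub>R u1 p + y *\<^sub>R u2 p + z *\<^sub>R u3 p"

text \<open>Coefficients are taken with the metric, so that their smoothness for vector fields is
  part of \<open>riemannian_metric\<close>.\<close>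

definition co1 :: "'a \<Rightarrow> 'a tvec \<Rightarrow> real" where "co1 p v = g p v (u1 p)"
definition co2 :: "'a \<Rightarrow> 'a tvec \<Rightarrow> real" where "co2 p v = g p v (u2 p)"
definition co3 :: "'a \<Rightarrow> 'a tvec \<Rightarrow> real" where "co3 p v = g p v (u3 p)"

lemma frame_tangent: "u1 p \<in> tangent_space A p" "u2 p \<in> tangent_space A p" "u3 p \<in> tangent_space A p"
  using frame_vf vector_field_tangent by auto

lemma metric_sym: "v \<in> tangent_space A p \<Longrightarrow> w \<in> tangent_space A p \<Longrightarrow> g p v w = g p w v"
  using metric unfolding riemannian_metric_def by blast

lemma metric_linear:
  "v \<in> tangent_space A p \<Longrightarrow> w \<in> tangent_space A p \<Longrightarrow> x \<in> tangent_space A p \<Longrightarrow>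
    g p (a *\<^sub>R v + b *\<^sub>R w) x = a * g p v x + b * g p w x"
  using metric unfolding riemannian_metric_def by blast

lemma metric_add:
  "v \<in> tangent_space A p \<Longrightarrow> w \<in> tangent_space A p \<Longrightarrow> x \<in> tangent_space A p \<Longrightarrow>
    g p (v + w) x = g p v x + g p w x"
  using metric_linear[of v p w x 1 1] by simp

lemma metric_smooth:
  assumes "X \<in> vector_fields A" "Y \<in> vector_fields A"
  shows "smooth_near A p (\<lambda>q. g q (X q) (Y q))"
proof -
  have "smooth_fun_on A UNIV (\<lambda>p. g p (X p) (Y p))"
    using metric assms unfolding riemannian_metric_def by blast
  then show ?thesis
    using smooth_fun_on_iff_smooth_near[OF open_UNIV] by blast
qed

lemma fr_tangent: "fr p x y z \<in> tangent_space A p"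
  unfolding fr_def using frame_tangent by (intro tangent_space_add tangent_space_scaleR)

lemma metric_fr_left:
  assumes "v \<in> tangent_space A p"
  shows "g p (fr p x y z) v = x * g p (u1 p) v + y * g p (u2 p) v + z * g p (u3 p) v"
proof -
  have "g p (1 *\<^sub>R (x *\<^sub>R u1 p + y *\<^sub>R u2 p) + z *\<^sub>R u3 p) v =
      1 * g p (x *\<^sub>R u1 p + y *\<^sub>R u2 p) v + z * g p (u3 p) v"
    by (rule metric_linear[OF tangent_space_scaleR_add[OF frame_tangent(1,2)] frame_tangent(3) assms])
  then show ?thesis
    using metric_linear[OF frame_tangent(1,2) assms] by (simp add: fr_def)
qed

lemma co_fr [simp]: "co1 p (fr p x y z) = x" "co2 p (fr p x y z) = y" "co3 p (fr p x y z) = z"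
  using orthonormal metric_sym[OF frame_tangent(1,2)] metric_sym[OF frame_tangent(2,3)]
    metric_sym[OF frame_tangent(3,1)]
  by (simp_all add: co1_def co2_def co3_def metric_fr_left frame_tangent)

lemma metric_fr: "g p (fr p x y z) (fr p x' y' z') = x * x' + y * y' + z * z'"
  using metric_fr_left[OF fr_tangent, of p x y z x' y' z'] co_fr[of p x' y' z']
    metric_sym[OF frame_tangent(1) fr_tangent, of p x' y' z']
    metric_sym[OF frame_tangent(2) fr_tangent, of p x' y' z']
    metric_sym[OF frame_tangent(3) fr_tangent, of p x' y' z']
  by (simp add: co1_def co2_def co3_def)

lemma fr_eq_iff: "fr p x y z = fr p x' y' z' \<longleftrightarrow> x = x' \<and> y = y' \<and> z = z'"
proof
  assume "fr p x y z = fr p x' y' z'"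
  from arg_cong[OF this, of "co1 p"] arg_cong[OF this, of "co2 p"] arg_cong[OF this, of "co3 p"]
  show "x = x' \<and> y = y' \<and> z = z'"
    by simp
qed simp

lemma fr_zero: "fr p 0 0 0 = 0"
  by (simp add: fr_def)

lemma fr_eq_0_iff: "fr p x y z = 0 \<longleftrightarrow> x = 0 \<and> y = 0 \<and> z = 0"
  using fr_eq_iff[of p x y z 0 0 0] by (simp add: fr_zero)

lemma fr_add: "fr p x y z + fr p x' y' z' = fr p (x + x') (y + y') (z + z')"
  by (simp add: fr_def algebra_simps)

lemma fr_diff: "fr p x y z - fr p x' y' z' = fr p (x - x') (y - y') (z - z')"
  by (simp add: fr_def algebra_simps)

lemma fr_scaleR: "a *\<^sub>R fr p x y z = fr p (a * x) (a * y) (a * z)"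
  by (simp add: fr_def algebra_simps)

lemma fr_apply: "fr p x y z f = x * u1 p f + y * u2 p f + z * u3 p f"
  by (simp add: fr_def scaleR_fun_def)

lemma frame_eq_fr: "u1 p = fr p 1 0 0" "u2 p = fr p 0 1 0" "u3 p = fr p 0 0 1"
  by (simp_all add: fr_def)

text \<open>Orthonormality makes the frame independent, and a chart presents the tangent space as a
  linear image of \<open>real^3\<close>; three independent vectors leave no room.\<close>

lemma frame_expand:
  assumes "v \<in> tangent_space A p"
  shows "v = fr p (co1 p v) (co2 p v) (co3 p v)"
proof -
  obtain U \<phi> where U: "(U, \<phi>) \<in> A" "p \<in> U"
    by (rule chart_ex)
  obtain c1 c2 c3 d where c: "u1 p = chart_vector A U \<phi> p c1" "u2 p = chart_vector A U \<phi> p c2"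
    "u3 p = chart_vector A U \<phi> p c3" "v = chart_vector A U \<phi> p d"
    using frame_tangent[of p] assms unfolding tangent_space_chart[OF U] by blast
  have fr: "fr p x y z = chart_vector A U \<phi> p (x *\<^sub>R c1 + y *\<^sub>R c2 + z *\<^sub>R c3)" for x y z
    using chart_vector_linear[OF U, of x c1 y c2]
      chart_vector_linear[OF U, of 1 "x *\<^sub>R c1 + y *\<^sub>R c2" z c3]
    by (simp add: fr_def c)
  have "\<exists>a1 a2 a3. d = a1 *\<^sub>R c1 + a2 *\<^sub>R c2 + a3 *\<^sub>R c3"
  proof (rule exists_coefficients_3)
    fix a1 a2 a3 assume "a1 *\<^sub>R c1 + a2 *\<^sub>R c2 + a3 *\<^sub>R c3 = 0"
    then have "fr p a1 a2 a3 = fr p 0 0 0"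
      unfolding fr by simp
    then show "a1 = 0 \<and> a2 = 0 \<and> a3 = 0"
      by (simp only: fr_eq_iff)
  qed
  then obtain x y z where "v = fr p x y z"
    unfolding c(4) fr by auto
  then show ?thesis
    by simp
qed

lemma tangent_eqI:
  assumes "v \<in> tangent_space A p" "w \<in> tangent_space A p"
    "co1 p v = co1 p w" "co2 p v = co2 p w" "co3 p v = co3 p w"
  shows "v = w"
  using frame_expand[OF assms(1)] unfolding assms(3-5) frame_expand[OF assms(2), symmetric] .

lemma metric_eq_co:
  assumes "v \<in> tangent_space A p" "w \<in> tangent_space A p"
  shows "g p v w = co1 p v * co1 p w + co2 p v * co2 p w + co3 p v * co3 p w"
  using metric_fr[of p "co1 p v" "co2 p v" "co3 p v" "co1 p w" "co2 p w" "co3 p w"]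
  unfolding frame_expand[OF assms(1), symmetric] frame_expand[OF assms(2), symmetric] .

lemma co_add:
  assumes "v \<in> tangent_space A p" "w \<in> tangent_space A p"
  shows "co1 p (v + w) = co1 p v + co1 p w" "co2 p (v + w) = co2 p v + co2 p w"
    "co3 p (v + w) = co3 p v + co3 p w"
proof -
  have "v + w = fr p (co1 p v + co1 p w) (co2 p v + co2 p w) (co3 p v + co3 p w)"
    unfolding fr_add[symmetric] frame_expand[OF assms(1), symmetric] frame_expand[OF assms(2), symmetric] ..
  then show "co1 p (v + w) = co1 p v + co1 p w" "co2 p (v + w) = co2 p v + co2 p w"
    "co3 p (v + w) = co3 p v + co3 p w"
    by simp_all
qed

lemma co_scaleR:
  assumes "v \<in> tangent_space A p"
  shows "co1 p (a *\<^sub>R v) = a * co1 p v" "co2 p (a *\<^sub>R v) = a * co2 p v" "co3 p (a *\<^sub>R v) = a * co3 p v"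
proof -
  have "a *\<^sub>R v = fr p (a * co1 p v) (a * co2 p v) (a * co3 p v)"
    unfolding fr_scaleR[symmetric] frame_expand[OF assms(1), symmetric] ..
  then show "co1 p (a *\<^sub>R v) = a * co1 p v" "co2 p (a *\<^sub>R v) = a * co2 p v" "co3 p (a *\<^sub>R v) = a * co3 p v"
    by simp_all
qed

lemma tangent_apply:
  assumes "v \<in> tangent_space A p"
  shows "v f = co1 p v * u1 p f + co2 p v * u2 p f + co3 p v * u3 p f"
  unfolding fr_apply[symmetric] frame_expand[OF assms, symmetric] ..

lemma co_smooth:
  assumes "X \<in> vector_fields A"
  shows "smooth_near A p (\<lambda>q. co1 q (X q))" "smooth_near A p (\<lambda>q. co2 q (X q))"
    "smooth_near A p (\<lambda>q. co3 q (X q))"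
  unfolding co1_def co2_def co3_def using metric_smooth[OF assms] frame_vf by auto

lemma fr_vector_field:
  assumes "\<And>p. smooth_near A p x" "\<And>p. smooth_near A p y" "\<And>p. smooth_near A p z"
  shows "(\<lambda>p. fr p (x p) (y p) (z p)) \<in> vector_fields A"
proof -
  have "fmult x u1 + fmult y u2 + fmult z u3 \<in> vector_fields A"
    using assms frame_vf by (intro vector_field_add vector_field_fmult)
  then show ?thesis
    by (simp add: fr_def fmult_def plus_fun_def)
qed

text \<open>The structure equations as commutation rules for second derivatives. Each pair is
  oriented one way, so that as rewrite rules they leave a single order and the second-order terms
  cancel.\<close>

lemma bracket_frame:
  assumes "smooth_near A p f"
  shows "u1 p (\<lambda>q. u2 q f) = u2 p (\<lambda>q. u1 q f) + \<tau> * u3 p f"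
    "u2 p (\<lambda>q. u3 q f) = u3 p (\<lambda>q. u2 q f) + c * u1 p f"
    "u3 p (\<lambda>q. u1 q f) = u1 p (\<lambda>q. u3 q f) + c * u2 p f"
  using brackets[THEN fun_cong, of p, THEN fun_cong, of f] assms
  by (simp_all add: lie_bracket_def scaleR_fun_def)

lemma vector_field_apply_apply:
  assumes "X \<in> vector_fields A" "Y \<in> vector_fields A" "smooth_near A p f"
  shows "X p (\<lambda>q. Y q f) =
    X p (\<lambda>q. co1 q (Y q)) * u1 p f + co1 p (Y p) * X p (\<lambda>q. u1 q f) +
    (X p (\<lambda>q. co2 q (Y q)) * u2 p f + co2 p (Y p) * X p (\<lambda>q. u2 q f)) +
    (X p (\<lambda>q. co3 q (Y q)) * u3 p f + co3 p (Y p) * X p (\<lambda>q. u3 q f))"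
proof -
  have "X p (\<lambda>q. Y q f) =
      X p (\<lambda>q. co1 q (Y q) * u1 q f + co2 q (Y q) * u2 q f + co3 q (Y q) * u3 q f)"
    using tangent_apply[OF vector_field_tangent[OF assms(2)], of _ f] by simp
  also have "\<dots> = X p (\<lambda>q. co1 q (Y q)) * u1 p f + co1 p (Y p) * X p (\<lambda>q. u1 q f) +
      (X p (\<lambda>q. co2 q (Y q)) * u2 p f + co2 p (Y p) * X p (\<lambda>q. u2 q f)) +
      (X p (\<lambda>q. co3 q (Y q)) * u3 p f + co3 p (Y p) * X p (\<lambda>q. u3 q f))"
    using co_smooth[OF assms(2)] vector_field_smooth[OF frame_vf(1) assms(3)]
      vector_field_smooth[OF frame_vf(2) assms(3)] vector_field_smooth[OF frame_vf(3) assms(3)]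
    by (simp add: vector_field_apply_add[OF assms(1)] vector_field_apply_mult[OF assms(1)]
        smooth_near_add smooth_near_mult)
  finally show ?thesis .
qed

text \<open>By the product rule the second-order terms cancel up to the structure equations, which
  contribute \<open>diag (c, c, \<tau>)\<close> applied to the cross product.\<close>

lemma lie_bracket_fr:
  assumes X: "X \<in> vector_fields A" and Y: "Y \<in> vector_fields A"
  shows "lie_bracket A X Y p = fr p
    (X p (\<lambda>q. co1 q (Y q)) - Y p (\<lambda>q. co1 q (X q)) +
      c * (co2 p (X p) * co3 p (Y p) - co3 p (X p) * co2 p (Y p)))
    (X p (\<lambda>q. co2 q (Y q)) - Y p (\<lambda>q. co2 q (X q)) +
      c * (co3 p (X p) * co1 p (Y p) - co1 p (X p) * co3 p (Y p)))
    (X p (\<lambda>q. co3 q (Y q)) - Y p (\<lambda>q. co3 q (X q)) +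
      \<tau> * (co1 p (X p) * co2 p (Y p) - co2 p (X p) * co1 p (Y p)))" (is "_ = fr p ?x ?y ?z")
proof
  fix f
  show "lie_bracket A X Y p f = fr p ?x ?y ?z f"
  proof (cases "smooth_near A p f")
    case True
    note e = tangent_apply[OF vector_field_tangent[OF X], of p]
      tangent_apply[OF vector_field_tangent[OF Y], of p]
    define a where "a = co1 p (X p)"
    define b where "b = co2 p (X p)"
    define d where "d = co3 p (X p)"
    define a' where "a' = co1 p (Y p)"
    define b' where "b' = co2 p (Y p)"
    define d' where "d' = co3 p (Y p)"
    note e = e[folded a_def b_def d_def a'_def b'_def d'_def]
    show ?thesis
      using True unfolding lie_bracket_def fr_apply vector_field_apply_apply[OF X Y True]
        vector_field_apply_apply[OF Y X True] a_def[symmetric] b_def[symmetric] d_def[symmetric]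
        a'_def[symmetric] b'_def[symmetric] d'_def[symmetric]
        e(1)[of "\<lambda>q. u1 q f"] e(1)[of "\<lambda>q. u2 q f"] e(1)[of "\<lambda>q. u3 q f"]
        e(2)[of "\<lambda>q. u1 q f"] e(2)[of "\<lambda>q. u2 q f"] e(2)[of "\<lambda>q. u3 q f"] bracket_frame[OF True]
      by (simp add: algebra_simps)
  next
    case False
    then show ?thesis
      using tangent_not_smooth[OF fr_tangent] by (simp add: lie_bracket_def)
  qed
qed

lemma lie_bracket_vector_field:
  assumes "X \<in> vector_fields A" "Y \<in> vector_fields A"
  shows "lie_bracket A X Y \<in> vector_fields A"
proof -
  note s = co_smooth[OF assms(1)] co_smooth[OF assms(2)]
    vector_field_smooth[OF assms(1) co_smooth(1)[OF assms(2)]]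
    vector_field_smooth[OF assms(1) co_smooth(2)[OF assms(2)]]
    vector_field_smooth[OF assms(1) co_smooth(3)[OF assms(2)]]
    vector_field_smooth[OF assms(2) co_smooth(1)[OF assms(1)]]
    vector_field_smooth[OF assms(2) co_smooth(2)[OF assms(1)]]
    vector_field_smooth[OF assms(2) co_smooth(3)[OF assms(1)]]
  have "(\<lambda>p. lie_bracket A X Y p) \<in> vector_fields A"
    unfolding lie_bracket_fr[OF assms] by (intro fr_vector_field smooth_near_intros s)
  then show ?thesis
    by simp
qed

text \<open>Koszul's formula for the left-invariant frame gives
  \<open>D\<^sub>X Y = X(y) + M x \<times> y\<close> with \<open>M = diag (\<tau>/2, \<tau>/2, c - \<tau>/2)\<close>.\<close>

definition conn_pt :: "'a \<Rightarrow> 'a tvec \<Rightarrow> 'a vfield \<Rightarrow> 'a tvec"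
  where "conn_pt p v X = fr p
      (v (\<lambda>q. co1 q (X q)) + \<tau> / 2 * (co2 p v * co3 p (X p)) - (c - \<tau> / 2) * (co3 p v * co2 p (X p)))
      (v (\<lambda>q. co2 q (X q)) + (c - \<tau> / 2) * (co3 p v * co1 p (X p)) - \<tau> / 2 * (co1 p v * co3 p (X p)))
      (v (\<lambda>q. co3 q (X q)) + \<tau> / 2 * (co1 p v * co2 p (X p)) - \<tau> / 2 * (co2 p v * co1 p (X p)))"

text \<open>The value 0 off the smooth fields is the one prescribed in \<open>levi_civita\<close>,
  so that the two agree as total operators.\<close>

definition conn :: "'a connection"
  where "conn X Y =
    (if X \<in> vector_fields A \<and> Y \<in> vector_fields A then (\<lambda>p. conn_pt p (X p) Y) else 0)"

lemma conn_apply: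
  "X \<in> vector_fields A \<Longrightarrow> Y \<in> vector_fields A \<Longrightarrow> conn X Y = (\<lambda>p. conn_pt p (X p) Y)"
  by (simp add: conn_def)

lemmas conn_eq = conn_apply[unfolded conn_pt_def]

lemma conn_vector_field:
  assumes "X \<in> vector_fields A" "Y \<in> vector_fields A"
  shows "conn X Y \<in> vector_fields A"
proof -
  note s = co_smooth[OF assms(1)] co_smooth[OF assms(2)]
    vector_field_smooth[OF assms(1) co_smooth(1)[OF assms(2)]]
    vector_field_smooth[OF assms(1) co_smooth(2)[OF assms(2)]]
    vector_field_smooth[OF assms(1) co_smooth(3)[OF assms(2)]]
  show ?thesis
    unfolding conn_eq[OF assms] by (intro fr_vector_field smooth_near_intros s)
qed

text \<open>For symmetric \<open>M\<close> one has
  \<open>M x \<times> y - M y \<times> x = (tr M - M) (x \<times> y)\<close>. With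
  \<open>M = diag (\<tau>/2, \<tau>/2, c - \<tau>/2)\<close> the factor is
  \<open>diag (c, c, \<tau>)\<close>, the one in \<open>lie_bracket_fr\<close>.\<close>

lemma conn_torsion_free: "torsion_free A conn"
  unfolding torsion_free_def
  by (auto simp: fun_eq_iff conn_eq lie_bracket_fr fr_diff fr_apply algebra_simps)

lemma conn_affine: "affine_connection A conn"
  unfolding affine_connection_def
proof (intro conjI ballI allI impI)
  fix X X' Y assume v: "X \<in> vector_fields A" "X' \<in> vector_fields A" "Y \<in> vector_fields A"
  note t = vector_field_tangent[OF v(1)] vector_field_tangent[OF v(2)]
  note e = conn_eq[OF vector_field_add[OF v(1,2)] v(3)] conn_eq[OF v(3) vector_field_add[OF v(1,2)]]
    conn_eq[OF v(1,3)] conn_eq[OF v(2,3)] conn_eq[OF v(3,1)] conn_eq[OF v(3,2)]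
  have "conn (X + X') Y p = conn X Y p + conn X' Y p" for p
    unfolding e plus_fun_apply[of X X'] co_add[OF t] fr_add fr_eq_iff plus_fun_apply[of "X p" "X' p"]
    by (simp add: algebra_simps)
  then show "conn (X + X') Y = conn X Y + conn X' Y"
    unfolding plus_fun_def[of "conn _ _"] by (rule ext)
  have "conn Y (X + X') p = conn Y X p + conn Y X' p" for p
    unfolding e plus_fun_apply[of X X'] co_add[OF t] fr_add fr_eq_iff
      vector_field_apply_add[OF v(3) co_smooth(1)[OF v(1)] co_smooth(1)[OF v(2)]]
      vector_field_apply_add[OF v(3) co_smooth(2)[OF v(1)] co_smooth(2)[OF v(2)]]
      vector_field_apply_add[OF v(3) co_smooth(3)[OF v(1)] co_smooth(3)[OF v(2)]]
    by (simp add: algebra_simps)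
  then show "conn Y (X + X') = conn Y X + conn Y X'"
    unfolding plus_fun_def[of "conn _ _"] by (rule ext)
next
  fix f X Y assume v: "X \<in> vector_fields A" "Y \<in> vector_fields A" and "smooth_fun_on A UNIV f"
  then have f: "smooth_near A p f" for p
    using smooth_fun_on_iff_smooth_near by blast
  have fa: "fmult f V p = f p *\<^sub>R V p" for V :: "'a vfield" and p
    by (simp add: fmult_def)
  note t = vector_field_tangent[OF v(1)] vector_field_tangent[OF v(2)]
  note e = conn_eq[OF vector_field_fmult[OF v(1) f] v(2)] conn_eq[OF v(1) vector_field_fmult[OF v(2) f]]
    conn_eq[OF v]
  have "conn (fmult f X) Y p = fmult f (conn X Y) p" for p
    unfolding e fa co_scaleR[OF t(1)] fr_scaleR fr_eq_iff
    by (simp add: scaleR_fun_def algebra_simps)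
  then show "conn (fmult f X) Y = fmult f (conn X Y)" ..
  have "conn X (fmult f Y) p = X p f *\<^sub>R fr p (co1 p (Y p)) (co2 p (Y p)) (co3 p (Y p)) + f p *\<^sub>R conn X Y p" for p
    unfolding e fa co_scaleR[OF t(2)] fr_scaleR fr_add fr_eq_iff
      vector_field_apply_mult[OF v(1) f co_smooth(1)[OF v(2)]]
      vector_field_apply_mult[OF v(1) f co_smooth(2)[OF v(2)]]
      vector_field_apply_mult[OF v(1) f co_smooth(3)[OF v(2)]]
    by (simp add: algebra_simps)
  then have "conn X (fmult f Y) p = X p f *\<^sub>R Y p + f p *\<^sub>R conn X Y p" for p
    using frame_expand[OF t(2)] by metis
  then show "conn X (fmult f Y) = fmult (\<lambda>p. X p f) Y + fmult f (conn X Y)"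
    unfolding fmult_def[of "\<lambda>p. X p f"] fmult_def[of f "conn X Y"] plus_fun_def[of "\<lambda>p. X p f *\<^sub>R Y p"]
    by (rule ext)
qed (simp_all add: conn_vector_field)

text \<open>The map \<open>y \<mapsto> M x \<times> y\<close> is skew, so its contributions cancel
  and the product rule remains.\<close>

lemma conn_metric: "metric_connection A g conn"
  unfolding metric_connection_def
proof (intro ballI allI)
  fix X Y Z p assume v: "X \<in> vector_fields A" "Y \<in> vector_fields A" "Z \<in> vector_fields A"
  note t = v[THEN vector_field_tangent]
  have "(\<lambda>q. g q (Y q) (Z q)) =
      (\<lambda>q. co1 q (Y q) * co1 q (Z q) + co2 q (Y q) * co2 q (Z q) + co3 q (Y q) * co3 q (Z q))"
    using metric_eq_co t by blast
  moreover have "X p (\<lambda>q. co1 q (Y q) * co1 q (Z q) + co2 q (Y q) * co2 q (Z q) + co3 q (Y q) * co3 q (Z q)) =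
      g p (conn X Y p) (Z p) + g p (Y p) (conn X Z p)"
    unfolding metric_eq_co[OF vector_field_tangent[OF conn_vector_field[OF v(1,2)]] t(3)]
      metric_eq_co[OF t(2) vector_field_tangent[OF conn_vector_field[OF v(1,3)]]]
    using co_smooth[OF v(2)] co_smooth[OF v(3)]
    by (simp add: conn_eq[OF v(1,2)] conn_eq[OF v(1,3)] vector_field_apply_add[OF v(1)]
        vector_field_apply_mult[OF v(1)] smooth_near_mult smooth_near_add)
      (simp add: algebra_simps)
  ultimately show "X p (\<lambda>q. g q (Y q) (Z q)) = g p (conn X Y p) (Z p) + g p (Y p) (conn X Z p)"
    by simp
qed

text \<open>The difference of two such connections is a tensor that is symmetric in the first two and
  skew in the last two arguments, hence zero.\<close>

lemma levi_civita_unique: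
  assumes D: "affine_connection A D" "torsion_free A D" "metric_connection A g D"
    and v: "X \<in> vector_fields A" "Y \<in> vector_fields A"
  shows "D X Y = conn X Y"
proof
  fix p
  define t where "t X Y Z = g p (D X Y p) (Z p) - g p (conn X Y p) (Z p)" for X Y Z
  have D_vf: "D X Y \<in> vector_fields A" if "X \<in> vector_fields A" "Y \<in> vector_fields A" for X Y
    using D(1) that unfolding affine_connection_def by blast
  have sym: "t X Y Z = t Y X Z"
    if v: "X \<in> vector_fields A" "Y \<in> vector_fields A" "Z \<in> vector_fields A" for X Y Z
  proof -
    have 1: "D X Y p = D Y X p + lie_bracket A X Y p"
      "conn X Y p = conn Y X p + lie_bracket A X Y p"
    proof -
      have "D X Y - D Y X = lie_bracket A X Y" "conn X Y - conn Y X = lie_bracket A X Y"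
        using D(2) conn_torsion_free v unfolding torsion_free_def by simp_all
      from fun_cong[OF this(1), of p] fun_cong[OF this(2), of p]
      show "D X Y p = D Y X p + lie_bracket A X Y p" "conn X Y p = conn Y X p + lie_bracket A X Y p"
        unfolding minus_apply[of "D X Y"] minus_apply[of "conn X Y"] by (simp_all only: diff_eq_eq add.commute)
    qed
    show ?thesis
      unfolding t_def 1
      using v metric_add D_vf conn_vector_field lie_bracket_vector_field vector_field_tangent by simp
  qed
  have skew: "t X Y Z = - t X Z Y"
    if v: "X \<in> vector_fields A" "Y \<in> vector_fields A" "Z \<in> vector_fields A" for X Y Z
  proof -
    have "g p (D X Y p) (Z p) + g p (Y p) (D X Z p) = g p (conn X Y p) (Z p) + g p (Y p) (conn X Z p)"
    proof -
      have "X p (\<lambda>q. g q (Y q) (Z q)) = g p (D X Y p) (Z p) + g p (Y p) (D X Z p)"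
        using D(3)[unfolded metric_connection_def] v by simp
      moreover have "X p (\<lambda>q. g q (Y q) (Z q)) = g p (conn X Y p) (Z p) + g p (Y p) (conn X Z p)"
        using conn_metric[unfolded metric_connection_def] v by simp
      ultimately show ?thesis
        by simp
    qed
    then show ?thesis
      unfolding t_def using metric_sym vector_field_tangent D_vf conn_vector_field v by simp
  qed
  \<comment> \<open>Applied in turn, symmetry and skewness run through the six orders of
    \<open>X\<close>, \<open>Y\<close>, \<open>Z\<close> and return to \<open>t X Y Z\<close> with
    the opposite sign.\<close>
  have t: "t X Y Z = 0" if "Z \<in> vector_fields A" for Z
    using sym[of X Y Z] sym[of Y Z X] sym[of Z X Y] skew[of Y X Z] skew[of Z Y X] skew[of X Z Y] v that
    by simp
  show "D X Y p = conn X Y p"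
    by (rule tangent_eqI)
      (use t frame_vf in \<open>auto simp: t_def co1_def co2_def co3_def vector_field_tangent D_vf conn_vector_field v\<close>)
qed

lemma levi_civita_eq: "levi_civita A g = conn"
  unfolding levi_civita_def
proof (rule the_equality)
  show "affine_connection A conn \<and> torsion_free A conn \<and> metric_connection A g conn \<and>
      (\<forall>X Y. X \<notin> vector_fields A \<or> Y \<notin> vector_fields A \<longrightarrow> conn X Y = 0)"
    using conn_affine conn_torsion_free conn_metric by (simp add: conn_def)
  fix D assume D: "affine_connection A D \<and> torsion_free A D \<and> metric_connection A g D \<and>
      (\<forall>X Y. X \<notin> vector_fields A \<or> Y \<notin> vector_fields A \<longrightarrow> D X Y = 0)"
  show "D = conn"
  proof (intro ext[of D] ext[of "D _"])
    fix X Y show "D X Y = conn X Y"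
    proof (cases "X \<in> vector_fields A \<and> Y \<in> vector_fields A")
      case True
      then show ?thesis
        using levi_civita_unique[of D X Y] D by blast
    next
      case False
      then show ?thesis
        using D unfolding conn_def by auto
    qed
  qed
qed

lemma const_vector_field: "(\<lambda>p. fr p x y z) \<in> vector_fields A"
  by (intro fr_vector_field smooth_near_const)

text \<open>Constant frame coefficients give a global extension. The descriptions in
  \<open>connection_at\<close> and \<open>curvature_at\<close> range over such extensions.\<close>

lemma vector_field_ex:
  assumes "v \<in> tangent_space A p"
  obtains X where "X \<in> vector_fields A" "X p = v"
  using that[OF const_vector_field] frame_expand[OF assms, symmetric] by blast

text \<open>The direction field enters \<open>conn\<close> only through its value at
  \<open>p\<close>, so all its extensions give the same result.\<close>

lemma connection_at_eq:
  assumes "v \<in> tangent_space A p" "X \<in> vector_fields A"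
  shows "connection_at A (levi_civita A g) p v X = conn_pt p v X"
  unfolding connection_at_def levi_civita_eq
proof (rule the_equality)
  obtain Y where Y: "Y \<in> vector_fields A" "Y p = v"
    using vector_field_ex[OF assms(1)] .
  then show "\<exists>Y\<in>vector_fields A. Y p = v \<and> conn_pt p v X = conn Y X p"
    using assms(2) by (intro bexI[of _ Y]) (auto simp: conn_def conn_pt_def)
  fix w assume "\<exists>Y\<in>vector_fields A. Y p = v \<and> w = conn Y X p"
  then show "w = conn_pt p v X"
    using assms(2) by (auto simp: conn_def)
qed

text \<open>\<open>R(x,y)z = N(x \<times> y) \<times> z\<close> with \<open>N = diag (-\<tau>\<^sup>2/4, -\<tau>\<^sup>2/4, 3\<tau>\<^sup>2/4 - c \<tau>)\<close>.\<close>

definition curv :: "'a \<Rightarrow> 'a tvec \<Rightarrow> 'a tvec \<Rightarrow> 'a tvec \<Rightarrow> 'a tvec"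
  where "curv p x y z =
    (let w1 = - \<tau>\<^sup>2 / 4 * (co2 p x * co3 p y - co3 p x * co2 p y);
         w2 = - \<tau>\<^sup>2 / 4 * (co3 p x * co1 p y - co1 p x * co3 p y);
         w3 = (3 * \<tau>\<^sup>2 / 4 - c * \<tau>) * (co1 p x * co2 p y - co2 p x * co1 p y)
     in fr p (w2 * co3 p z - w3 * co2 p z) (w3 * co1 p z - w1 * co3 p z) (w1 * co2 p z - w2 * co1 p z))"

text \<open>Derivatives of the coefficients cancel, those of \<open>Z\<close> with the help of the
  bracket term. The commutator of the cross products with \<open>M x\<close> and \<open>M y\<close>
  leaves the cofactor matrix \<open>cof M\<close>, the bracket leaves \<open>M (tr M - M)\<close>,
  and \<open>N = cof M - M (tr M - M)\<close>.\<close>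

lemma curvature_eq:
  assumes X: "X \<in> vector_fields A" and Y: "Y \<in> vector_fields A" and Z: "Z \<in> vector_fields A"
  shows "curvature A conn X Y Z p = curv p (X p) (Y p) (Z p)"
proof -
  note vf = conn_vector_field[OF X Z] conn_vector_field[OF Y Z] lie_bracket_vector_field[OF X Y]
  have s: "smooth_near A p (\<lambda>q. V q (\<lambda>q. co1 q (Z q)))" "smooth_near A p (\<lambda>q. V q (\<lambda>q. co2 q (Z q)))"
    "smooth_near A p (\<lambda>q. V q (\<lambda>q. co3 q (Z q)))" if "V \<in> vector_fields A" for V
    using that co_smooth[OF Z] vector_field_smooth by auto
  have b: "lie_bracket A X Y p f = X p (\<lambda>q. Y q f) - Y p (\<lambda>q. X q f)" if "smooth_near A p f" for f
    using that by (simp add: lie_bracket_def)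
  note b = b[OF co_smooth(1)[OF Z]] b[OF co_smooth(2)[OF Z]] b[OF co_smooth(3)[OF Z]]
  have co: "co1 p (lie_bracket A X Y p) = X p (\<lambda>q. co1 q (Y q)) - Y p (\<lambda>q. co1 q (X q)) +
      c * (co2 p (X p) * co3 p (Y p) - co3 p (X p) * co2 p (Y p))"
    "co2 p (lie_bracket A X Y p) = X p (\<lambda>q. co2 q (Y q)) - Y p (\<lambda>q. co2 q (X q)) +
      c * (co3 p (X p) * co1 p (Y p) - co1 p (X p) * co3 p (Y p))"
    "co3 p (lie_bracket A X Y p) = X p (\<lambda>q. co3 q (Y q)) - Y p (\<lambda>q. co3 q (X q)) +
      \<tau> * (co1 p (X p) * co2 p (Y p) - co2 p (X p) * co1 p (Y p))"
    unfolding lie_bracket_fr[OF X Y] co_fr by simp_all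
  have 1: "curvature A conn X Y Z p =
      conn X (conn Y Z) p - conn Y (conn X Z) p - conn (lie_bracket A X Y) Z p"
    by (simp add: curvature_def)
  \<comment> \<open>Here \<open>M = diag (m, m, n)\<close>; in these letters the structure constants
    \<open>\<tau> = 2 m\<close> and \<open>c = n + m\<close> are free of fractions.\<close>
  obtain m n where mn: "\<tau> / 2 = m" "c - \<tau> / 2 = n"
    by blast
  then have \<tau>c: "\<tau> = 2 * m" "c = n + m"
    by auto
  show ?thesis
    unfolding 1 conn_eq[OF X vf(2)] conn_eq[OF Y vf(1)] conn_eq[OF vf(3) Z] fr_diff curv_def Let_def fr_eq_iff
    unfolding conn_eq[OF X Z] conn_eq[OF Y Z] co_fr b co mn
    by (simp add: vector_field_apply[OF X] vector_field_apply[OF Y] vector_field_apply_const[OF X]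
         vector_field_apply_const[OF Y] s[OF X] s[OF Y] co_smooth[OF X]
         co_smooth[OF Y] co_smooth[OF Z] smooth_near_intros)
       (simp add: \<tau>c power2_eq_square field_simps)
qed

lemma curvature_at_eq:
  assumes "x \<in> tangent_space A p" "y \<in> tangent_space A p" "z \<in> tangent_space A p"
  shows "curvature_at A (levi_civita A g) p x y z = curv p x y z"
  unfolding curvature_at_def levi_civita_eq
proof (rule the_equality)
  obtain X where X: "X \<in> vector_fields A" "X p = x"
    using vector_field_ex[OF assms(1)] .
  obtain Y where Y: "Y \<in> vector_fields A" "Y p = y"
    using vector_field_ex[OF assms(2)] .
  obtain Z where Z: "Z \<in> vector_fields A" "Z p = z"
    using vector_field_ex[OF assms(3)] .
  show "\<exists>X\<in>vector_fields A. \<exists>Y\<in>vector_fields A. \<exists>Z\<in>vector_fields A.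
      X p = x \<and> Y p = y \<and> Z p = z \<and> curv p x y z = curvature A conn X Y Z p"
    using X Y Z curvature_eq[OF X(1) Y(1) Z(1), of p]
    by (intro bexI[OF _ X(1)] bexI[OF _ Y(1)] bexI[OF _ Z(1)]) simp
  fix w assume "\<exists>X\<in>vector_fields A. \<exists>Y\<in>vector_fields A. \<exists>Z\<in>vector_fields A.
      X p = x \<and> Y p = y \<and> Z p = z \<and> w = curvature A conn X Y Z p"
  then obtain X Y Z where "X \<in> vector_fields A" "Y \<in> vector_fields A" "Z \<in> vector_fields A"
    "X p = x" "Y p = y" "Z p = z" "w = curvature A conn X Y Z p"
    by blast
  then show "w = curv p x y z"
    using curvature_eq[of X Y Z p] by simp
qed

end


section \<open>Fields along a curve\<close>

text \<open>Treats functions of the curve parameter as functions on a manifold with a single chart,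
  so that the closure rules for \<open>smooth_near\<close> also apply to them.\<close>

interpretation line: smooth_manifold "std_atlas :: (real, real) atlas"
proof
  have "homeomorphism UNIV UNIV (\<lambda>x::real. x) (\<lambda>x. x)"
    by (simp add: homeomorphism_ident)
  then show "smooth_atlas (std_atlas :: (real, real) atlas)"
    by (auto simp: smooth_atlas_def std_atlas_def o_def inv_id[unfolded id_def] smooth_on_ident)
qed

lemma smooth_near_line:
  fixes h :: "real \<Rightarrow> real"
  shows "smooth_near std_atlas t h \<longleftrightarrow> (\<exists>T. open T \<and> t \<in> T \<and> smooth_on T h)"
  using line.smooth_near_chart[of UNIV "\<lambda>x. x" t h] by (simp add: std_atlas_def inv_id[unfolded id_def])

lemma smooth_on_iff_smooth_near:
  fixes h :: "real \<Rightarrow> real"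
  assumes "open S"
  shows "smooth_on S h \<longleftrightarrow> (\<forall>t\<in>S. smooth_near std_atlas t h)"
  unfolding smooth_near_line using assms smooth_on_local[of S h] by blast

lemmas smooth_on_UNIV_intros = smooth_on_add[OF open_UNIV] smooth_on_diff[OF open_UNIV]
  smooth_on_mult[OF open_UNIV] smooth_on_minus[OF open_UNIV] smooth_on_deriv[OF open_UNIV]

locale M3_curve = M3_frame A g u1 u2 u3 \<tau> c
  for A :: "('a::{t2_space, second_countable_topology}, real^3) atlas"
    and g :: "'a metric" and u1 u2 u3 :: "'a vfield" and \<tau> c :: real +
  fixes \<gamma> :: "real \<Rightarrow> 'a"
  assumes curve: "smooth_curve A \<gamma>"
begin

lemma curve_continuous: "continuous_on UNIV \<gamma>"
  using curve unfolding smooth_curve_def smooth_map_on_def by blast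

lemma smooth_near_curve:
  assumes "smooth_near A (\<gamma> t) f"
  shows "smooth_near std_atlas t (\<lambda>s. f (\<gamma> s))"
proof -
  obtain V \<psi> where V: "(V, \<psi>) \<in> A" "\<gamma> t \<in> V"
    by (rule chart_ex)
  obtain T where T: "open T" "\<psi> (\<gamma> t) \<in> T" "smooth_on T (\<lambda>x. f (inv_into V \<psi> x))"
    using assms unfolding smooth_near_chart[OF V] by blast
  have "smooth_on (\<gamma> -` V) (\<lambda>s. \<psi> (\<gamma> s))"
    using curve V(1) unfolding smooth_curve_def smooth_map_on_def std_atlas_def
    by (auto simp: o_def inv_id[unfolded id_def])
  note sm = this
  have o: "open (\<gamma> -` V)"
    using continuous_open_preimage[OF curve_continuous open_UNIV chart_open(1)[OF V(1)]] by simp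
  have o2: "open (\<gamma> -` V \<inter> (\<lambda>s. \<psi> (\<gamma> s)) -` T)"
    by (rule continuous_open_preimage[OF smooth_on_imp_continuous_on[OF sm] o T(1)])
  have "smooth_on (\<gamma> -` V \<inter> (\<lambda>s. \<psi> (\<gamma> s)) -` T) (\<lambda>s. f (inv_into V \<psi> (\<psi> (\<gamma> s))))"
    by (rule smooth_on_compose[OF o2 T(1) smooth_on_subset[OF sm] T(3)]) auto
  then have "smooth_on (\<gamma> -` V \<inter> (\<lambda>s. \<psi> (\<gamma> s)) -` T) (\<lambda>s. f (\<gamma> s))"
    by (rule smooth_on_cong[OF o2, rotated]) (simp add: chart_inv[OF V(1)])
  then show ?thesis
    unfolding smooth_near_line using o2 V(2) T(2)
    by (intro exI[of _ "\<gamma> -` V \<inter> (\<lambda>s. \<psi> (\<gamma> s)) -` T"]) simp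
qed

lemma velocity_has_derivative:
  assumes "smooth_near A (\<gamma> t) f"
  shows "((\<lambda>s. f (\<gamma> s)) has_field_derivative velocity A \<gamma> t f) (at t)"
proof -
  obtain T where "t \<in> T" "smooth_on T (\<lambda>s. f (\<gamma> s))"
    using smooth_near_curve[OF assms] unfolding smooth_near_line by blast
  from smooth_on_has_field_derivative[OF this(2,1)] show ?thesis
    using assms by (simp add: velocity_def o_def)
qed

lemma velocity_tangent: "velocity A \<gamma> t \<in> tangent_space A (\<gamma> t)"
proof -
  have d: "(\<lambda>s. f (\<gamma> s)) differentiable (at t)" if "smooth_near A (\<gamma> t) f" for f
    using velocity_has_derivative[OF that] real_differentiable_def by blast
  have "velocity A \<gamma> t = (\<lambda>f. if smooth_near A (\<gamma> t) f then frechet_derivative (\<lambda>s. f (\<gamma> s)) (at t) 1 else 0)"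
    using frechet_derivative_eq_deriv[OF d] by (auto simp: fun_eq_iff velocity_def o_def)
  also have "\<dots> \<in> tangent_space A (\<gamma> t)"
    by (rule push_tangent_space[OF _ d]) (use curve_continuous in \<open>simp_all add: continuous_on_eq_continuous_at\<close>)
  finally show ?thesis .
qed

lemma along_tangent: "V \<in> vector_fields_along A \<gamma> \<Longrightarrow> V t \<in> tangent_space A (\<gamma> t)"
  by (simp add: vector_fields_along_def)

lemma along_smooth_near:
  assumes "V \<in> vector_fields_along A \<gamma>" "smooth_near A (\<gamma> t) f"
  shows "smooth_near std_atlas t (\<lambda>s. V s f)"
proof -
  obtain W where W: "open W" "\<gamma> t \<in> W" "smooth_fun_on A W f"
    using assms(2) unfolding smooth_near_def by blast
  then have "smooth_on (\<gamma> -` W) (\<lambda>s. V s f)"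
    using assms(1) unfolding vector_fields_along_def by simp
  moreover have "open (\<gamma> -` W)"
    using continuous_open_preimage[OF curve_continuous open_UNIV W(1)] by simp
  ultimately show ?thesis
    unfolding smooth_near_line using W(2) by (intro exI[of _ "\<gamma> -` W"]) simp
qed

lemma alongI:
  assumes "\<And>t. V t \<in> tangent_space A (\<gamma> t)"
    and "\<And>t f. smooth_near A (\<gamma> t) f \<Longrightarrow> smooth_near std_atlas t (\<lambda>s. V s f)"
  shows "V \<in> vector_fields_along A \<gamma>"
proof -
  have "smooth_on (\<gamma> -` W) (\<lambda>t. V t f)" if W: "open W" and f: "smooth_fun_on A W f" for W f
  proof -
    have "open (\<gamma> -` W)"
      using continuous_open_preimage[OF curve_continuous open_UNIV W] by simp
    then show ?thesis
      using f assms(2) unfolding smooth_on_iff_smooth_near[OF \<open>open (\<gamma> -` W)\<close>]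
        smooth_fun_on_iff_smooth_near[OF W] by simp
  qed
  then show ?thesis
    using assms(1) unfolding vector_fields_along_def by simp
qed

lemma velocity_along: "velocity A \<gamma> \<in> vector_fields_along A \<gamma>"
proof (rule alongI[OF velocity_tangent])
  fix t f assume f: "smooth_near A (\<gamma> t) f"
  obtain W where W: "open W" "\<gamma> t \<in> W" "\<And>q. q \<in> W \<Longrightarrow> smooth_near A q f"
    using smooth_near_eventually[OF f] by blast
  have o: "open (\<gamma> -` W)"
    using continuous_open_preimage[OF curve_continuous open_UNIV W(1)] by simp
  then have "smooth_on (\<gamma> -` W) (\<lambda>s. f (\<gamma> s))"
    unfolding smooth_on_iff_smooth_near[OF o] using smooth_near_curve[OF W(3)] by simp
  then have "smooth_on (\<gamma> -` W) (deriv (\<lambda>s. f (\<gamma> s)))"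
    by (rule smooth_on_deriv[OF o])
  then have "smooth_on (\<gamma> -` W) (\<lambda>s. velocity A \<gamma> s f)"
    by (rule smooth_on_cong[OF o, rotated]) (simp add: velocity_def W(3) o_def)
  then show "smooth_near std_atlas t (\<lambda>s. velocity A \<gamma> s f)"
    unfolding smooth_near_line using o W(2) by (intro exI[of _ "\<gamma> -` W"]) simp
qed

lemma restriction_along:
  assumes "X \<in> vector_fields A"
  shows "(\<lambda>t. X (\<gamma> t)) \<in> vector_fields_along A \<gamma>"
  by (rule alongI)
    (rule vector_field_tangent[OF assms], rule smooth_near_curve[OF vector_field_smooth[OF assms]])

section \<open>Frame components of fields along the curve\<close>

definition frc :: "(real \<Rightarrow> real) \<Rightarrow> (real \<Rightarrow> real) \<Rightarrow> (real \<Rightarrow> real) \<Rightarrow> 'a curve_vfield"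
  where "frc x y z = (\<lambda>t. fr (\<gamma> t) (x t) (y t) (z t))"

lemma frc_along:
  assumes "smooth_on UNIV x" "smooth_on UNIV y" "smooth_on UNIV z"
  shows "frc x y z \<in> vector_fields_along A \<gamma>"
proof (rule alongI)
  show "frc x y z t \<in> tangent_space A (\<gamma> t)" for t
    by (simp add: frc_def fr_tangent)
  fix t f assume f: "smooth_near A (\<gamma> t) f"
  have "smooth_near std_atlas t x" "smooth_near std_atlas t y" "smooth_near std_atlas t z"
    using assms smooth_on_iff_smooth_near[OF open_UNIV] by blast+
  moreover note smooth_near_curve[OF vector_field_smooth[OF frame_vf(1) f]]
    smooth_near_curve[OF vector_field_smooth[OF frame_vf(2) f]]
    smooth_near_curve[OF vector_field_smooth[OF frame_vf(3) f]]
  ultimately show "smooth_near std_atlas t (\<lambda>s. frc x y z s f)"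
    unfolding frc_def fr_apply by (intro line.smooth_near_intros)
qed

text \<open>In a chart, the frame coefficients of a field along the curve solve a linear system with
  smooth invertible matrix, so that they are smooth by Cramer's rule.\<close>

lemma frame_chart_matrix:
  assumes U: "(U, \<phi>) \<in> A" "p \<in> U"
  defines "m \<equiv> (\<lambda>i j. (if i = 1 then u1 p else if i = 2 then u2 p else u3 p) (\<lambda>q. \<phi> q \<bullet> axis j 1))"
  shows "det (\<chi> j i. m i j :: real^3^3) \<noteq> 0"
proof -
  obtain c1 c2 c3 where c: "u1 p = chart_vector A U \<phi> p c1" "u2 p = chart_vector A U \<phi> p c2"
    "u3 p = chart_vector A U \<phi> p c3"
    using frame_tangent[of p] unfolding tangent_space_chart[OF U] by blast
  have m: "m i j = (if i = 1 then c1 else if i = 2 then c2 else c3) $ j" for i j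
  proof -
    have "chart_vector A U \<phi> p k (\<lambda>q. \<phi> q \<bullet> axis j 1) = k $ j" for k
      using chart_vector_coord[OF U, of k "axis j 1"]
      by (simp only: inner_axis inner_real_def mult_1_right)
    then show ?thesis
      by (cases "i = 1"; cases "i = 2") (simp_all only: m_def c if_True if_False simp_thms)
  qed
  have "x = 0" if "(\<chi> j i. m i j) *v x = 0" for x :: "real^3"
  proof -
    have "x $ 1 *\<^sub>R c1 + x $ 2 *\<^sub>R c2 + x $ 3 *\<^sub>R c3 = 0"
      using that by (simp add: vec_eq_iff matrix_vector_mult_def m sum_3 mult.commute)
    then have "fr p (x $ 1) (x $ 2) (x $ 3) = chart_vector A U \<phi> p 0"
      using chart_vector_linear[OF U, of "x $ 1" c1 "x $ 2" c2]
        chart_vector_linear[OF U, of 1 "x $ 1 *\<^sub>R c1 + x $ 2 *\<^sub>R c2" "x $ 3" c3]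
      by (simp add: fr_def c)
    also have "\<dots> = 0"
      using chart_vector_linear[OF U, of 0 0 0 0] by simp
    finally show ?thesis
      by (simp add: fr_eq_0_iff vec_eq_iff forall_3)
  qed
  then show ?thesis
    using matrix_left_invertible_ker invertible_left_inverse invertible_det_nz by blast
qed

text \<open>\<open>riemannian_metric\<close> promises smooth products only for vector fields of the
  manifold. A field along the curve need not be the restriction of one, hence the detour through a
  chart.\<close>

lemma co_along_smooth:
  assumes V: "V \<in> vector_fields_along A \<gamma>"
  shows "smooth_on UNIV (\<lambda>t. co1 (\<gamma> t) (V t))" "smooth_on UNIV (\<lambda>t. co2 (\<gamma> t) (V t))"
    "smooth_on UNIV (\<lambda>t. co3 (\<gamma> t) (V t))"
proof -
  have "smooth_near std_atlas t (\<lambda>t. co1 (\<gamma> t) (V t)) \<and> smooth_near std_atlas t (\<lambda>t. co2 (\<gamma> t) (V t)) \<and>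
      smooth_near std_atlas t (\<lambda>t. co3 (\<gamma> t) (V t))" for t
  proof -
    obtain U \<phi> where U: "(U, \<phi>) \<in> A" "\<gamma> t \<in> U"
      by (rule chart_ex)
    define h where "h j = (\<lambda>q. \<phi> q \<bullet> axis j (1::real))" for j :: 3
    have h: "smooth_near A (\<gamma> t) (h j)" for j
      unfolding h_def by (rule smooth_near_coord[OF U])
    define m1 m2 m3 a where m: "m1 = (\<lambda>j s. u1 (\<gamma> s) (h j))" "m2 = (\<lambda>j s. u2 (\<gamma> s) (h j))"
      "m3 = (\<lambda>j s. u3 (\<gamma> s) (h j))" "a = (\<lambda>j s. V s (h j))"
    have s: "smooth_near std_atlas t (m1 j)" "smooth_near std_atlas t (m2 j)"
      "smooth_near std_atlas t (m3 j)" "smooth_near std_atlas t (a j)" for j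
      unfolding m
      by (rule smooth_near_curve[OF vector_field_smooth[OF frame_vf(1) h]]
          smooth_near_curve[OF vector_field_smooth[OF frame_vf(2) h]]
          smooth_near_curve[OF vector_field_smooth[OF frame_vf(3) h]] along_smooth_near[OF V h])+
    \<comment> \<open>Determinant of the system for the frame coefficients; nonzero over
      \<open>U\<close> by \<open>frame_chart_matrix\<close>.\<close>
    define d where "d s = m1 1 s * (m2 2 s * m3 3 s - m3 2 s * m2 3 s) - m2 1 s * (m1 2 s * m3 3 s - m3 2 s * m1 3 s)
      + m3 1 s * (m1 2 s * m2 3 s - m2 2 s * m1 3 s)" for s
    have d0: "d s \<noteq> 0" if "\<gamma> s \<in> U" for s
      using frame_chart_matrix[OF U(1) that] unfolding det_3 d_def m h_def by (simp add: algebra_simps)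
    have ds: "smooth_near std_atlas t (\<lambda>s. inverse (d s))"
      by (rule line.smooth_near_inverse[where f = d and p = t, OF _ d0[OF U(2)]])
        (unfold d_def, intro line.smooth_near_intros s)
    have o: "open (\<gamma> -` U)"
      using continuous_open_preimage[OF curve_continuous open_UNIV chart_open(1)[OF U(1)]] by simp
    have a: "a j s = co1 (\<gamma> s) (V s) * m1 j s + co2 (\<gamma> s) (V s) * m2 j s + co3 (\<gamma> s) (V s) * m3 j s" for j s
      unfolding m by (rule tangent_apply[OF along_tangent[OF V]])
    \<comment> \<open>The numerator is \<open>d\<close> with the column \<open>m1\<close> replaced
      by \<open>a\<close>; the other two coefficients replace \<open>m2\<close> and
      \<open>m3\<close>.\<close>
    have x: "inverse (d s) * (a 1 s * (m2 2 s * m3 3 s - m3 2 s * m2 3 s) - m2 1 s * (a 2 s * m3 3 s - m3 2 s * a 3 s)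
      + m3 1 s * (a 2 s * m2 3 s - m2 2 s * a 3 s)) = co1 (\<gamma> s) (V s)" if "s \<in> \<gamma> -` U" for s
    proof -
      have "a 1 s * (m2 2 s * m3 3 s - m3 2 s * m2 3 s) - m2 1 s * (a 2 s * m3 3 s - m3 2 s * a 3 s)
      + m3 1 s * (a 2 s * m2 3 s - m2 2 s * a 3 s) = d s * co1 (\<gamma> s) (V s)"
        unfolding a d_def by algebra
      then show ?thesis using d0 that by simp
    qed
    have y: "inverse (d s) * (m1 1 s * (a 2 s * m3 3 s - m3 2 s * a 3 s) - a 1 s * (m1 2 s * m3 3 s - m3 2 s * m1 3 s)
      + m3 1 s * (m1 2 s * a 3 s - a 2 s * m1 3 s)) = co2 (\<gamma> s) (V s)" if "s \<in> \<gamma> -` U" for s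
    proof -
      have "m1 1 s * (a 2 s * m3 3 s - m3 2 s * a 3 s) - a 1 s * (m1 2 s * m3 3 s - m3 2 s * m1 3 s)
      + m3 1 s * (m1 2 s * a 3 s - a 2 s * m1 3 s) = d s * co2 (\<gamma> s) (V s)"
        unfolding a d_def by algebra
      then show ?thesis using d0 that by simp
    qed
    have z: "inverse (d s) * (m1 1 s * (m2 2 s * a 3 s - a 2 s * m2 3 s) - m2 1 s * (m1 2 s * a 3 s - a 2 s * m1 3 s)
      + a 1 s * (m1 2 s * m2 3 s - m2 2 s * m1 3 s)) = co3 (\<gamma> s) (V s)" if "s \<in> \<gamma> -` U" for s
    proof -
      have "m1 1 s * (m2 2 s * a 3 s - a 2 s * m2 3 s) - m2 1 s * (m1 2 s * a 3 s - a 2 s * m1 3 s)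
      + a 1 s * (m1 2 s * m2 3 s - m2 2 s * m1 3 s) = d s * co3 (\<gamma> s) (V s)"
        unfolding a d_def by algebra
      then show ?thesis using d0 that by simp
    qed
    have t: "t \<in> \<gamma> -` U"
      using U(2) by simp
    show ?thesis
      by (intro conjI; rule line.smooth_near_cong[OF o t], erule x y z, intro line.smooth_near_intros s ds)
  qed
  then show "smooth_on UNIV (\<lambda>t. co1 (\<gamma> t) (V t))" "smooth_on UNIV (\<lambda>t. co2 (\<gamma> t) (V t))"
    "smooth_on UNIV (\<lambda>t. co3 (\<gamma> t) (V t))"
    by (simp_all add: smooth_on_iff_smooth_near)
qed

lemma along_eq_frc:
  assumes "V \<in> vector_fields_along A \<gamma>"
  shows "V = frc (\<lambda>t. co1 (\<gamma> t) (V t)) (\<lambda>t. co2 (\<gamma> t) (V t)) (\<lambda>t. co3 (\<gamma> t) (V t))"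
  unfolding frc_def using frame_expand[OF along_tangent[OF assms]] by (rule ext)

lemma along_add:
  assumes "V \<in> vector_fields_along A \<gamma>" "W \<in> vector_fields_along A \<gamma>"
  shows "V + W \<in> vector_fields_along A \<gamma>"
proof (rule alongI)
  show "(V + W) t \<in> tangent_space A (\<gamma> t)" for t
    using tangent_space_add[OF along_tangent[OF assms(1)] along_tangent[OF assms(2)]]
    unfolding plus_fun_apply[of V W] .
  show "smooth_near std_atlas t (\<lambda>s. (V + W) s f)" if "smooth_near A (\<gamma> t) f" for t f
    using line.smooth_near_add[OF along_smooth_near[OF assms(1) that] along_smooth_near[OF assms(2) that]]
    unfolding plus_fun_apply .
qed

lemma along_fmult:
  assumes "V \<in> vector_fields_along A \<gamma>" "smooth_on UNIV f"
  shows "fmult f V \<in> vector_fields_along A \<gamma>"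
proof (rule alongI)
  show "fmult f V t \<in> tangent_space A (\<gamma> t)" for t
    unfolding fmult_def by (rule tangent_space_scaleR[OF along_tangent[OF assms(1)]])
  have "smooth_near std_atlas t f" for t
    using assms(2) smooth_on_iff_smooth_near by blast
  then show "smooth_near std_atlas t (\<lambda>s. fmult f V s h)" if "smooth_near A (\<gamma> t) h" for t h
    using line.smooth_near_mult[OF _ along_smooth_near[OF assms(1) that]]
    by (simp add: fmult_def scaleR_fun_def)
qed

section \<open>The covariant derivative along the curve\<close>

abbreviation v1 :: "real \<Rightarrow> real" where "v1 t \<equiv> co1 (\<gamma> t) (velocity A \<gamma> t)"
abbreviation v2 :: "real \<Rightarrow> real" where "v2 t \<equiv> co2 (\<gamma> t) (velocity A \<gamma> t)"
abbreviation v3 :: "real \<Rightarrow> real" where "v3 t \<equiv> co3 (\<gamma> t) (velocity A \<gamma> t)"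

text \<open>The formula of \<open>conn_pt\<close> in the direction of the velocity, with time
  derivatives of the coefficients. Off the fields along the curve the value is the 0 that
  \<open>is_covariant_derivative_along\<close> prescribes.\<close>

definition cov :: "'a curve_vfield \<Rightarrow> 'a curve_vfield"
  where "cov V = (if V \<in> vector_fields_along A \<gamma> then frc
    (\<lambda>t. deriv (\<lambda>s. co1 (\<gamma> s) (V s)) t + \<tau> / 2 * (v2 t * co3 (\<gamma> t) (V t)) - (c - \<tau> / 2) * (v3 t * co2 (\<gamma> t) (V t)))
    (\<lambda>t. deriv (\<lambda>s. co2 (\<gamma> s) (V s)) t + (c - \<tau> / 2) * (v3 t * co1 (\<gamma> t) (V t)) - \<tau> / 2 * (v1 t * co3 (\<gamma> t) (V t)))
    (\<lambda>t. deriv (\<lambda>s. co3 (\<gamma> s) (V s)) t + \<tau> / 2 * (v1 t * co2 (\<gamma> t) (V t)) - \<tau> / 2 * (v2 t * co1 (\<gamma> t) (V t)))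
    else 0)"

lemma cov_apply:
  assumes "V \<in> vector_fields_along A \<gamma>"
  shows "cov V t = fr (\<gamma> t)
    (deriv (\<lambda>s. co1 (\<gamma> s) (V s)) t + \<tau> / 2 * (v2 t * co3 (\<gamma> t) (V t)) - (c - \<tau> / 2) * (v3 t * co2 (\<gamma> t) (V t)))
    (deriv (\<lambda>s. co2 (\<gamma> s) (V s)) t + (c - \<tau> / 2) * (v3 t * co1 (\<gamma> t) (V t)) - \<tau> / 2 * (v1 t * co3 (\<gamma> t) (V t)))
    (deriv (\<lambda>s. co3 (\<gamma> s) (V s)) t + \<tau> / 2 * (v1 t * co2 (\<gamma> t) (V t)) - \<tau> / 2 * (v2 t * co1 (\<gamma> t) (V t)))"
  using assms by (simp add: cov_def frc_def)

lemma cov_frc: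
  assumes "smooth_on UNIV x" "smooth_on UNIV y" "smooth_on UNIV z"
  shows "cov (frc x y z) = frc
    (\<lambda>t. deriv x t + \<tau> / 2 * (v2 t * z t) - (c - \<tau> / 2) * (v3 t * y t))
    (\<lambda>t. deriv y t + (c - \<tau> / 2) * (v3 t * x t) - \<tau> / 2 * (v1 t * z t))
    (\<lambda>t. deriv z t + \<tau> / 2 * (v1 t * y t) - \<tau> / 2 * (v2 t * x t))"
  using frc_along[OF assms] by (simp add: cov_def) (simp add: frc_def)

lemma cov_along:
  assumes "V \<in> vector_fields_along A \<gamma>"
  shows "cov V \<in> vector_fields_along A \<gamma>"
  unfolding cov_def if_P[OF assms]
  by (intro frc_along smooth_on_UNIV_intros smooth_on_const co_along_smooth assms velocity_along)

lemma co_along_deriv: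
  assumes "V \<in> vector_fields_along A \<gamma>"
  shows "((\<lambda>s. co1 (\<gamma> s) (V s)) has_field_derivative deriv (\<lambda>s. co1 (\<gamma> s) (V s)) t) (at t)"
    "((\<lambda>s. co2 (\<gamma> s) (V s)) has_field_derivative deriv (\<lambda>s. co2 (\<gamma> s) (V s)) t) (at t)"
    "((\<lambda>s. co3 (\<gamma> s) (V s)) has_field_derivative deriv (\<lambda>s. co3 (\<gamma> s) (V s)) t) (at t)"
  using co_along_smooth[OF assms] smooth_on_has_field_derivative by blast+

lemma cov_is_covariant_derivative: "is_covariant_derivative_along A (levi_civita A g) \<gamma> cov"
  unfolding is_covariant_derivative_along_def
proof (intro conjI ballI allI impI)
  fix V W assume v: "V \<in> vector_fields_along A \<gamma>" "W \<in> vector_fields_along A \<gamma>"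
  have "cov (V + W) t = cov V t + cov W t" for t
    unfolding cov_apply[OF along_add[OF v]] cov_apply[OF v(1)] cov_apply[OF v(2)] fr_add fr_eq_iff
      plus_fun_apply[of V W] co_add[OF along_tangent[OF v(1)] along_tangent[OF v(2)]]
      DERIV_imp_deriv[OF DERIV_add[OF co_along_deriv(1)[OF v(1)] co_along_deriv(1)[OF v(2)]]]
      DERIV_imp_deriv[OF DERIV_add[OF co_along_deriv(2)[OF v(1)] co_along_deriv(2)[OF v(2)]]]
      DERIV_imp_deriv[OF DERIV_add[OF co_along_deriv(3)[OF v(1)] co_along_deriv(3)[OF v(2)]]]
    by (simp add: algebra_simps)
  then show "cov (V + W) = cov V + cov W"
    unfolding plus_fun_def[of "cov V"] by (rule ext)
next
  fix f :: "real \<Rightarrow> real" and V assume v: "V \<in> vector_fields_along A \<gamma>" and f: "smooth_on UNIV f"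
  have fa: "fmult f V t = f t *\<^sub>R V t" for t
    by (simp add: fmult_def)
  have f': "(f has_field_derivative deriv f t) (at t)" for t
    using smooth_on_has_field_derivative[OF f] by blast
  have "cov (fmult f V) t = deriv f t *\<^sub>R fr (\<gamma> t) (co1 (\<gamma> t) (V t)) (co2 (\<gamma> t) (V t)) (co3 (\<gamma> t) (V t)) + f t *\<^sub>R cov V t" for t
    unfolding cov_apply[OF along_fmult[OF v f]] cov_apply[OF v] fr_add fr_scaleR fr_eq_iff
      fa co_scaleR[OF along_tangent[OF v]]
      DERIV_imp_deriv[OF DERIV_mult[OF f' co_along_deriv(1)[OF v]]]
      DERIV_imp_deriv[OF DERIV_mult[OF f' co_along_deriv(2)[OF v]]]
      DERIV_imp_deriv[OF DERIV_mult[OF f' co_along_deriv(3)[OF v]]]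
    by (simp add: algebra_simps)
  then have "cov (fmult f V) t = deriv f t *\<^sub>R V t + f t *\<^sub>R cov V t" for t
    unfolding frame_expand[OF along_tangent[OF v], symmetric] .
  then show "cov (fmult f V) = fmult (deriv f) V + fmult f (cov V)"
    unfolding fmult_def[of "deriv f"] fmult_def[of f "cov V"] plus_fun_def[of "\<lambda>t. deriv f t *\<^sub>R V t"]
    by (rule ext)
next
  fix X t assume X: "X \<in> vector_fields A"
  show "cov (\<lambda>t. X (\<gamma> t)) t = connection_at A (levi_civita A g) (\<gamma> t) (velocity A \<gamma> t) X"
    unfolding connection_at_eq[OF velocity_tangent X] cov_apply[OF restriction_along[OF X]] conn_pt_def
      DERIV_imp_deriv[OF velocity_has_derivative[OF co_smooth(1)[OF X]]]
      DERIV_imp_deriv[OF velocity_has_derivative[OF co_smooth(2)[OF X]]]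
      DERIV_imp_deriv[OF velocity_has_derivative[OF co_smooth(3)[OF X]]] ..
next
  fix V assume "V \<notin> vector_fields_along A \<gamma>"
  then show "cov V = 0"
    by (simp add: cov_def)
qed (rule cov_along)

text \<open>A field along the curve is a combination of the three restricted frame fields with
  smooth coefficients; additivity, the product rule and the connection fix every candidate on such
  combinations.\<close>

lemma covariant_derivative_along_eq: "covariant_derivative_along A g \<gamma> = cov"
  unfolding covariant_derivative_along_def
proof (rule the_equality)
  show "is_covariant_derivative_along A (levi_civita A g) \<gamma> cov"
    by (rule cov_is_covariant_derivative)
  fix Dt assume Dt: "is_covariant_derivative_along A (levi_civita A g) \<gamma> Dt"
  note D = Dt[unfolded is_covariant_derivative_along_def]
    cov_is_covariant_derivative[unfolded is_covariant_derivative_along_def]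
  have *: "Dt V = cov V" if V: "V \<in> vector_fields_along A \<gamma>" for V
  proof -
    define x where "x t = co1 (\<gamma> t) (V t)" for t
    define y where "y t = co2 (\<gamma> t) (V t)" for t
    define z where "z t = co3 (\<gamma> t) (V t)" for t
    have s: "smooth_on UNIV x" "smooth_on UNIV y" "smooth_on UNIV z"
      using co_along_smooth[OF V] by (simp_all add: x_def[abs_def] y_def[abs_def] z_def[abs_def])
    define e1 where "e1 = (\<lambda>t. u1 (\<gamma> t))"
    define e2 where "e2 = (\<lambda>t. u2 (\<gamma> t))"
    define e3 where "e3 = (\<lambda>t. u3 (\<gamma> t))"
    have e: "e1 \<in> vector_fields_along A \<gamma>" "e2 \<in> vector_fields_along A \<gamma>" "e3 \<in> vector_fields_along A \<gamma>"
      unfolding e1_def e2_def e3_def by (intro restriction_along frame_vf)+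
    have eq: "Dt e1 = cov e1" "Dt e2 = cov e2" "Dt e3 = cov e3"
      using D frame_vf unfolding e1_def e2_def e3_def by (auto intro!: ext[of "Dt _" "cov _"])
    have V_eq: "V = fmult x e1 + fmult y e2 + fmult z e3"
      by (subst along_eq_frc[OF V])
        (simp add: frc_def fr_def fmult_def e1_def e2_def e3_def x_def y_def z_def plus_fun_def)
    \<comment> \<open>Stated for an arbitrary \<open>F\<close> so that it applies both to
      \<open>Dt\<close> and to \<open>cov\<close>.\<close>
    have "F V = fmult (deriv x) e1 + fmult x (F e1) + (fmult (deriv y) e2 + fmult y (F e2)) +
        (fmult (deriv z) e3 + fmult z (F e3))"
      if F: "is_covariant_derivative_along A (levi_civita A g) \<gamma> F" for F
    proof -
      note F = F[unfolded is_covariant_derivative_along_def]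
      have add: "F (V + W) = F V + F W" if "V \<in> vector_fields_along A \<gamma>" "W \<in> vector_fields_along A \<gamma>" for V W
        using F that by blast
      have mult: "F (fmult f V) = fmult (deriv f) V + fmult f (F V)"
        if "V \<in> vector_fields_along A \<gamma>" "smooth_on UNIV f" for f V
        using F that by blast
      show ?thesis
        unfolding V_eq add[OF along_add[OF along_fmult[OF e(1) s(1)] along_fmult[OF e(2) s(2)]] along_fmult[OF e(3) s(3)]]
          add[OF along_fmult[OF e(1) s(1)] along_fmult[OF e(2) s(2)]] mult[OF e(1) s(1)] mult[OF e(2) s(2)]
          mult[OF e(3) s(3)] ..
    qed
    from this[OF Dt] this[OF cov_is_covariant_derivative] show ?thesis
      unfolding eq by simp
  qed
  show "Dt = cov"
  proof
    fix V show "Dt V = cov V"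
      by (cases "V \<in> vector_fields_along A \<gamma>") (use * D in \<open>auto simp: cov_def\<close>)
  qed
qed

end


section \<open>The Jacobi equation\<close>

text \<open>\<open>S\<close> and \<open>C\<close> are the sine and cosine of the slope angle. The frame \<open>e\<close>, \<open>e\<^sub>3 \<times> e\<close>, \<open>e\<^sub>3\<close>
  with \<open>e = (cos \<phi>, sin \<phi>, 0)\<close> and \<open>\<phi>(t) = \<phi>\<^sub>0 - (c - \<tau>) C t\<close> follows the horizontal part of the
  velocity, which turns the Jacobi equation into a system with constant coefficients.\<close>

locale M3_geodesic = M3_curve A g u1 u2 u3 \<tau> c \<gamma>
  for A :: "('a::{t2_space, second_countable_topology}, real^3) atlas"
    and g :: "'a metric" and u1 u2 u3 :: "'a vfield" and \<tau> c :: real and \<gamma> :: "real \<Rightarrow> 'a" +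
  fixes S C \<phi>0 :: real
  assumes geodesic: "cov (velocity A \<gamma>) = 0"
    and v0: "v1 0 = S * cos \<phi>0" "v2 0 = S * sin \<phi>0" "v3 0 = C"
    and SC: "S\<^sup>2 + C\<^sup>2 = 1"
begin

section \<open>Motion of the velocity\<close>

definition cs :: "real \<Rightarrow> real" where "cs t = cos (- ((c - \<tau>) * C) * t + \<phi>0)"
definition sn :: "real \<Rightarrow> real" where "sn t = sin (- ((c - \<tau>) * C) * t + \<phi>0)"

lemma cs_sn: "(cs t)\<^sup>2 + (sn t)\<^sup>2 = 1"
  by (simp add: cs_def sn_def)

lemma cs_sn_smooth: "smooth_on UNIV cs" "smooth_on UNIV sn"
  unfolding cs_def[abs_def] sn_def[abs_def] by (intro smooth_on_sin_cos open_UNIV)+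

lemma cs_sn_deriv:
  "(cs has_field_derivative ((c - \<tau>) * C * sn t)) (at t)"
  "(sn has_field_derivative (- ((c - \<tau>) * C * cs t))) (at t)"
  unfolding cs_def[abs_def] sn_def[abs_def] by (auto intro!: derivative_eq_intros)

text \<open>The geodesic equation is Euler's equation \<open>v' = - M v \<times> v\<close> of a
  symmetric top: the two equal entries of \<open>M\<close> keep \<open>v3\<close> constant and let
  the horizontal part turn at a constant rate.\<close>

lemma velocity_deriv:
  "((\<lambda>t. v1 t) has_field_derivative (c - \<tau>) * v3 t * v2 t) (at t)"
  "((\<lambda>t. v2 t) has_field_derivative - ((c - \<tau>) * v3 t * v1 t)) (at t)"
  "((\<lambda>t. v3 t) has_field_derivative 0) (at t)"
proof -
  have "cov (velocity A \<gamma>) t = 0"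
    by (simp add: geodesic)
  then have e: "deriv (\<lambda>t. v1 t) t = (c - \<tau>) * v3 t * v2 t" "deriv (\<lambda>t. v2 t) t = - ((c - \<tau>) * v3 t * v1 t)"
    "deriv (\<lambda>t. v3 t) t = 0"
    unfolding cov_apply[OF velocity_along] fr_eq_0_iff by (simp_all add: algebra_simps)
  show "((\<lambda>t. v1 t) has_field_derivative (c - \<tau>) * v3 t * v2 t) (at t)"
    "((\<lambda>t. v2 t) has_field_derivative - ((c - \<tau>) * v3 t * v1 t)) (at t)"
    "((\<lambda>t. v3 t) has_field_derivative 0) (at t)"
    using co_along_deriv[OF velocity_along, of t] unfolding e .
qed

lemma v3_eq: "v3 t = C"
  using DERIV_isconst_all[of "\<lambda>t. v3 t" t 0] velocity_deriv(3) v0(3) by simp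

lemma v12_eq: "v1 t = S * cs t" "v2 t = S * sn t"
proof -
  \<comment> \<open>The components of the velocity in the rotating frame have derivative 0, so they
    keep their initial values.\<close>
  have 1: "((\<lambda>t. v1 t * cs t + v2 t * sn t) has_field_derivative 0) (at t)" for t
    by (rule derivative_eq_intros velocity_deriv cs_sn_deriv refl)+ (simp add: v3_eq algebra_simps)
  have 2: "((\<lambda>t. v2 t * cs t - v1 t * sn t) has_field_derivative 0) (at t)" for t
    by (rule derivative_eq_intros velocity_deriv cs_sn_deriv refl)+ (simp add: v3_eq algebra_simps)
  have "S * cos \<phi>0 * cos \<phi>0 + S * sin \<phi>0 * sin \<phi>0 = S"
    using sin_cos_squared_add[of \<phi>0] by algebra
  then have "v1 0 * cs 0 + v2 0 * sn 0 = S" "v2 0 * cs 0 - v1 0 * sn 0 = 0"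
    unfolding v0 by (simp_all add: cs_def sn_def)
  then have e: "v1 t * cs t + v2 t * sn t = S" "v2 t * cs t - v1 t * sn t = 0"
    using DERIV_isconst_all[of "\<lambda>t. v1 t * cs t + v2 t * sn t" t 0] 1
      DERIV_isconst_all[of "\<lambda>t. v2 t * cs t - v1 t * sn t" t 0] 2 by simp_all
  have "x * (k\<^sup>2 + l\<^sup>2) = s * k \<and> y * (k\<^sup>2 + l\<^sup>2) = s * l"
    if "x * k + y * l = s" "y * k - x * l = 0" for x y k l s :: real
  proof -
    have "x * (k\<^sup>2 + l\<^sup>2) = k * (x * k + y * l) - l * (y * k - x * l)"
      "y * (k\<^sup>2 + l\<^sup>2) = l * (x * k + y * l) + k * (y * k - x * l)"
      by algebra+
    then show ?thesis
      unfolding that by simp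
  qed
  from this[OF e] show "v1 t = S * cs t" "v2 t = S * sn t"
    by (simp_all add: cs_sn)
qed

text \<open>Components in the rotating frame, where the velocity is the constant
  \<open>(S, 0, C)\<close>.\<close>

definition rot :: "real \<Rightarrow> real \<Rightarrow> real \<Rightarrow> real \<Rightarrow> 'a tvec"
  where "rot t p q r = fr (\<gamma> t) (p * cs t - q * sn t) (p * sn t + q * cs t) r"

definition fld :: "(real \<Rightarrow> real) \<Rightarrow> (real \<Rightarrow> real) \<Rightarrow> (real \<Rightarrow> real) \<Rightarrow> 'a curve_vfield"
  where "fld p q r = (\<lambda>t. rot t (p t) (q t) (r t))"

lemma rot_eq_0_iff: "rot t p q r = 0 \<longleftrightarrow> p = 0 \<and> q = 0 \<and> r = 0"
proof
  assume "rot t p q r = 0"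
  then have e: "p * cs t - q * sn t = 0" "p * sn t + q * cs t = 0" "r = 0"
    by (simp_all add: rot_def fr_eq_0_iff)
  have "p * ((cs t)\<^sup>2 + (sn t)\<^sup>2) = 0"
    using e(1,2) by algebra
  moreover have "q * ((cs t)\<^sup>2 + (sn t)\<^sup>2) = 0"
    using e(1,2) by algebra
  ultimately show "p = 0 \<and> q = 0 \<and> r = 0"
    using e(3) by (simp add: cs_sn)
qed (simp add: rot_def fr_zero)

lemma rot_add: "rot t p q r + rot t p' q' r' = rot t (p + p') (q + q') (r + r')"
  by (simp add: rot_def fr_add algebra_simps)

lemma rot_scaleR: "a *\<^sub>R rot t p q r = rot t (a * p) (a * q) (a * r)"
  by (simp add: rot_def fr_scaleR algebra_simps)

lemma rot_tangent: "rot t p q r \<in> tangent_space A (\<gamma> t)"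
  by (simp add: rot_def fr_tangent)

lemma fld_eq_frc: "fld p q r = frc (\<lambda>t. p t * cs t - q t * sn t) (\<lambda>t. p t * sn t + q t * cs t) r"
  by (simp add: fld_def rot_def frc_def)

lemma fld_along:
  assumes "smooth_on UNIV p" "smooth_on UNIV q" "smooth_on UNIV r"
  shows "fld p q r \<in> vector_fields_along A \<gamma>"
  unfolding fld_eq_frc by (intro frc_along smooth_on_UNIV_intros assms cs_sn_smooth)

lemma along_eq_fld:
  assumes "V \<in> vector_fields_along A \<gamma>"
  obtains p q r where "smooth_on UNIV p" "smooth_on UNIV q" "smooth_on UNIV r" "V = fld p q r"
proof
  define p where "p t = co1 (\<gamma> t) (V t) * cs t + co2 (\<gamma> t) (V t) * sn t" for t
  define q where "q t = co2 (\<gamma> t) (V t) * cs t - co1 (\<gamma> t) (V t) * sn t" for t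
  define r where "r t = co3 (\<gamma> t) (V t)" for t
  show "smooth_on UNIV p" "smooth_on UNIV q" "smooth_on UNIV r"
    unfolding p_def[abs_def] q_def[abs_def] r_def[abs_def]
    by (intro smooth_on_UNIV_intros co_along_smooth[OF assms] cs_sn_smooth)+
  have "p t * cs t - q t * sn t = co1 (\<gamma> t) (V t) * ((cs t)\<^sup>2 + (sn t)\<^sup>2)"
    "p t * sn t + q t * cs t = co2 (\<gamma> t) (V t) * ((cs t)\<^sup>2 + (sn t)\<^sup>2)" for t
    unfolding p_def q_def by algebra+
  then have "V t = fld p q r t" for t
    using frame_expand[OF along_tangent[OF assms], of t] by (simp add: fld_def rot_def r_def cs_sn)
  then show "V = fld p q r" ..
qed

text \<open>About \<open>\<xi>\<close> the frame turns at rate \<open>- (c - \<tau>) C\<close> and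
  the connection contributes \<open>(c - \<tau>/2) C\<close>; only the sum \<open>\<tau>/2 C\<close>
  is left.\<close>

lemma cov_fld:
  assumes s: "smooth_on UNIV p" "smooth_on UNIV q" "smooth_on UNIV r"
  shows "cov (fld p q r) = fld (\<lambda>t. deriv p t - \<tau> / 2 * (C * q t))
    (\<lambda>t. deriv q t + \<tau> / 2 * (C * p t) - \<tau> / 2 * (S * r t)) (\<lambda>t. deriv r t + \<tau> / 2 * (S * q t))"
proof
  fix t
  have d: "(p has_field_derivative deriv p t) (at t)" "(q has_field_derivative deriv q t) (at t)"
    using s smooth_on_has_field_derivative by blast+
  have 1: "deriv (\<lambda>t. p t * cs t - q t * sn t) t = p t * ((c - \<tau>) * C * sn t) + deriv p t * cs t -
      (q t * (- ((c - \<tau>) * C * cs t)) + deriv q t * sn t)"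
    by (intro DERIV_imp_deriv DERIV_diff DERIV_mult' d cs_sn_deriv)
  have 2: "deriv (\<lambda>t. p t * sn t + q t * cs t) t = p t * (- ((c - \<tau>) * C * cs t)) + deriv p t * sn t +
      (q t * ((c - \<tau>) * C * sn t) + deriv q t * cs t)"
    by (intro DERIV_imp_deriv DERIV_add DERIV_mult' d cs_sn_deriv)
  have sm: "smooth_on UNIV (\<lambda>t. p t * cs t - q t * sn t)" "smooth_on UNIV (\<lambda>t. p t * sn t + q t * cs t)"
    by (intro smooth_on_UNIV_intros s cs_sn_smooth)+
  have 3: "S * cs t * (p t * sn t + q t * cs t) - S * sn t * (p t * cs t - q t * sn t) = S * q t"
  proof -
    have "S * cs t * (p t * sn t + q t * cs t) - S * sn t * (p t * cs t - q t * sn t) = S * q t * ((cs t)\<^sup>2 + (sn t)\<^sup>2)"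
      by algebra
    then show ?thesis
      by (simp add: cs_sn)
  qed
  have "deriv r t + \<tau> / 2 * (S * cs t * (p t * sn t + q t * cs t)) - \<tau> / 2 * (S * sn t * (p t * cs t - q t * sn t)) =
      deriv r t + \<tau> / 2 * (S * q t)"
    unfolding 3[symmetric] by (simp add: algebra_simps)
  then show "cov (fld p q r) t = fld (\<lambda>t. deriv p t - \<tau> / 2 * (C * q t))
    (\<lambda>t. deriv q t + \<tau> / 2 * (C * p t) - \<tau> / 2 * (S * r t)) (\<lambda>t. deriv r t + \<tau> / 2 * (S * q t)) t"
    unfolding fld_eq_frc cov_frc[OF sm s(3)] v3_eq v12_eq
    unfolding frc_def fr_eq_iff 1 2 by (simp add: algebra_simps)
qed

text \<open>\<open>p\<close> and \<open>r\<close> enter only through \<open>r S - p C\<close>, the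
  component along the unit normal \<open>(- C, 0, S)\<close>: the tangential part of a field meets
  no curvature.\<close>

lemma curv_rot:
  "curv (\<gamma> t) (rot t p q r) (velocity A \<gamma> t) (velocity A \<gamma> t) = rot t
    (- (\<tau>\<^sup>2 / 4) * (r * S - p * C) * C)
    (\<tau>\<^sup>2 / 4 * q * C\<^sup>2 - (3 * \<tau>\<^sup>2 / 4 - c * \<tau>) * q * S\<^sup>2)
    (\<tau>\<^sup>2 / 4 * (r * S - p * C) * S)"
proof -
  obtain x where x: "\<tau>\<^sup>2 / 4 = x"
    by blast
  obtain y where y: "3 * \<tau>\<^sup>2 / 4 - c * \<tau> = y"
    by blast
  have xm: "- \<tau>\<^sup>2 / 4 = - x"
    using x by simp
  have s: "sn t * sn t = 1 - cs t * cs t"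
    using cs_sn[of t] by (simp add: power2_eq_square)
  show ?thesis
    unfolding curv_def Let_def rot_def co_fr v3_eq v12_eq fr_eq_iff x y xm
    using s by (intro conjI) algebra+
qed

text \<open>The undifferentiated terms in \<open>p\<close> and \<open>r\<close> produced by applying
  \<open>cov_fld\<close> twice cancel against the curvature. This is why the first and the third
  equation are total derivatives.\<close>

lemma jacobi_fld:
  assumes s: "smooth_on UNIV p" "smooth_on UNIV q" "smooth_on UNIV r"
  shows "jacobi_field A g \<gamma> (fld p q r) \<longleftrightarrow> (\<forall>t. deriv (deriv p) t = \<tau> * C * deriv q t \<and>
    deriv (deriv q) t = - \<tau> * C * deriv p t + \<tau> * S * deriv r t + (\<tau>\<^sup>2 - c * \<tau>) * S\<^sup>2 * q t \<and>
    deriv (deriv r) t = - \<tau> * S * deriv q t)"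
proof -
  have d: "(p has_field_derivative deriv p t) (at t)" "(q has_field_derivative deriv q t) (at t)"
    "(r has_field_derivative deriv r t) (at t)" for t
    using s smooth_on_has_field_derivative by blast+
  have d2: "(deriv p has_field_derivative deriv (deriv p) t) (at t)"
    "(deriv q has_field_derivative deriv (deriv q) t) (at t)"
    "(deriv r has_field_derivative deriv (deriv r) t) (at t)" for t
    using smooth_on_deriv[OF open_UNIV s(1)] smooth_on_deriv[OF open_UNIV s(2)]
      smooth_on_deriv[OF open_UNIV s(3)] smooth_on_has_field_derivative by blast+
  have s2: "smooth_on UNIV (\<lambda>t. deriv p t - \<tau> / 2 * (C * q t))"
    "smooth_on UNIV (\<lambda>t. deriv q t + \<tau> / 2 * (C * p t) - \<tau> / 2 * (S * r t))"
    "smooth_on UNIV (\<lambda>t. deriv r t + \<tau> / 2 * (S * q t))"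
    by (intro smooth_on_UNIV_intros s smooth_on_const)+
  have e: "deriv (\<lambda>t. deriv p t - \<tau> / 2 * (C * q t)) t = deriv (deriv p) t - \<tau> / 2 * (C * deriv q t)"
    "deriv (\<lambda>t. deriv q t + \<tau> / 2 * (C * p t) - \<tau> / 2 * (S * r t)) t =
      deriv (deriv q) t + \<tau> / 2 * (C * deriv p t) - \<tau> / 2 * (S * deriv r t)"
    "deriv (\<lambda>t. deriv r t + \<tau> / 2 * (S * q t)) t = deriv (deriv r) t + \<tau> / 2 * (S * deriv q t)" for t
    by (intro DERIV_imp_deriv DERIV_diff DERIV_add DERIV_cmult d d2)+
  have j: "cov (cov (fld p q r)) t + curvature_at A (levi_civita A g) (\<gamma> t) (fld p q r t) (velocity A \<gamma> t) (velocity A \<gamma> t) =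
      rot t (deriv (deriv p) t - \<tau> * C * deriv q t)
        (deriv (deriv q) t + \<tau> * C * deriv p t - \<tau> * S * deriv r t - (\<tau>\<^sup>2 - c * \<tau>) * S\<^sup>2 * q t)
        (deriv (deriv r) t + \<tau> * S * deriv q t)" for t
  proof -
    have sc: "\<tau>\<^sup>2 / 4 * q t * C\<^sup>2 = \<tau>\<^sup>2 / 4 * q t * (1 - S\<^sup>2)"
      using SC by (metis add_diff_cancel_left')
    have sc': "\<tau> / 2 * (C * (\<tau> / 2 * (C * q t))) = \<tau>\<^sup>2 / 4 * q t * (1 - S\<^sup>2)"
      unfolding sc[symmetric] by (simp add: power2_eq_square)
    have c1: "deriv (deriv p) t - \<tau> / 2 * (C * deriv q t) -
        \<tau> / 2 * (C * (deriv q t + \<tau> / 2 * (C * p t) - \<tau> / 2 * (S * r t))) +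
        - (\<tau>\<^sup>2 / 4) * (r t * S - p t * C) * C = deriv (deriv p) t - \<tau> * C * deriv q t"
      by (simp add: power2_eq_square field_simps)
    have c2: "deriv (deriv q) t + \<tau> / 2 * (C * deriv p t) - \<tau> / 2 * (S * deriv r t) +
        \<tau> / 2 * (C * (deriv p t - \<tau> / 2 * (C * q t))) -
        \<tau> / 2 * (S * (deriv r t + \<tau> / 2 * (S * q t))) +
        (\<tau>\<^sup>2 / 4 * q t * C\<^sup>2 - (3 * \<tau>\<^sup>2 / 4 - c * \<tau>) * q t * S\<^sup>2) =
        deriv (deriv q) t + \<tau> * C * deriv p t - \<tau> * S * deriv r t - (\<tau>\<^sup>2 - c * \<tau>) * S\<^sup>2 * q t"
      unfolding sc right_diff_distrib sc' by (simp add: power2_eq_square field_simps)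
    have c3: "deriv (deriv r) t + \<tau> / 2 * (S * deriv q t) +
        \<tau> / 2 * (S * (deriv q t + \<tau> / 2 * (C * p t) - \<tau> / 2 * (S * r t))) +
        \<tau>\<^sup>2 / 4 * (r t * S - p t * C) * S = deriv (deriv r) t + \<tau> * S * deriv q t"
      by (simp add: power2_eq_square field_simps)
    show ?thesis
      unfolding cov_fld[OF s] cov_fld[OF s2] e
      unfolding fld_def curvature_at_eq[OF rot_tangent velocity_tangent velocity_tangent] curv_rot rot_add
        c1 c2 c3 ..
  qed
  have "jacobi_field A g \<gamma> (fld p q r) \<longleftrightarrow> (\<forall>t. rot t (deriv (deriv p) t - \<tau> * C * deriv q t)
        (deriv (deriv q) t + \<tau> * C * deriv p t - \<tau> * S * deriv r t - (\<tau>\<^sup>2 - c * \<tau>) * S\<^sup>2 * q t)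
        (deriv (deriv r) t + \<tau> * S * deriv q t) = 0)"
    unfolding jacobi_field_def covariant_derivative_along_eq j using fld_along[OF s] by simp
  also have "\<dots> \<longleftrightarrow> (\<forall>t. deriv (deriv p) t = \<tau> * C * deriv q t \<and>
    deriv (deriv q) t = - \<tau> * C * deriv p t + \<tau> * S * deriv r t + (\<tau>\<^sup>2 - c * \<tau>) * S\<^sup>2 * q t \<and>
    deriv (deriv r) t = - \<tau> * S * deriv q t)"
    unfolding rot_eq_0_iff by (intro all_cong1) (auto simp: algebra_simps)
  finally show ?thesis .
qed

end


section \<open>Solutions of the Jacobi equation\<close>

text \<open>Gronwall's argument for \<open>E = d\<^sup>2 + d'\<^sup>2\<close>: its derivative
  \<open>2 (1 - l) d d'\<close> is bounded by \<open>\<bar>1 - l\<bar> E\<close>, so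
  \<open>E\<close> times a suitable exponential is monotone, forwards and backwards from
  \<open>t0\<close>. This covers every sign of \<open>l\<close>.\<close>

lemma second_order_unique:
  fixes d d' :: "real \<Rightarrow> real"
  assumes d: "\<And>t. (d has_field_derivative d' t) (at t)"
    and d': "\<And>t. (d' has_field_derivative - l * d t) (at t)"
    and "d t0 = 0" "d' t0 = 0"
  shows "d t = 0"
proof -
  define E where "E t = (d t)\<^sup>2 + (d' t)\<^sup>2" for t
  define K where "K = \<bar>1 - l\<bar>"
  have E': "(E has_field_derivative 2 * (1 - l) * (d t * d' t)) (at t)" for t
    unfolding E_def[abs_def]
    by (rule derivative_eq_intros d d' refl)+ (simp add: power2_eq_square algebra_simps)
  have bound: "\<bar>2 * (1 - l) * (d t * d' t)\<bar> \<le> K * E t" for t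
  proof -
    have "2 * \<bar>d t * d' t\<bar> \<le> E t"
      using sum_squares_bound[of "\<bar>d t\<bar>" "\<bar>d' t\<bar>"] by (simp add: E_def abs_mult mult.assoc)
    then have "K * (2 * \<bar>d t * d' t\<bar>) \<le> K * E t"
      by (intro mult_left_mono) (simp_all add: K_def)
    moreover have "\<bar>2 * (1 - l) * (d t * d' t)\<bar> = K * (2 * \<bar>d t * d' t\<bar>)"
      unfolding K_def abs_mult by simp
    ultimately show ?thesis
      by simp
  qed
  have "E t \<le> 0"
  proof (cases "t0 \<le> t")
    case True
    have "((\<lambda>t. E t * exp (- K * t)) has_field_derivative
        (2 * (1 - l) * (d t * d' t) - K * E t) * exp (- K * t)) (at t)" for t
      by (rule derivative_eq_intros E' refl)+ (simp add: algebra_simps)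
    moreover have "(2 * (1 - l) * (d t * d' t) - K * E t) * exp (- K * t) \<le> 0" for t
      using bound[of t] by (intro mult_nonpos_nonneg) auto
    ultimately have "E t * exp (- K * t) \<le> E t0 * exp (- K * t0)"
      using DERIV_nonpos_imp_nonincreasing[OF True, of "\<lambda>t. E t * exp (- K * t)"] by blast
    then show ?thesis
      using assms(3,4) by (simp add: E_def[of t0] mult_le_0_iff)
  next
    case False
    have "((\<lambda>t. E t * exp (K * t)) has_field_derivative
        (2 * (1 - l) * (d t * d' t) + K * E t) * exp (K * t)) (at t)" for t
      by (rule derivative_eq_intros E' refl)+ (simp add: algebra_simps)
    moreover have "0 \<le> (2 * (1 - l) * (d t * d' t) + K * E t) * exp (K * t)" for t
      using bound[of t] by (intro mult_nonneg_nonneg) auto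
    ultimately have "E t * exp (K * t) \<le> E t0 * exp (K * t0)"
      using DERIV_nonneg_imp_nondecreasing[of t t0 "\<lambda>t. E t * exp (K * t)"] False by force
    then show ?thesis
      using assms(3,4) by (simp add: E_def[of t0] mult_le_0_iff)
  qed
  then have "(d t)\<^sup>2 \<le> 0"
    using zero_le_power2[of "d' t"] unfolding E_def by linarith
  then show ?thesis
    by simp
qed

text \<open>For \<open>l \<le> 0\<close> the function \<open>q q' + w \<rho> - w\<^sup>2 t\<close> is nondecreasing.\<close>

lemma no_zero_if_nonpos:
  fixes q q' \<rho> :: "real \<Rightarrow> real"
  assumes q: "\<And>t. (q has_field_derivative q' t) (at t)"
    and q': "\<And>t. (q' has_field_derivative \<tau> * w - l * q t) (at t)"
    and \<rho>: "\<And>t. (\<rho> has_field_derivative w - \<tau> * q t) (at t)"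
    and z: "q 0 = 0" "\<rho> 0 = 0" "q T = 0" "\<rho> T = 0" and "T > 0" "l \<le> 0"
  shows "w = 0 \<and> q t = 0"
proof -
  \<comment> \<open>The summand \<open>w \<rho>\<close> removes the coupling
    \<open>\<tau> w q\<close> that \<open>q q''\<close> brings in; what remains is
    \<open>\<Phi>' = q'\<^sup>2 - l q\<^sup>2\<close>.\<close>
  define \<Phi> where "\<Phi> t = q t * q' t + w * \<rho> t - w\<^sup>2 * t" for t
  have \<Phi>': "(\<Phi> has_field_derivative (q' t)\<^sup>2 - l * (q t)\<^sup>2) (at t)" for t
    unfolding \<Phi>_def[abs_def]
    by (rule derivative_eq_intros q q' \<rho> refl)+ (simp add: power2_eq_square algebra_simps)
  have nonneg: "0 \<le> - l * (q t)\<^sup>2" for t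
    using assms(9) by (simp add: mult_nonpos_nonneg)
  have mono: "\<Phi> a \<le> \<Phi> b" if "a \<le> b" for a b
  proof (rule DERIV_nonneg_imp_nondecreasing[OF that])
    fix t
    have "0 \<le> (q' t)\<^sup>2 - l * (q t)\<^sup>2"
      using nonneg[of t] zero_le_power2[of "q' t"] by linarith
    then show "\<exists>y. DERIV \<Phi> t :> y \<and> 0 \<le> y"
      using \<Phi>' by blast
  qed
  have "w\<^sup>2 * T \<le> 0"
    using mono[of 0 T] z \<open>T > 0\<close> by (simp add: \<Phi>_def)
  \<comment> \<open>The boundary values are \<open>\<Phi> 0 = 0\<close> and
    \<open>\<Phi> T = - w\<^sup>2 T\<close>, which a nondecreasing function allows only for
    \<open>w = 0\<close>.\<close>
  then have w: "w = 0"
    using \<open>T > 0\<close> by (simp add: mult_le_0_iff)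
  have \<Phi>0: "\<Phi> t = 0" if "0 < t" "t < T" for t
    using mono[of 0 t] mono[of t T] that z w by (simp add: \<Phi>_def)
  have q'0: "q' t = 0" if t: "0 < t" "t < T" for t
  proof -
    have "(\<Phi> has_field_derivative 0) (at t)"
      by (rule has_field_derivative_transform_within_open[of "\<lambda>t. 0" 0 t "{0<..<T}"]) (use t \<Phi>0 in auto)
    then have "(q' t)\<^sup>2 - l * (q t)\<^sup>2 = 0"
      using \<Phi>' DERIV_unique by blast
    then have "(q' t)\<^sup>2 \<le> 0"
      using nonneg[of t] by simp
    then show ?thesis
      by simp
  qed
  have cont: "continuous_on {0..T} q"
    by (intro continuous_at_imp_continuous_on ballI DERIV_isCont[OF q])
  have half: "0 < T / 2" "T / 2 < T"
    using \<open>T > 0\<close> by auto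
  have "q (T / 2) = q 0"
  proof (rule DERIV_isconst2[OF \<open>T > 0\<close> cont])
    show "\<And>x. 0 < x \<Longrightarrow> x < T \<Longrightarrow> DERIV q x :> 0"
      using q q'0 by metis
  qed (use half in auto)
  \<comment> \<open>Monotonicity speaks only of \<open>[0, T]\<close>, while \<open>t\<close> is
    arbitrary: \<open>q\<close> and \<open>q'\<close> vanish at \<open>T / 2\<close>, and uniqueness
    carries this to the whole line.\<close>
  then have "q t = 0"
    using second_order_unique[of q q' l "T / 2" t] q q' w z(1) q'0[OF half] by simp
  then show ?thesis
    using w by simp
qed

section \<open>First integrals and orthogonal Jacobi fields\<close>

context M3_geodesic
begin

text \<open>This is \<open>slope_lambda\<close>, since \<open>c \<tau> = \<kappa>\<close>.\<close>

definition lam :: real where "lam = c * \<tau> * S\<^sup>2 + \<tau>\<^sup>2 * C\<^sup>2"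

text \<open>The first and third Jacobi equations are total derivatives. Their integrals turn the
  second into an oscillator equation for \<open>q\<close> alone, where
  \<open>S\<^sup>2 + C\<^sup>2 = 1\<close> collects the coefficient \<open>lam\<close>.\<close>

lemma jacobi_first_integrals:
  assumes s: "smooth_on UNIV p" "smooth_on UNIV q" "smooth_on UNIV r"
  shows "jacobi_field A g \<gamma> (fld p q r) \<longleftrightarrow> (\<exists>\<alpha> a. \<forall>t. deriv p t = \<alpha> + \<tau> * C * q t \<and>
    deriv r t = a - \<tau> * S * q t \<and> deriv (deriv q) t = \<tau> * (S * a - C * \<alpha>) - lam * q t)"
    (is "_ \<longleftrightarrow> ?R")
proof -
  have d: "(p has_field_derivative deriv p t) (at t)" "(q has_field_derivative deriv q t) (at t)"
    "(r has_field_derivative deriv r t) (at t)" for t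
    using s smooth_on_has_field_derivative by blast+
  have d2: "(deriv p has_field_derivative deriv (deriv p) t) (at t)"
    "(deriv r has_field_derivative deriv (deriv r) t) (at t)" for t
    using smooth_on_deriv[OF open_UNIV s(1)] smooth_on_deriv[OF open_UNIV s(3)]
      smooth_on_has_field_derivative by blast+
  show ?thesis
  proof
    assume "jacobi_field A g \<gamma> (fld p q r)"
    then have J: "deriv (deriv p) t = \<tau> * C * deriv q t"
      "deriv (deriv q) t = - \<tau> * C * deriv p t + \<tau> * S * deriv r t + (\<tau>\<^sup>2 - c * \<tau>) * S\<^sup>2 * q t"
      "deriv (deriv r) t = - \<tau> * S * deriv q t" for t
      unfolding jacobi_fld[OF s] by blast+
    have "((\<lambda>t. deriv p t - \<tau> * C * q t) has_field_derivative 0) (at t)" for t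
      using DERIV_diff[OF d2(1)[of t] DERIV_cmult[OF d(2)[of t], of "\<tau> * C"]] J(1) by simp
    then have p: "deriv p t - \<tau> * C * q t = deriv p 0 - \<tau> * C * q 0" for t
      using DERIV_isconst_all by blast
    have "((\<lambda>t. deriv r t + \<tau> * S * q t) has_field_derivative 0) (at t)" for t
      using DERIV_add[OF d2(2)[of t] DERIV_cmult[OF d(2)[of t], of "\<tau> * S"]] J(3) by simp
    then have r: "deriv r t + \<tau> * S * q t = deriv r 0 + \<tau> * S * q 0" for t
      using DERIV_isconst_all by blast
    show ?R
    proof (intro exI allI conjI)
      fix t
      show 1: "deriv p t = (deriv p 0 - \<tau> * C * q 0) + \<tau> * C * q t"
        using p[of t] by simp
      show 2: "deriv r t = (deriv r 0 + \<tau> * S * q 0) - \<tau> * S * q t"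
        using r[of t] by simp
      have "\<tau>\<^sup>2 * S\<^sup>2 * q t + \<tau>\<^sup>2 * C\<^sup>2 * q t = \<tau>\<^sup>2 * q t * (S\<^sup>2 + C\<^sup>2)"
        by algebra
      then show "deriv (deriv q) t = \<tau> * (S * (deriv r 0 + \<tau> * S * q 0) - C * (deriv p 0 - \<tau> * C * q 0)) - lam * q t"
        unfolding J(2)[of t] 1 2 lam_def by (simp add: power2_eq_square algebra_simps)
    qed
  next
    assume ?R
    then obtain \<alpha> a where R: "deriv p t = \<alpha> + \<tau> * C * q t" "deriv r t = a - \<tau> * S * q t"
      "deriv (deriv q) t = \<tau> * (S * a - C * \<alpha>) - lam * q t" for t
      by blast
    show "jacobi_field A g \<gamma> (fld p q r)"
      unfolding jacobi_fld[OF s]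
    proof (intro allI conjI)
      fix t
      have "deriv p = (\<lambda>t. \<alpha> + \<tau> * C * q t)" "deriv r = (\<lambda>t. a - \<tau> * S * q t)"
        using R by auto
      moreover have "((\<lambda>t. \<alpha> + \<tau> * C * q t) has_field_derivative \<tau> * C * deriv q t) (at t)"
        "((\<lambda>t. a - \<tau> * S * q t) has_field_derivative - \<tau> * S * deriv q t) (at t)"
        by (rule derivative_eq_intros d refl | simp)+
      ultimately show "deriv (deriv p) t = \<tau> * C * deriv q t" "deriv (deriv r) t = - \<tau> * S * deriv q t"
        by (simp_all add: DERIV_imp_deriv)
      have "\<tau>\<^sup>2 * S\<^sup>2 * q t = \<tau>\<^sup>2 * (1 - C\<^sup>2) * q t"
        using SC by (metis add_diff_cancel_right')
      then have "(\<tau>\<^sup>2 - c * \<tau>) * S\<^sup>2 * q t = \<tau>\<^sup>2 * q t - \<tau>\<^sup>2 * C\<^sup>2 * q t - c * \<tau> * S\<^sup>2 * q t"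
        by (simp add: algebra_simps)
      moreover have "\<tau> * S * (\<tau> * S * q t) = \<tau>\<^sup>2 * q t - \<tau>\<^sup>2 * C\<^sup>2 * q t"
        using \<open>\<tau>\<^sup>2 * S\<^sup>2 * q t = \<tau>\<^sup>2 * (1 - C\<^sup>2) * q t\<close> by (simp add: power2_eq_square algebra_simps)
      ultimately show "deriv (deriv q) t = - \<tau> * C * deriv p t + \<tau> * S * deriv r t + (\<tau>\<^sup>2 - c * \<tau>) * S\<^sup>2 * q t"
        unfolding R lam_def by (simp add: power2_eq_square algebra_simps)
    qed
  qed
qed

text \<open>Jacobi fields that vanish at \<open>0\<close> and at a second point are orthogonal to the geodesic, hence
  are of the form \<open>(- C \<rho>, q, S \<rho>)\<close>.\<close>

lemma orthogonal_form:
  assumes p: "\<And>t. (p has_field_derivative \<alpha> + \<tau> * C * q t) (at t)"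
    and r: "\<And>t. (r has_field_derivative a - \<tau> * S * q t) (at t)"
    and z: "p 0 = 0" "r 0 = 0" and o: "S * \<alpha> + C * a = 0"
  defines "\<rho> \<equiv> \<lambda>t. S * r t - C * p t" and "w \<equiv> S * a - C * \<alpha>"
  shows "p t = - C * \<rho> t" "r t = S * \<rho> t" "(\<rho> has_field_derivative w - \<tau> * q t) (at t)" "\<rho> 0 = 0"
proof -
  \<comment> \<open>Inner product with the velocity; its derivative \<open>S \<alpha> + C a\<close>
    is 0 by \<open>o\<close>.\<close>
  have "((\<lambda>t. S * p t + C * r t) has_field_derivative 0) (at t)" for t
    by (rule derivative_eq_intros p r refl)+ (use o in \<open>simp add: algebra_simps\<close>)
  then have t: "S * p t + C * r t = 0" for t
    using DERIV_isconst_all[of "\<lambda>t. S * p t + C * r t" t 0] z by simp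
  \<comment> \<open>A pair orthogonal to the unit vector \<open>(S, C)\<close> is a multiple of
    \<open>(- C, S)\<close>.\<close>
  have *: "x = - C * (S * y - C * x) \<and> y = S * (S * y - C * x)" if "S * x + C * y = 0" for x y
  proof -
    have "- C * (S * y - C * x) = x * (S\<^sup>2 + C\<^sup>2) - S * (S * x + C * y)"
      "S * (S * y - C * x) = y * (S\<^sup>2 + C\<^sup>2) - C * (S * x + C * y)"
      by algebra+
    then show ?thesis
      unfolding that SC by simp
  qed
  show "p t = - C * \<rho> t" "r t = S * \<rho> t"
    using *[OF t] unfolding \<rho>_def by blast+
  have e: "w - \<tau> * q t = S * (a - \<tau> * S * q t) - C * (\<alpha> + \<tau> * C * q t)"
  proof -
    have "\<tau> * q t * (S\<^sup>2 + C\<^sup>2) = \<tau> * q t"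
      by (simp add: SC)
    then show ?thesis
      unfolding w_def by (simp add: power2_eq_square algebra_simps)
  qed
  show "(\<rho> has_field_derivative w - \<tau> * q t) (at t)"
    unfolding \<rho>_def e by (intro DERIV_diff DERIV_cmult p r)
  show "\<rho> 0 = 0"
    unfolding \<rho>_def using z by simp
qed

lemma vanishing_jacobi_form:
  assumes "J \<in> vanishing_jacobi_fields A g \<gamma> T" "T > 0"
  obtains \<rho> q w where "J = fld (\<lambda>t. - C * \<rho> t) q (\<lambda>t. S * \<rho> t)"
    "\<forall>t. (q has_field_derivative deriv q t) (at t)"
    "\<forall>t. (deriv q has_field_derivative \<tau> * w - lam * q t) (at t)"
    "\<forall>t. (\<rho> has_field_derivative w - \<tau> * q t) (at t)"
    "q 0 = 0" "\<rho> 0 = 0" "q T = 0" "\<rho> T = 0"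
proof -
  have J: "jacobi_field A g \<gamma> J" "J 0 = 0" "J T = 0"
    using assms(1) unfolding vanishing_jacobi_fields_def by blast+
  obtain p q r where s: "smooth_on UNIV p" "smooth_on UNIV q" "smooth_on UNIV r" and e: "J = fld p q r"
    using along_eq_fld J(1) unfolding jacobi_field_def by blast
  obtain \<alpha> a where R: "deriv p t = \<alpha> + \<tau> * C * q t" "deriv r t = a - \<tau> * S * q t"
    "deriv (deriv q) t = \<tau> * (S * a - C * \<alpha>) - lam * q t" for t
    using J(1) unfolding e jacobi_first_integrals[OF s] by blast
  have d: "(p has_field_derivative \<alpha> + \<tau> * C * q t) (at t)" "(q has_field_derivative deriv q t) (at t)"
    "(r has_field_derivative a - \<tau> * S * q t) (at t)"
    "(deriv q has_field_derivative \<tau> * (S * a - C * \<alpha>) - lam * q t) (at t)" for t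
    using s smooth_on_deriv[OF open_UNIV s(2)] smooth_on_has_field_derivative unfolding R[symmetric] by blast+
  have z: "p 0 = 0" "q 0 = 0" "r 0 = 0" "p T = 0" "q T = 0" "r T = 0"
    using J(2,3) unfolding e fld_def rot_eq_0_iff by blast+
  \<comment> \<open>The tangential component is affine in \<open>t\<close>; zeros at
    \<open>0\<close> and at \<open>T > 0\<close> leave no slope.\<close>
  have "((\<lambda>t. S * p t + C * r t - (S * \<alpha> + C * a) * t) has_field_derivative 0) (at t)" for t
    by (rule derivative_eq_intros d refl)+ (simp add: algebra_simps)
  then have "(S * \<alpha> + C * a) * T = 0"
    using DERIV_isconst_all[of "\<lambda>t. S * p t + C * r t - (S * \<alpha> + C * a) * t" T 0] z by simp
  then have o: "S * \<alpha> + C * a = 0"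
    using assms(2) by simp
  note f = orthogonal_form[OF d(1,3) z(1,3) o]
  show ?thesis
  proof
    show "J = fld (\<lambda>t. - C * (S * r t - C * p t)) q (\<lambda>t. S * (S * r t - C * p t))"
      unfolding e fld_def using f(1,2) by auto
    show "\<forall>t. (q has_field_derivative deriv q t) (at t)"
      "\<forall>t. (deriv q has_field_derivative \<tau> * (S * a - C * \<alpha>) - lam * q t) (at t)"
      "\<forall>t. ((\<lambda>t. S * r t - C * p t) has_field_derivative (S * a - C * \<alpha>) - \<tau> * q t) (at t)"
      using d f(3) by simp_all
  qed (use z in simp_all)
qed

lemma vanishing_jacobiI:
  assumes "smooth_on UNIV q" "smooth_on UNIV \<rho>"
    and q': "\<And>t. deriv (deriv q) t = \<tau> * w - lam * q t"
    and \<rho>': "\<And>t. (\<rho> has_field_derivative w - \<tau> * q t) (at t)"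
    and "q 0 = 0" "\<rho> 0 = 0" "q T = 0" "\<rho> T = 0"
  shows "fld (\<lambda>t. - C * \<rho> t) q (\<lambda>t. S * \<rho> t) \<in> vanishing_jacobi_fields A g \<gamma> T"
proof -
  have s: "smooth_on UNIV (\<lambda>t. - C * \<rho> t)" "smooth_on UNIV (\<lambda>t. S * \<rho> t)"
    by (intro smooth_on_UNIV_intros smooth_on_const assms)+
  have "deriv (\<lambda>t. - C * \<rho> t) t = - C * w + \<tau> * C * q t \<and> deriv (\<lambda>t. S * \<rho> t) t = S * w - \<tau> * S * q t" for t
    using DERIV_imp_deriv[OF DERIV_cmult[OF \<rho>'], of "- C" t] DERIV_imp_deriv[OF DERIV_cmult[OF \<rho>'], of S t]
    by (simp add: algebra_simps)
  moreover have "S * (S * w) - C * (- C * w) = w"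
  proof -
    have "S * (S * w) - C * (- C * w) = w * (S\<^sup>2 + C\<^sup>2)"
      by algebra
    then show ?thesis
      unfolding SC by simp
  qed
  \<comment> \<open>\<open>\<alpha> = - C w\<close> and \<open>a = S w\<close> solve
    \<open>S \<alpha> + C a = 0\<close> and \<open>S a - C \<alpha> = w\<close>.\<close>
  ultimately have "jacobi_field A g \<gamma> (fld (\<lambda>t. - C * \<rho> t) q (\<lambda>t. S * \<rho> t))"
    unfolding jacobi_first_integrals[OF s(1) assms(1) s(2)] using q'
    by (intro exI[of _ "- C * w"] exI[of _ "S * w"]) simp
  moreover have "fld (\<lambda>t. - C * \<rho> t) q (\<lambda>t. S * \<rho> t) 0 = 0" "fld (\<lambda>t. - C * \<rho> t) q (\<lambda>t. S * \<rho> t) T = 0"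
    unfolding fld_def rot_eq_0_iff using assms(5-8) by simp_all
  ultimately show ?thesis
    unfolding vanishing_jacobi_fields_def by blast
qed

lemma fld_0: "fld (\<lambda>t. 0) (\<lambda>t. 0) (\<lambda>t. 0) = 0"
  unfolding fld_def by (rule ext) (simp add: rot_eq_0_iff)

lemma no_conjugate_points:
  assumes "lam \<le> 0"
  shows "\<not> conjugate_at A g \<gamma> T"
proof
  assume "conjugate_at A g \<gamma> T"
  then obtain J where T: "T > 0" and J: "J \<in> vanishing_jacobi_fields A g \<gamma> T" "J \<noteq> 0"
    unfolding conjugate_at_def by blast
  obtain \<rho> q w where f: "J = fld (\<lambda>t. - C * \<rho> t) q (\<lambda>t. S * \<rho> t)"
    "\<forall>t. (q has_field_derivative deriv q t) (at t)"
    "\<forall>t. (deriv q has_field_derivative \<tau> * w - lam * q t) (at t)"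
    "\<forall>t. (\<rho> has_field_derivative w - \<tau> * q t) (at t)"
    "q 0 = 0" "\<rho> 0 = 0" "q T = 0" "\<rho> T = 0"
    using vanishing_jacobi_form[OF J(1) T] .
  have wq: "w = 0" "q t = 0" for t
    using no_zero_if_nonpos[OF spec[OF f(2)] spec[OF f(3)] spec[OF f(4)] f(5-8) T assms] by blast+
  then have "\<rho> t = 0" for t
    using DERIV_isconst_all[of \<rho> t 0] f(4,6) by simp
  then have "J = 0"
    unfolding f(1) wq by (simp add: fld_0)
  then show False
    using J(2) by blast
qed

section \<open>Explicit solutions for positive \<open>lam\<close>\<close>

definition om :: real where "om = sqrt lam"
definition mu :: real where "mu = (\<tau>\<^sup>2 - c * \<tau>) / (2 * \<tau>\<^sup>2) * S\<^sup>2"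

text \<open>The parameters are \<open>x = \<tau> w / \<surd>\<lambda>\<close> and \<open>b = q' (0)\<close>.\<close>

definition solq :: "real \<Rightarrow> real \<Rightarrow> real \<Rightarrow> real"
  where "solq x b t = 1 / om * (x * (1 - cos (om * t)) + b * sin (om * t))"

text \<open>The term linear in \<open>t\<close> comes from the mean
  \<open>\<tau> w / \<lambda>\<close> of \<open>q\<close>: the drift is \<open>w - \<tau>\<^sup>2 w
  / \<lambda> = - 2 \<mu> \<tau>\<^sup>2 w / \<lambda>\<close>.\<close>

definition solr :: "real \<Rightarrow> real \<Rightarrow> real \<Rightarrow> real"
  where "solr x b t = \<tau> / lam * (x * (sin (om * t) - 2 * mu * (om * t)) - b * (1 - cos (om * t)))"

definition sol :: "real \<Rightarrow> real \<Rightarrow> 'a curve_vfield"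
  where "sol x b = fld (\<lambda>t. - C * solr x b t) (solq x b) (\<lambda>t. S * solr x b t)"

lemma sol_linear: "sol x b = x *\<^sub>R sol 1 0 + b *\<^sub>R sol 0 1"
proof
  fix t
  have "sol x b t = x *\<^sub>R sol 1 0 t + b *\<^sub>R sol 0 1 t"
    unfolding sol_def fld_def rot_scaleR rot_add solq_def solr_def
    by (rule arg_cong3[where f = "rot t"]) (simp_all add: algebra_simps)
  then show "sol x b t = (x *\<^sub>R sol 1 0 + b *\<^sub>R sol 0 1) t"
    by (simp add: scaleR_fun_def[of _ "sol _ _"])
qed

text \<open>Read as \<open>2 \<mu> = 1 - \<lambda> / \<tau>\<^sup>2\<close>, this is what makes
  \<open>solr\<close> an antiderivative of \<open>w - \<tau> q\<close>.\<close>

lemma lam_eq: "\<tau> > 0 \<Longrightarrow> lam = \<tau>\<^sup>2 * (1 - 2 * mu)"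
proof -
  assume "\<tau> > 0"
  then have "\<tau>\<^sup>2 * (1 - 2 * mu) = \<tau>\<^sup>2 * (S\<^sup>2 + C\<^sup>2) - (\<tau>\<^sup>2 - c * \<tau>) * S\<^sup>2"
    unfolding SC mu_def by (simp add: field_simps)
  then show "lam = \<tau>\<^sup>2 * (1 - 2 * mu)"
    unfolding lam_def by (simp add: algebra_simps)
qed

context
  assumes \<tau>: "\<tau> > 0" and lam: "lam > 0"
begin

lemma om: "om > 0" "om * om = lam"
  using lam by (simp_all add: om_def)

lemma solq_deriv: "(solq x b has_field_derivative x * sin (om * t) + b * cos (om * t)) (at t)"
  unfolding solq_def[abs_def] by (rule derivative_eq_intros refl)+ (use om in \<open>simp add: field_simps\<close>)

lemma solq_deriv2: "((\<lambda>t. x * sin (om * t) + b * cos (om * t)) has_field_derivative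
  \<tau> * (om * x / \<tau>) - lam * solq x b t) (at t)"
  unfolding solq_def om(2)[symmetric]
  by (rule derivative_eq_intros refl)+ (use om(1) \<tau> in \<open>simp add: field_simps\<close>)

lemma solr_deriv: "(solr x b has_field_derivative om * x / \<tau> - \<tau> * solq x b t) (at t)"
proof -
  have "\<tau> / lam * (x * (om * cos (om * t) - 2 * mu * om) - b * (om * sin (om * t))) =
      om * x / \<tau> - \<tau> * solq x b t"
  proof -
    have 1: "2 * mu = 1 - lam / \<tau>\<^sup>2"
      using lam_eq[OF \<tau>] \<tau> by (simp add: field_simps)
    have 2: "2 * mu * om = om - lam * om / \<tau>\<^sup>2"
      unfolding 1 by (simp add: algebra_simps)
    show ?thesis
      unfolding 2 solq_def om(2)[symmetric] using om(1) \<tau> by (simp add: field_simps power2_eq_square)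
  qed
  moreover have "(solr x b has_field_derivative
      \<tau> / lam * (x * (om * cos (om * t) - 2 * mu * om) - b * (om * sin (om * t)))) (at t)"
    unfolding solr_def[abs_def] by (rule derivative_eq_intros refl)+ (simp add: algebra_simps)
  ultimately show ?thesis
    by simp
qed

lemma sol_smooth: "smooth_on UNIV (solq x b)" "smooth_on UNIV (solr x b)"
  unfolding solq_def[abs_def] solr_def[abs_def]
  using smooth_on_sin_cos[OF open_UNIV, of om 0]
  by (intro smooth_on_UNIV_intros smooth_on_const smooth_on_ident; simp)+

text \<open>The difference from the explicit \<open>q\<close> solves the homogeneous equation with
  zero initial data, hence vanishes; then \<open>\<rho>\<close> is found by integration.\<close>

lemma sol_unique:
  assumes q: "\<And>t. (q has_field_derivative q' t) (at t)"
    and q': "\<And>t. (q' has_field_derivative \<tau> * w - lam * q t) (at t)"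
    and \<rho>: "\<And>t. (\<rho> has_field_derivative w - \<tau> * q t) (at t)"
    and z: "q 0 = 0" "\<rho> 0 = 0"
  shows "q = solq (\<tau> * w / om) (q' 0)" "\<rho> = solr (\<tau> * w / om) (q' 0)"
proof -
  define x where "x = \<tau> * w / om"
  have x: "om * x / \<tau> = w"
    using om \<tau> by (simp add: x_def)
  have q_eq: "q t = solq x (q' 0) t" for t
  proof -
    have 1: "((\<lambda>t. q t - solq x (q' 0) t) has_field_derivative
        q' t - (x * sin (om * t) + q' 0 * cos (om * t))) (at t)" for t
      by (intro DERIV_diff q solq_deriv)
    have 2: "((\<lambda>t. q' t - (x * sin (om * t) + q' 0 * cos (om * t))) has_field_derivative
        - lam * (q t - solq x (q' 0) t)) (at t)" for t
      using DERIV_diff[OF q'[of t] solq_deriv2[of x "q' 0" t]] unfolding x by (simp add: algebra_simps)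
    have "q t - solq x (q' 0) t = 0"
      using second_order_unique[of "\<lambda>t. q t - solq x (q' 0) t"
          "\<lambda>t. q' t - (x * sin (om * t) + q' 0 * cos (om * t))" lam 0 t] 1 2 z
      by (simp add: solq_def)
    then show ?thesis
      by simp
  qed
  have "((\<lambda>t. \<rho> t - solr x (q' 0) t) has_field_derivative 0) (at t)" for t
    using DERIV_diff[OF \<rho>[of t] solr_deriv[of x "q' 0" t]] unfolding x q_eq by simp
  then have "\<rho> t - solr x (q' 0) t = \<rho> 0 - solr x (q' 0) 0" for t
    using DERIV_isconst_all by blast
  then have "\<rho> t = solr x (q' 0) t" for t
    using z by (simp add: solr_def)
  then show "q = solq (\<tau> * w / om) (q' 0)" "\<rho> = solr (\<tau> * w / om) (q' 0)"
    using q_eq unfolding x_def by auto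
qed

lemma vanishing_jacobi_sol:
  assumes T: "T > 0"
  shows "J \<in> vanishing_jacobi_fields A g \<gamma> T \<longleftrightarrow>
    (\<exists>x b. J = sol x b \<and> solq x b T = 0 \<and> solr x b T = 0)"
proof
  assume J: "J \<in> vanishing_jacobi_fields A g \<gamma> T"
  obtain \<rho> q w where f: "J = fld (\<lambda>t. - C * \<rho> t) q (\<lambda>t. S * \<rho> t)"
    "\<forall>t. (q has_field_derivative deriv q t) (at t)"
    "\<forall>t. (deriv q has_field_derivative \<tau> * w - lam * q t) (at t)"
    "\<forall>t. (\<rho> has_field_derivative w - \<tau> * q t) (at t)"
    "q 0 = 0" "\<rho> 0 = 0" "q T = 0" "\<rho> T = 0"
    using vanishing_jacobi_form[OF J T] .
  note e = sol_unique[OF spec[OF f(2)] spec[OF f(3)] spec[OF f(4)] f(5,6)]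
  show "\<exists>x b. J = sol x b \<and> solq x b T = 0 \<and> solr x b T = 0"
  proof (intro exI conjI)
    show "J = sol (\<tau> * w / om) (deriv q 0)"
      unfolding sol_def e[symmetric] by (rule f(1))
    show "solq (\<tau> * w / om) (deriv q 0) T = 0" "solr (\<tau> * w / om) (deriv q 0) T = 0"
      unfolding e[symmetric] by (rule f(7) f(8))+
  qed
next
  assume "\<exists>x b. J = sol x b \<and> solq x b T = 0 \<and> solr x b T = 0"
  then obtain x b where J: "J = sol x b" "solq x b T = 0" "solr x b T = 0"
    by blast
  have "deriv (solq x b) = (\<lambda>t. x * sin (om * t) + b * cos (om * t))"
    using DERIV_imp_deriv[OF solq_deriv] by blast
  then have "deriv (deriv (solq x b)) t = \<tau> * (om * x / \<tau>) - lam * solq x b t" for t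
    using DERIV_imp_deriv[OF solq_deriv2] by simp
  then show "J \<in> vanishing_jacobi_fields A g \<gamma> T"
    unfolding J(1) sol_def
    by (rule vanishing_jacobiI[OF sol_smooth _ solr_deriv]) (use J in \<open>simp_all add: solq_def solr_def\<close>)
qed

lemma sol_eq_0_iff: "sol x b = 0 \<longleftrightarrow> x = 0 \<and> b = 0"
proof
  assume "sol x b = 0"
  then have "sol x b t = 0" for t
    by simp
  then have "solq x b t = 0" for t
    unfolding sol_def fld_def rot_eq_0_iff by blast
  \<comment> \<open>Up to the factor \<open>1 / om\<close>, half a period gives \<open>2 x\<close>
    and a quarter gives \<open>x + b\<close>.\<close>
  from this[of "pi / om"] this[of "pi / 2 / om"] show "x = 0 \<and> b = 0"
    using om by (auto simp: solq_def)
next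
  assume "x = 0 \<and> b = 0"
  then show "sol x b = 0"
    using sol_linear[of 0 0] by simp
qed

text \<open>Half-angle formulas expose the factor \<open>sin (s / 2)\<close> of the determinant; the
  nonzero factors \<open>2 / om\<close> and \<open>2 \<tau> / lam\<close> are dropped.\<close>

lemma sol_zero_iff:
  fixes T
  defines "s \<equiv> om * T"
  shows "solq x b T = 0 \<and> solr x b T = 0 \<longleftrightarrow>
    sin (s / 2) * (x * sin (s / 2) + b * cos (s / 2)) = 0 \<and>
    x * (sin (s / 2) * cos (s / 2) - mu * s) = b * (sin (s / 2))\<^sup>2"
proof -
  have h: "1 - cos s = 2 * (sin (s / 2))\<^sup>2" "sin s = 2 * sin (s / 2) * cos (s / 2)"
    using cos_double_sin[of "s / 2"] sin_double[of "s / 2"] by simp_all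
  have "solq x b T = 2 / om * (sin (s / 2) * (x * sin (s / 2) + b * cos (s / 2)))"
    unfolding solq_def s_def[symmetric] h by (simp add: power2_eq_square algebra_simps)
  moreover have "solr x b T = 2 * \<tau> / lam * (x * (sin (s / 2) * cos (s / 2) - mu * s) - b * (sin (s / 2))\<^sup>2)"
    unfolding solr_def s_def[symmetric] h by (simp add: algebra_simps)
  ultimately show ?thesis
    using om lam \<tau> by auto
qed

text \<open>For \<open>sin (s / 2) = 0\<close> only \<open>x \<mu> s = 0\<close> remains of the
  system, so \<open>x = 0\<close> and \<open>b\<close> is free.\<close>

lemma vanishing_at_period:
  assumes "T > 0" "sin (om * T / 2) = 0" "mu \<noteq> 0"
  shows "vanishing_jacobi_fields A g \<gamma> T = range (\<lambda>b. sol 0 b)"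
proof -
  have "mu * (om * T) \<noteq> 0"
    using assms om(1) by simp
  then show ?thesis
    unfolding set_eq_iff vanishing_jacobi_sol[OF assms(1)] sol_zero_iff assms(2) by auto
qed

text \<open>For \<open>\<mu> = 0\<close>, the case of the Hopf fibers, both equations become
  void.\<close>

lemma vanishing_at_period_fiber:
  assumes "T > 0" "sin (om * T / 2) = 0" "mu = 0"
  shows "vanishing_jacobi_fields A g \<gamma> T = {sol x b | x b. True}"
  unfolding set_eq_iff vanishing_jacobi_sol[OF assms(1)] sol_zero_iff assms(2,3) by auto

text \<open>The first equation fixes the ratio, \<open>(x, b) = k (cos (s/2), - sin (s/2))\<close>;
  the tangent equation is what makes the second one hold for these.\<close>

lemma vanishing_at_tan:
  assumes "T > 0" "sin (om * T / 2) \<noteq> 0" "sin (om * T / 2) = mu * (om * T) * cos (om * T / 2)"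
  shows "vanishing_jacobi_fields A g \<gamma> T = range (\<lambda>k. sol (k * cos (om * T / 2)) (- k * sin (om * T / 2)))"
proof -
  define a where "a = sin (om * T / 2)"
  define d where "d = cos (om * T / 2)"
  define m where "m = mu * (om * T)"
  have ad: "a * a + d * d = 1"
    using sin_cos_squared_add[of "om * T / 2"] by (simp add: a_def d_def power2_eq_square)
  have a: "a \<noteq> 0" "a = m * d"
    using assms by (simp_all add: a_def d_def m_def)
  have "a * (x * a + b * d) = 0 \<and> x * (a * d - m) = b * a\<^sup>2 \<longleftrightarrow> (\<exists>k. x = k * d \<and> b = - k * a)" for x b
  proof
    assume "a * (x * a + b * d) = 0 \<and> x * (a * d - m) = b * a\<^sup>2"
    then have 1: "x * a = - b * d"
      using a(1) by (simp add: eq_neg_iff_add_eq_0)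
    then have "x = (- b / a) * d"
      using a(1) by (simp add: field_simps)
    then show "\<exists>k. x = k * d \<and> b = - k * a"
      using a(1) by (intro exI[of _ "- b / a"]) simp
  next
    assume "\<exists>k. x = k * d \<and> b = - k * a"
    then obtain k where k: "x = k * d" "b = - k * a"
      by blast
    have "k * d * (a * d - m) = k * (a * (d * d) - m * d)"
      by (simp add: algebra_simps)
    also have "\<dots> = - k * a * a\<^sup>2"
    proof -
      have dd: "d * d = 1 - a * a"
        using ad by simp
      show ?thesis
        unfolding dd a(2)[symmetric] by (simp add: power2_eq_square algebra_simps)
    qed
    finally show "a * (x * a + b * d) = 0 \<and> x * (a * d - m) = b * a\<^sup>2"
      unfolding k by (simp add: algebra_simps)
  qed
  note * = this
  show ?thesis
    unfolding set_eq_iff vanishing_jacobi_sol[OF assms(1)] sol_zero_iff a_def[symmetric] d_def[symmetric]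
      m_def[symmetric] * by auto
qed

lemma vanishing_trivial:
  assumes "T > 0" "sin (om * T / 2) \<noteq> 0" "sin (om * T / 2) \<noteq> mu * (om * T) * cos (om * T / 2)"
    and J: "J \<in> vanishing_jacobi_fields A g \<gamma> T"
  shows "J = 0"
proof -
  define a where "a = sin (om * T / 2)"
  define d where "d = cos (om * T / 2)"
  define m where "m = mu * (om * T)"
  have ad: "a * a + d * d = 1"
    using sin_cos_squared_add[of "om * T / 2"] by (simp add: a_def d_def power2_eq_square)
  have a: "a \<noteq> 0" "a \<noteq> m * d"
    using assms by (simp_all add: a_def d_def m_def)
  obtain x b where x: "J = sol x b" "a * (x * a + b * d) = 0" "x * (a * d - m) = b * a\<^sup>2"
    using J unfolding vanishing_jacobi_sol[OF assms(1)] sol_zero_iff a_def[symmetric] d_def[symmetric]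
      m_def[symmetric] by blast
  have 1: "x * a + b * d = 0"
    using x(2) a(1) by simp
  \<comment> \<open>Elimination of \<open>b\<close> from the two equations, with
    \<open>a\<^sup>2 + d\<^sup>2 = 1\<close>.\<close>
  have "x * (a - m * d) = a * a * (x * a + b * d) + d * (x * (a * d - m) - b * a\<^sup>2) + x * a * (1 - (a * a + d * d))"
    by algebra
  then have "x * (a - m * d) = 0"
    unfolding 1 x(3) ad by simp
  then have "x = 0"
    using a(2) by simp
  moreover from this have "b = 0"
    using x(3) a(1) by simp
  ultimately show ?thesis
    using x(1) sol_eq_0_iff by simp
qed

text \<open>\<open>sol\<close> is linear and injective in \<open>(x, b)\<close>.\<close>

lemma dim_sol_plane: "dim {sol x b | x b. True} = 2"
proof -
  have ni: "sol 1 0 \<notin> span {sol 0 1}"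
  proof
    assume "sol 1 0 \<in> span {sol 0 1}"
    then obtain k where "sol 1 0 = k *\<^sub>R sol 0 1"
      unfolding span_singleton by blast
    then have "sol 1 (- k) = 0"
      using sol_linear[of 1 "- k"] by simp
    then show False
      using sol_eq_0_iff by simp
  qed
  have "{sol x b | x b. True} = span {sol 1 0, sol 0 1}"
  proof (intro equalityI subsetI)
    fix J assume "J \<in> {sol x b | x b. True}"
    then obtain x b where J: "J = sol x b"
      by blast
    show "J \<in> span {sol 1 0, sol 0 1}"
      unfolding J by (subst sol_linear, intro span_add span_scale span_base) simp_all
  next
    fix J assume "J \<in> span {sol 1 0, sol 0 1}"
    then obtain x where "J - x *\<^sub>R sol 1 0 \<in> span {sol 0 1}"
      unfolding span_breakdown_eq by blast
    then obtain b where "J - x *\<^sub>R sol 1 0 = b *\<^sub>R sol 0 1"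
      unfolding span_singleton by blast
    then have "J = sol x b"
      unfolding sol_linear[of x b] by (simp add: algebra_simps)
    then show "J \<in> {sol x b | x b. True}"
      by blast
  qed
  then have "dim {sol x b | x b. True} = dim {sol 1 0, sol 0 1}"
    by (simp only: real_vector.dim_span)
  also have "\<dots> = card {sol 1 0, sol 0 1}"
  proof (rule real_vector.dim_eq_card_independent)
    have "independent {sol 0 1}"
      using sol_eq_0_iff[of 0 1] by simp
    then show "independent {sol 1 0, sol 0 1}"
      using ni by (simp add: independent_insert)
  qed
  also have "\<dots> = 2"
    using ni span_base[of "sol 0 1" "{sol 0 1}"] by (auto simp: card_insert_if)
  finally show ?thesis .
qed

end

end


section \<open>Killing fields\<close>

context smooth_manifold
begin

lemma lie_bracket_apply:
  assumes "smooth_near A p f"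
  shows "lie_bracket A X Y p f = X p (\<lambda>q. Y q f) - Y p (\<lambda>q. X q f)"
  using assms by (simp add: lie_bracket_def)

text \<open>\<open>lie_bracket\<close> is the commutator only on functions smooth near the point,
  and 0 otherwise. Unfolding it under \<open>X p\<close> therefore needs a neighbourhood and the
  locality of tangent vectors.\<close>

lemma vector_field_lie_bracket:
  assumes X: "X \<in> vector_fields A" and Y: "Y \<in> vector_fields A" and Z: "Z \<in> vector_fields A"
    and f: "smooth_near A p f"
  shows "X p (\<lambda>q. lie_bracket A Y Z q f) = X p (\<lambda>q. Y q (\<lambda>r. Z r f)) - X p (\<lambda>q. Z q (\<lambda>r. Y r f))"
proof -
  obtain W where W: "open W" "p \<in> W" "\<And>q. q \<in> W \<Longrightarrow> smooth_near A q f"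
    using smooth_near_eventually[OF f] by blast
  have "X p (\<lambda>q. lie_bracket A Y Z q f) = X p (\<lambda>q. Y q (\<lambda>r. Z r f) - Z q (\<lambda>r. Y r f))"
    by (rule tangent_cong[OF vector_field_tangent[OF X] W(1,2)]) (rule lie_bracket_apply[OF W(3)])
  also have "\<dots> = X p (\<lambda>q. Y q (\<lambda>r. Z r f)) - X p (\<lambda>q. Z q (\<lambda>r. Y r f))"
    by (rule vector_field_apply_diff[OF X vector_field_smooth[OF Y vector_field_smooth[OF Z f]]
          vector_field_smooth[OF Z vector_field_smooth[OF Y f]]])
  finally show ?thesis .
qed

lemma lie_bracket_jacobi:
  assumes X: "X \<in> vector_fields A" and Y: "Y \<in> vector_fields A" and Z: "Z \<in> vector_fields A"
  shows "lie_bracket A X (lie_bracket A Y Z) p f =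
    lie_bracket A (lie_bracket A X Y) Z p f + lie_bracket A Y (lie_bracket A X Z) p f"
proof (cases "smooth_near A p f")
  case True
  note s = vector_field_smooth[OF X True] vector_field_smooth[OF Y True] vector_field_smooth[OF Z True]
  show ?thesis
    unfolding lie_bracket_apply[OF True] lie_bracket_apply[OF s(1)] lie_bracket_apply[OF s(2)]
      lie_bracket_apply[OF s(3)] vector_field_lie_bracket[OF X Y Z True]
      vector_field_lie_bracket[OF Z X Y True] vector_field_lie_bracket[OF Y X Z True]
    by simp
qed (simp add: lie_bracket_def)

end

section \<open>Killing fields in the frame\<close>

context M3_frame
begin

text \<open>The products of frame fields are constant, so the Killing condition makes the matrix of
  \<open>u\<^sub>i \<mapsto> [K, u\<^sub>i]\<close> skew: it is a cross product,
  \<open>[K, u\<^sub>i] = b \<times> u\<^sub>i\<close>.\<close>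

lemma killing_frame_brackets:
  assumes K: "killing_field A g K"
  obtains b1 b2 b3 where "\<forall>p. smooth_near A p b1" "\<forall>p. smooth_near A p b2" "\<forall>p. smooth_near A p b3"
    "\<forall>p. lie_bracket A K u1 p = fr p 0 (b3 p) (- b2 p)" "\<forall>p. lie_bracket A K u2 p = fr p (- b3 p) 0 (b1 p)"
    "\<forall>p. lie_bracket A K u3 p = fr p (b2 p) (- b1 p) 0"
proof
  have Kv: "K \<in> vector_fields A"
    using K unfolding killing_field_def by blast
  note vf = lie_bracket_vector_field[OF Kv frame_vf(1)] lie_bracket_vector_field[OF Kv frame_vf(2)]
    lie_bracket_vector_field[OF Kv frame_vf(3)]
  define L1 L2 L3 where L: "L1 = lie_bracket A K u1" "L2 = lie_bracket A K u2" "L3 = lie_bracket A K u3"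
  note t = vf[THEN vector_field_tangent, folded L]
  have ki: "K p (\<lambda>q. g q (X q) (Y q)) = g p (lie_bracket A K X p) (Y p) + g p (X p) (lie_bracket A K Y p)"
    if "X \<in> vector_fields A" "Y \<in> vector_fields A" for X Y p
    using K that unfolding killing_field_def by blast
  have co0: "co1 p (u1 p) = 1" "co2 p (u1 p) = 0" "co3 p (u1 p) = 0" "co1 p (u2 p) = 0" "co2 p (u2 p) = 1"
    "co3 p (u2 p) = 0" "co1 p (u3 p) = 0" "co2 p (u3 p) = 0" "co3 p (u3 p) = 1" for p
    unfolding frame_eq_fr co_fr by simp_all
  have const: "(\<lambda>q. g q (u1 q) (u1 q)) = (\<lambda>q. 1)" "(\<lambda>q. g q (u2 q) (u2 q)) = (\<lambda>q. 1)"
    "(\<lambda>q. g q (u3 q) (u3 q)) = (\<lambda>q. 1)" "(\<lambda>q. g q (u1 q) (u2 q)) = (\<lambda>q. 0)"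
    "(\<lambda>q. g q (u2 q) (u3 q)) = (\<lambda>q. 0)" "(\<lambda>q. g q (u3 q) (u1 q)) = (\<lambda>q. 0)"
    using orthonormal by auto
  have s: "co1 p (L1 p) = 0" "co2 p (L2 p) = 0" "co3 p (L3 p) = 0" "co1 p (L2 p) = - co2 p (L1 p)"
    "co2 p (L3 p) = - co3 p (L2 p)" "co3 p (L1 p) = - co1 p (L3 p)" for p
    using ki[OF frame_vf(1) frame_vf(1), of p] ki[OF frame_vf(2) frame_vf(2), of p]
      ki[OF frame_vf(3) frame_vf(3), of p] ki[OF frame_vf(1) frame_vf(2), of p]
      ki[OF frame_vf(2) frame_vf(3), of p] ki[OF frame_vf(3) frame_vf(1), of p]
    unfolding const vector_field_apply_const[OF Kv] L[symmetric]
    unfolding metric_eq_co[OF t(1) frame_tangent(1)] metric_eq_co[OF t(1) frame_tangent(2)]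
      metric_eq_co[OF t(1) frame_tangent(3)] metric_eq_co[OF t(2) frame_tangent(1)]
      metric_eq_co[OF t(2) frame_tangent(2)] metric_eq_co[OF t(2) frame_tangent(3)]
      metric_eq_co[OF t(3) frame_tangent(1)] metric_eq_co[OF t(3) frame_tangent(2)]
      metric_eq_co[OF t(3) frame_tangent(3)]
      metric_eq_co[OF frame_tangent(1) t(1)] metric_eq_co[OF frame_tangent(1) t(2)]
      metric_eq_co[OF frame_tangent(1) t(3)] metric_eq_co[OF frame_tangent(2) t(1)]
      metric_eq_co[OF frame_tangent(2) t(2)] metric_eq_co[OF frame_tangent(2) t(3)]
      metric_eq_co[OF frame_tangent(3) t(1)] metric_eq_co[OF frame_tangent(3) t(2)]
      metric_eq_co[OF frame_tangent(3) t(3)] co0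
    by simp_all
  show "\<forall>p. smooth_near A p (\<lambda>p. co3 p (L2 p))" "\<forall>p. smooth_near A p (\<lambda>p. co1 p (L3 p))"
    "\<forall>p. smooth_near A p (\<lambda>p. co2 p (L1 p))"
    unfolding L using co_smooth(3)[OF vf(2)] co_smooth(1)[OF vf(3)] co_smooth(2)[OF vf(1)] by blast+
  show "\<forall>p. lie_bracket A K u1 p = fr p 0 (co2 p (L1 p)) (- co1 p (L3 p))"
    "\<forall>p. lie_bracket A K u2 p = fr p (- co2 p (L1 p)) 0 (co3 p (L2 p))"
    "\<forall>p. lie_bracket A K u3 p = fr p (co1 p (L3 p)) (- co3 p (L2 p)) 0"
    unfolding L[symmetric] using frame_expand[OF t(1)] frame_expand[OF t(2)] frame_expand[OF t(3)]
    unfolding s by blast+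
qed

lemma lie_bracket_frame_right:
  assumes X: "X \<in> vector_fields A" and x: "\<And>p. X p = fr p (x p) (y p) (z p)"
  shows "lie_bracket A X u1 p = fr p (- u1 p x) (- u1 p y + c * z p) (- u1 p z - \<tau> * y p)"
    "lie_bracket A X u2 p = fr p (- u2 p x - c * z p) (- u2 p y) (- u2 p z + \<tau> * x p)"
    "lie_bracket A X u3 p = fr p (- u3 p x + c * y p) (- u3 p y - c * x p) (- u3 p z)"
    "lie_bracket A u1 X p = fr p (u1 p x) (u1 p y - c * z p) (u1 p z + \<tau> * y p)"
    "lie_bracket A u2 X p = fr p (u2 p x + c * z p) (u2 p y) (u2 p z - \<tau> * x p)"
    "lie_bracket A u3 X p = fr p (u3 p x - c * y p) (u3 p y + c * x p) (u3 p z)"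
proof -
  have co: "co1 p (X p) = x p" "co2 p (X p) = y p" "co3 p (X p) = z p" for p
    by (simp_all add: x)
  have co0: "co1 p (u1 p) = 1" "co2 p (u1 p) = 0" "co3 p (u1 p) = 0" "co1 p (u2 p) = 0" "co2 p (u2 p) = 1"
    "co3 p (u2 p) = 0" "co1 p (u3 p) = 0" "co2 p (u3 p) = 0" "co3 p (u3 p) = 1" for p
    unfolding frame_eq_fr co_fr by simp_all
  show "lie_bracket A X u1 p = fr p (- u1 p x) (- u1 p y + c * z p) (- u1 p z - \<tau> * y p)"
    "lie_bracket A X u2 p = fr p (- u2 p x - c * z p) (- u2 p y) (- u2 p z + \<tau> * x p)"
    "lie_bracket A X u3 p = fr p (- u3 p x + c * y p) (- u3 p y - c * x p) (- u3 p z)"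
    "lie_bracket A u1 X p = fr p (u1 p x) (u1 p y - c * z p) (u1 p z + \<tau> * y p)"
    "lie_bracket A u2 X p = fr p (u2 p x + c * z p) (u2 p y) (u2 p z - \<tau> * x p)"
    "lie_bracket A u3 X p = fr p (u3 p x - c * y p) (u3 p y + c * x p) (u3 p z)"
    unfolding lie_bracket_fr[OF X frame_vf(1)] lie_bracket_fr[OF X frame_vf(2)] lie_bracket_fr[OF X frame_vf(3)]
      lie_bracket_fr[OF frame_vf(1) X] lie_bracket_fr[OF frame_vf(2) X] lie_bracket_fr[OF frame_vf(3) X]
      co co0 vector_field_apply_const[OF X] vector_field_apply_const[OF frame_vf(1)]
      vector_field_apply_const[OF frame_vf(2)] vector_field_apply_const[OF frame_vf(3)] fr_eq_iff
    by simp_all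
qed

text \<open>The derivations \<open>[K, \<cdot>]\<close> satisfy \<open>[K,[u\<^sub>i,u\<^sub>j]] = [[K,u\<^sub>i],u\<^sub>j] + [u\<^sub>i,[K,u\<^sub>j]]\<close>. This determines all
  derivatives of their coefficients, and the integrability condition for the latter is
  \<open>\<tau> (c - \<tau>) [K,u\<^sub>3] = 0\<close>.\<close>

lemma killing_bracket_u3:
  assumes K: "killing_field A g K" and "\<tau> \<noteq> 0" "c \<noteq> \<tau>"
  obtains b where "\<forall>p. lie_bracket A K u1 p = fr p 0 (b p) 0" "\<forall>p. lie_bracket A K u2 p = fr p (- b p) 0 0"
    "\<forall>p. lie_bracket A K u3 p = fr p 0 0 0"
proof -
  have Kv: "K \<in> vector_fields A"
    using K unfolding killing_field_def by blast
  obtain b1 b2 b3 where s: "\<forall>p. smooth_near A p b1" "\<forall>p. smooth_near A p b2" "\<forall>p. smooth_near A p b3"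
    and br: "\<forall>p. lie_bracket A K u1 p = fr p 0 (b3 p) (- b2 p)" "\<forall>p. lie_bracket A K u2 p = fr p (- b3 p) 0 (b1 p)"
    "\<forall>p. lie_bracket A K u3 p = fr p (b2 p) (- b1 p) 0"
    using killing_frame_brackets[OF K] .
  have s: "smooth_near A p b1" "smooth_near A p b2" "smooth_near A p b3" for p
    using s by blast+
  have br: "lie_bracket A K u1 = (\<lambda>p. fr p 0 (b3 p) (- b2 p))" "lie_bracket A K u2 = (\<lambda>p. fr p (- b3 p) 0 (b1 p))"
    "lie_bracket A K u3 = (\<lambda>p. fr p (b2 p) (- b1 p) 0)"
    using br by blast+
  have sc: "lie_bracket A K (a *\<^sub>R X) p = a *\<^sub>R lie_bracket A K X p" if X: "X \<in> vector_fields A" for a X p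
  proof -
    have t: "(a *\<^sub>R X) q = a *\<^sub>R X q" for q
      by (simp add: scaleR_fun_def)
    have aX: "a *\<^sub>R X \<in> vector_fields A"
      using vector_field_fmult[OF X smooth_near_const, of a] unfolding fmult_def t[symmetric] by simp
    have sa: "(a *\<^sub>R X p) f = a * X p f" for f
      by (simp add: scaleR_fun_def)
    show ?thesis
      unfolding lie_bracket_fr[OF Kv aX] lie_bracket_fr[OF Kv X] t sa co_scaleR[OF vector_field_tangent[OF X]]
        vector_field_apply_cmult[OF Kv co_smooth(1)[OF X]] vector_field_apply_cmult[OF Kv co_smooth(2)[OF X]]
        vector_field_apply_cmult[OF Kv co_smooth(3)[OF X]] fr_scaleR fr_eq_iff
      by (simp add: algebra_simps)
  qed
  have j: "lie_bracket A K (lie_bracket A X Y) p = lie_bracket A (lie_bracket A K X) Y p + lie_bracket A X (lie_bracket A K Y) p"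
    if "X \<in> vector_fields A" "Y \<in> vector_fields A" for X Y p
    using lie_bracket_jacobi[OF Kv that] by (intro ext) simp
  note z = smooth_near_const[of _ 0]
  note m = vector_field_apply_minus[OF frame_vf(1)] vector_field_apply_minus[OF frame_vf(2)]
    vector_field_apply_minus[OF frame_vf(3)] vector_field_apply_const[OF frame_vf(1)]
    vector_field_apply_const[OF frame_vf(2)] vector_field_apply_const[OF frame_vf(3)]
  note L1 = lie_bracket_frame_right[OF fr_vector_field[OF z s(3) smooth_near_minus[OF s(2)]] refl]
  note L2 = lie_bracket_frame_right[OF fr_vector_field[OF smooth_near_minus[OF s(3)] z s(1)] refl]
  note L3 = lie_bracket_frame_right[OF fr_vector_field[OF s(2) smooth_near_minus[OF s(1)] z] refl]
  \<comment> \<open>Components of the Jacobi identity for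
    \<open>[u\<^sub>1, u\<^sub>2] = \<tau> u\<^sub>3\<close>; \<open>e2\<close> and
    \<open>e3\<close> belong to the other two brackets.\<close>
  have e1: "\<tau> * b2 p = - u1 p b3 + c * b2 p" "- \<tau> * b1 p = - u2 p b3 - c * b1 p" "0 = u2 p b2 + u1 p b1" for p
  proof -
    have "\<tau> *\<^sub>R lie_bracket A K u3 p = lie_bracket A (lie_bracket A K u1) u2 p + lie_bracket A u1 (lie_bracket A K u2) p"
      using j[OF frame_vf(1,2), of p] unfolding brackets sc[OF frame_vf(3)] .
    then show "\<tau> * b2 p = - u1 p b3 + c * b2 p" "- \<tau> * b1 p = - u2 p b3 - c * b1 p" "0 = u2 p b2 + u1 p b1"
      unfolding br L1 L2 fr_add fr_scaleR fr_eq_iff by (simp_all add: m s)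
  qed
  have e2: "0 = u3 p b3 + u2 p b2" "0 = u2 p b1" "- c * b2 p = - u3 p b1 - \<tau> * b2 p" for p
  proof -
    have "c *\<^sub>R lie_bracket A K u1 p = lie_bracket A (lie_bracket A K u2) u3 p + lie_bracket A u2 (lie_bracket A K u3) p"
      using j[OF frame_vf(2,3), of p] unfolding brackets sc[OF frame_vf(1)] .
    then show "0 = u3 p b3 + u2 p b2" "0 = u2 p b1" "- c * b2 p = - u3 p b1 - \<tau> * b2 p"
      unfolding br L2 L3 fr_add fr_scaleR fr_eq_iff by (simp_all add: m s)
  qed
  have e3: "0 = u1 p b2" "0 = u1 p b1 + u3 p b3" "c * b1 p = \<tau> * b1 p - - u3 p (\<lambda>q. - b2 q)" for p
  proof -
    have "c *\<^sub>R lie_bracket A K u2 p = lie_bracket A (lie_bracket A K u3) u1 p + lie_bracket A u3 (lie_bracket A K u1) p"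
      using j[OF frame_vf(3,1), of p] unfolding brackets sc[OF frame_vf(2)] .
    then show "0 = u1 p b2" "0 = u1 p b1 + u3 p b3" "c * b1 p = \<tau> * b1 p - - u3 p (\<lambda>q. - b2 q)"
      unfolding br L1 L3 fr_add fr_scaleR fr_eq_iff by (simp_all add: m s)
  qed
  \<comment> \<open>The pairwise sums of \<open>u1 p b1\<close>, \<open>u2 p b2\<close> and
    \<open>u3 p b3\<close> vanish, hence so does each of them.\<close>
  have d: "u1 p b1 = 0" "u2 p b2 = 0" "u2 p b1 = 0" "u1 p b2 = 0" "u3 p b1 = (c - \<tau>) * b2 p"
    "u3 p b2 = (\<tau> - c) * b1 p" for p
    using e1[of p] e2[of p] e3[of p] by (simp_all add: m s algebra_simps)
  \<comment> \<open>Integrability: \<open>b1\<close> and \<open>b2\<close> have no derivatives along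
    \<open>u1\<close> and \<open>u2\<close>, hence none along
    \<open>[u\<^sub>1, u\<^sub>2] = \<tau> u\<^sub>3\<close>.\<close>
  have "\<tau> * u3 p b1 = 0" "\<tau> * u3 p b2 = 0" for p
    using bracket_frame(1)[OF s(1), of p] bracket_frame(1)[OF s(2), of p] unfolding d m by simp_all
  then have "b2 p = 0 \<and> b1 p = 0" for p
    using d(5,6)[of p] assms(2,3) by simp
  then show ?thesis
    using that[of b3] unfolding br by simp
qed

text \<open>At a zero of \<open>K\<close> the structure constants drop out of
  \<open>[K, u\<^sub>i]\<close>, which is then minus the derivative of the coefficients. So the
  linearization of \<open>K\<close> is an infinitesimal rotation about \<open>\<xi>\<close>.\<close>

lemma frame_deriv_at_zero:
  assumes Kv: "K \<in> vector_fields A" and K0: "K p = 0"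
    and b: "lie_bracket A K u1 p = fr p 0 b 0" "lie_bracket A K u2 p = fr p (- b) 0 0"
      "lie_bracket A K u3 p = fr p 0 0 0"
    and v: "v \<in> tangent_space A p"
  shows "v (\<lambda>q. co1 q (K q)) = b * co2 p v" "v (\<lambda>q. co2 q (K q)) = - b * co1 p v" "v (\<lambda>q. co3 q (K q)) = 0"
proof -
  have z: "co1 p (K p) = 0" "co2 p (K p) = 0" "co3 p (K p) = 0"
    using co_fr[of p 0 0 0] unfolding K0 fr_zero by simp_all
  have "K q = fr q (co1 q (K q)) (co2 q (K q)) (co3 q (K q))" for q
    by (rule frame_expand[OF vector_field_tangent[OF Kv]])
  note L = lie_bracket_frame_right[where x = "\<lambda>q. co1 q (K q)" and y = "\<lambda>q. co2 q (K q)"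
      and z = "\<lambda>q. co3 q (K q)", OF Kv this, of p]
  have b1: "u1 p (\<lambda>q. co1 q (K q)) = 0" "u1 p (\<lambda>q. co2 q (K q)) = - b" "u1 p (\<lambda>q. co3 q (K q)) = 0"
    using trans[OF L(1)[symmetric] b(1)] by (simp_all add: fr_eq_iff z)
  have b2: "u2 p (\<lambda>q. co1 q (K q)) = b" "u2 p (\<lambda>q. co2 q (K q)) = 0" "u2 p (\<lambda>q. co3 q (K q)) = 0"
    using trans[OF L(2)[symmetric] b(2)] by (simp_all add: fr_eq_iff z)
  have b3: "u3 p (\<lambda>q. co1 q (K q)) = 0" "u3 p (\<lambda>q. co2 q (K q)) = 0" "u3 p (\<lambda>q. co3 q (K q)) = 0"
    using trans[OF L(3)[symmetric] b(3)] by (simp_all add: fr_eq_iff z)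
  show "v (\<lambda>q. co1 q (K q)) = b * co2 p v" "v (\<lambda>q. co2 q (K q)) = - b * co1 p v" "v (\<lambda>q. co3 q (K q)) = 0"
    using b1 b2 b3 tangent_apply[OF v, of "\<lambda>q. co1 q (K q)"] tangent_apply[OF v, of "\<lambda>q. co2 q (K q)"]
      tangent_apply[OF v, of "\<lambda>q. co3 q (K q)"] by (simp_all add: algebra_simps)
qed

text \<open>\<open>fsys b x y z\<close> says that \<open>K = x u\<^sub>1 + y u\<^sub>2 + z u\<^sub>3\<close> satisfies \<open>[K,u\<^sub>1] = b u\<^sub>2\<close>, \<open>[K,u\<^sub>2] = - b u\<^sub>1\<close>
  and \<open>[K,u\<^sub>3] = 0\<close>.\<close>

definition fsys :: "real \<Rightarrow> ('a \<Rightarrow> real) \<Rightarrow> ('a \<Rightarrow> real) \<Rightarrow> ('a \<Rightarrow> real) \<Rightarrow> bool"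
  where "fsys b x y z \<longleftrightarrow> (\<forall>p. smooth_near A p x \<and> smooth_near A p y \<and> smooth_near A p z \<and>
    u1 p x = 0 \<and> u1 p y = c * z p - b \<and> u1 p z = - \<tau> * y p \<and>
    u2 p x = b - c * z p \<and> u2 p y = 0 \<and> u2 p z = \<tau> * x p \<and>
    u3 p x = c * y p \<and> u3 p y = - c * x p \<and> u3 p z = 0)"

lemma fsys_apply:
  assumes "fsys b x y z" "v \<in> tangent_space A p"
  shows "v x = co2 p v * (b - c * z p) + co3 p v * (c * y p)"
    "v y = co1 p v * (c * z p - b) + co3 p v * (- c * x p)"
    "v z = co1 p v * (- \<tau> * y p) + co2 p v * (\<tau> * x p)"
  using assms(1) tangent_apply[OF assms(2), of x] tangent_apply[OF assms(2), of y]
    tangent_apply[OF assms(2), of z] unfolding fsys_def by simp_all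

text \<open>Besides differentiating the coefficients of \<open>X\<close>, the bracket
  \<open>[K, X]\<close> only adds \<open>b\<close> times the quarter turn of its horizontal part.
  That term is skew and cancels in the metric.\<close>

lemma fsys_killing:
  assumes K: "fsys b x y z"
  shows "killing_field A g (\<lambda>p. fr p (x p) (y p) (z p))"
proof -
  define K where "K = (\<lambda>p. fr p (x p) (y p) (z p))"
  have Kv: "K \<in> vector_fields A"
    unfolding K_def using assms by (intro fr_vector_field) (auto simp: fsys_def)
  have co: "co1 p (K p) = x p" "co2 p (K p) = y p" "co3 p (K p) = z p" for p
    by (simp_all add: K_def)
  have br: "lie_bracket A K X p = fr p (K p (\<lambda>q. co1 q (X q)) - b * co2 p (X p))
      (K p (\<lambda>q. co2 q (X q)) + b * co1 p (X p)) (K p (\<lambda>q. co3 q (X q)))" if X: "X \<in> vector_fields A" for X p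
    unfolding lie_bracket_fr[OF Kv X] co fsys_apply[OF assms vector_field_tangent[OF X]] fr_eq_iff
    by (simp add: algebra_simps)
  have "K p (\<lambda>q. g q (X q) (Y q)) = g p (lie_bracket A K X p) (Y p) + g p (X p) (lie_bracket A K Y p)"
    if X: "X \<in> vector_fields A" and Y: "Y \<in> vector_fields A" for X Y p
  proof -
    note tX = vector_field_tangent[OF X] and tY = vector_field_tangent[OF Y]
    have "(\<lambda>q. g q (X q) (Y q)) = (\<lambda>q. co1 q (X q) * co1 q (Y q) + co2 q (X q) * co2 q (Y q) + co3 q (X q) * co3 q (Y q))"
      using metric_eq_co[OF tX tY] by blast
    then show ?thesis
      unfolding br[OF X] br[OF Y] metric_eq_co[OF fr_tangent tY] metric_eq_co[OF tX fr_tangent] co_fr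
      by (simp add: vector_field_apply_add[OF Kv] vector_field_apply_mult[OF Kv] co_smooth[OF X] co_smooth[OF Y]
          smooth_near_mult smooth_near_add) (simp add: algebra_simps)
  qed
  then show ?thesis
    using Kv unfolding killing_field_def K_def by blast
qed

text \<open>The frame spans each tangent space, so all derivatives in a chart vanish, and a ball in
  the chart is convex.\<close>

lemma zero_derivative_imp_locally_constant:
  assumes f: "\<And>p. smooth_near A p f"
    and z: "\<And>p. u1 p f = 0" "\<And>p. u2 p f = 0" "\<And>p. u3 p f = 0"
  shows "\<exists>W. open W \<and> a \<in> W \<and> (\<forall>b\<in>W. f a = f b)"
proof -
  obtain U \<phi> where U: "(U, \<phi>) \<in> A" "a \<in> U"
    by (rule chart_ex)
  have "\<phi> a \<in> \<phi> ` U"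
    using U(2) by (rule imageI)
  then obtain e where e: "e > 0" "ball (\<phi> a) e \<subseteq> \<phi> ` U"
    by (rule openE[OF chart_open(2)[OF U(1)]])
  define F where "F = (\<lambda>x. f (inv_into U \<phi> x))"
  have d: "(F has_derivative (\<lambda>h. 0)) (at x)" if "x \<in> \<phi> ` U" for x
  proof -
    have q: "inv_into U \<phi> x \<in> U" "\<phi> (inv_into U \<phi> x) = x"
      using chart_inv_in[OF U(1) that] chart_inv'[OF U(1) that] by auto
    have "frechet_derivative F (at x) h = 0" for h
    proof -
      have "chart_vector A U \<phi> (inv_into U \<phi> x) h \<in> tangent_space A (inv_into U \<phi> x)"
        unfolding tangent_space_chart[OF U(1) q(1)] by (rule rangeI)
      from tangent_apply[OF this, of f] have "chart_vector A U \<phi> (inv_into U \<phi> x) h f = 0"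
        by (simp add: z)
      then show ?thesis
        by (simp add: chart_vector_def f F_def o_def q(2))
    qed
    then have "frechet_derivative F (at x) = (\<lambda>h. 0)"
      by (rule ext)
    moreover have "F differentiable (at x)"
      using smooth_near_differentiable[OF U(1) q(1) f] unfolding q(2) F_def .
    ultimately show ?thesis
      unfolding frechet_derivative_works by simp
  qed
  have dw: "(F has_derivative (\<lambda>h. 0)) (at x within ball (\<phi> a) e)" if "x \<in> ball (\<phi> a) e" for x
    by (rule has_derivative_at_withinI[OF d[OF subsetD[OF e(2) that]]])
  have ctr: "\<phi> a \<in> ball (\<phi> a) e"
    using e(1) by simp
  show ?thesis
  proof (intro exI conjI ballI)
    show "open (U \<inter> \<phi> -` ball (\<phi> a) e)"
      by (rule continuous_open_preimage[OF chart_continuous[OF U(1)] chart_open(1)[OF U(1)] open_ball])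
    show "a \<in> U \<inter> \<phi> -` ball (\<phi> a) e"
      using U(2) ctr by blast
    fix b assume b: "b \<in> U \<inter> \<phi> -` ball (\<phi> a) e"
    then have mem: "\<phi> b \<in> ball (\<phi> a) e"
      by blast
    have "F (\<phi> a) = F (\<phi> b)"
      by (rule has_derivative_zero_unique[OF convex_ball _ ctr mem]) (erule dw)
    then show "f a = f b"
      using b U(2) by (simp add: F_def chart_inv[OF U(1)])
  qed
qed

lemma zero_derivative_imp_constant:
  assumes conn: "connected (UNIV :: 'a set)" and f: "\<And>p. smooth_near A p f"
    and z: "\<And>p. u1 p f = 0" "\<And>p. u2 p f = 0" "\<And>p. u3 p f = 0"
  shows "f p = f q"
proof (rule connected_local_const[OF conn UNIV_I UNIV_I], rule ballI)
  fix a
  obtain W where W: "open W" "a \<in> W" "\<forall>b\<in>W. f a = f b"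
    using zero_derivative_imp_locally_constant[OF f z, of a] by blast
  show "\<forall>\<^sub>F b in at a. f a = f b"
    unfolding eventually_at_topological using W by (intro exI[of _ W]) simp
qed

end

section \<open>Killing fields along the geodesic\<close>

context M3_geodesic
begin

text \<open>In the rotating frame the restricted field has the first integrals
  \<open>\<alpha> = a = 0\<close>, hence \<open>w = 0\<close>, and \<open>q' (0) = - b S\<close>.
  These data identify it with an explicit solution.\<close>

lemma fsys_along:
  assumes K: "fsys b x y z" and z0: "x (\<gamma> 0) = 0" "y (\<gamma> 0) = 0" "z (\<gamma> 0) = 0"
    and \<tau>: "\<tau> > 0" and lam: "lam > 0"
  shows "(\<lambda>t. fr (\<gamma> t) (x (\<gamma> t)) (y (\<gamma> t)) (z (\<gamma> t))) = sol 0 (- b * S)"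
proof -
  have sm: "smooth_near A p x" "smooth_near A p y" "smooth_near A p z" for p
    using K unfolding fsys_def by blast+
  note fa = fsys_apply[OF K velocity_tangent, unfolded v3_eq v12_eq]
  define k1 k2 k3 where k: "k1 = (\<lambda>t. x (\<gamma> t))" "k2 = (\<lambda>t. y (\<gamma> t))" "k3 = (\<lambda>t. z (\<gamma> t))"
  have d: "(k1 has_field_derivative S * sn t * (b - c * k3 t) + C * (c * k2 t)) (at t)"
    "(k2 has_field_derivative S * cs t * (c * k3 t - b) + C * (- c * k1 t)) (at t)"
    "(k3 has_field_derivative S * cs t * (- \<tau> * k2 t) + S * sn t * (\<tau> * k1 t)) (at t)" for t
    unfolding k fa[symmetric] by (rule velocity_has_derivative[OF sm(1)] velocity_has_derivative[OF sm(2)]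
      velocity_has_derivative[OF sm(3)])+
  define p where "p t = k1 t * cs t + k2 t * sn t" for t
  define q where "q t = k2 t * cs t - k1 t * sn t" for t
  have ss: "sn t * sn t = 1 - cs t * cs t" for t
    using cs_sn[of t] by (simp add: power2_eq_square)
  have p': "(p has_field_derivative 0 + \<tau> * C * q t) (at t)" for t
    unfolding p_def[abs_def]
    by (rule derivative_eq_intros d cs_sn_deriv refl)+ (simp add: q_def algebra_simps)
  have q': "(q has_field_derivative S * (c * k3 t - b) - \<tau> * C * p t) (at t)" for t
  proof -
    have "(q has_field_derivative S * (c * k3 t - b) * (cs t * cs t + sn t * sn t) - \<tau> * C * p t) (at t)"
      unfolding q_def[abs_def]
      by (rule derivative_eq_intros d cs_sn_deriv refl)+ (simp add: p_def algebra_simps)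
    then show ?thesis
      unfolding ss by simp
  qed
  have r': "(k3 has_field_derivative 0 - \<tau> * S * q t) (at t)" for t
    using d(3)[of t] by (simp add: q_def algebra_simps)
  have q'': "((\<lambda>t. S * (c * k3 t - b) - \<tau> * C * p t) has_field_derivative \<tau> * 0 - lam * q t) (at t)" for t
    by (rule derivative_eq_intros p' r' refl)+ (simp add: lam_def power2_eq_square algebra_simps)
  have p0: "p 0 = 0" "q 0 = 0" "k3 0 = 0"
    using z0 by (simp_all add: p_def q_def k)
  note o = orthogonal_form[where \<alpha> = 0 and a = 0 and p = p and q = q and r = k3, OF p' r' p0(1,3)]
  have w: "((\<lambda>t. S * k3 t - C * p t) has_field_derivative 0 - \<tau> * q t) (at t)" for t
    using o(3)[of t] by simp
  have "q = solq (\<tau> * 0 / om) (S * (c * k3 0 - b) - \<tau> * C * p 0)"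
    "(\<lambda>t. S * k3 t - C * p t) = solr (\<tau> * 0 / om) (S * (c * k3 0 - b) - \<tau> * C * p 0)"
    by (rule sol_unique[OF \<tau> lam _ q'' w]; use q' p0 in simp)+
  then have e: "q = solq 0 (- b * S)" "(\<lambda>t. S * k3 t - C * p t) = solr 0 (- b * S)"
    using p0 by (simp_all add: mult.commute)
  have "fr (\<gamma> t) (k1 t) (k2 t) (k3 t) = rot t (p t) (q t) (k3 t)" for t
  proof -
    have "p t * cs t - q t * sn t = k1 t * (cs t * cs t + sn t * sn t)"
      "p t * sn t + q t * cs t = k2 t * (cs t * cs t + sn t * sn t)"
      unfolding p_def q_def by algebra+
    then show ?thesis
      unfolding rot_def ss by simp
  qed
  moreover have "p t = - C * solr 0 (- b * S) t" "k3 t = S * solr 0 (- b * S) t" for t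
    using o(1,2)[of t] unfolding e(2)[symmetric] by simp_all
  ultimately show ?thesis
    unfolding sol_def fld_def e(1)[symmetric] k[symmetric] by (simp add: k)
qed

text \<open>Both sides are differentiated at 0. In the rotating frame the explicit field has
  derivative \<open>(- C w, b, S w)\<close>, while a Killing field vanishing there has
  \<open>(0, - \<beta> S, 0)\<close>, an infinitesimal rotation of the velocity about
  \<open>\<xi>\<close>. Comparison gives \<open>w = 0\<close> and
  \<open>b = - \<beta> S\<close>.\<close>

lemma killing_sol:
  assumes K: "killing_field A g K" and "\<tau> > 0" "c \<noteq> \<tau>" and lam: "lam > 0"
    and e: "(\<lambda>t. K (\<gamma> t)) = sol x b"
  shows "x = 0 \<and> (S = 0 \<longrightarrow> b = 0)"
proof -
  have Kv: "K \<in> vector_fields A"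
    using K unfolding killing_field_def by blast
  have Kt: "K (\<gamma> t) = rot t (- C * solr x b t) (solq x b t) (S * solr x b t)" for t
    using fun_cong[OF e, of t] by (simp add: sol_def fld_def)
  have z: "solq x b 0 = 0" "solr x b 0 = 0"
    by (simp_all add: solq_def solr_def)
  have K0: "K (\<gamma> 0) = 0"
    unfolding Kt z rot_eq_0_iff by simp
  obtain h where h: "\<forall>p. lie_bracket A K u1 p = fr p 0 (h p) 0" "\<forall>p. lie_bracket A K u2 p = fr p (- h p) 0 0"
    "\<forall>p. lie_bracket A K u3 p = fr p 0 0 0"
    using killing_bracket_u3[OF K _ assms(3)] assms(2) by (metis less_irrefl)
  define \<beta> where "\<beta> = h (\<gamma> 0)"
  note f = frame_deriv_at_zero[OF Kv K0 spec[OF h(1)] spec[OF h(2)] spec[OF h(3)] velocity_tangent,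
      unfolded v12_eq, folded \<beta>_def]
  note D = velocity_has_derivative[OF co_smooth(1)[OF Kv], of 0] velocity_has_derivative[OF co_smooth(2)[OF Kv], of 0]
    velocity_has_derivative[OF co_smooth(3)[OF Kv], of 0]
  note D = D[unfolded f Kt rot_def co_fr]
  define w where "w = om * x / \<tau>"
  have sr: "(solr x b has_field_derivative w) (at 0)"
    using solr_deriv[OF assms(2) lam, of x b 0] z by (simp add: w_def)
  have sq: "(solq x b has_field_derivative b) (at 0)"
    using solq_deriv[OF assms(2) lam, of x b 0] by simp
  have 1: "((\<lambda>t. - C * solr x b t * cs t - solq x b t * sn t) has_field_derivative - C * w * cs 0 - b * sn 0) (at 0)"
    by (rule derivative_eq_intros sr sq cs_sn_deriv refl)+ (simp add: z)
  have 2: "((\<lambda>t. - C * solr x b t * sn t + solq x b t * cs t) has_field_derivative - C * w * sn 0 + b * cs 0) (at 0)"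
    by (rule derivative_eq_intros sr sq cs_sn_deriv refl)+ (simp add: z)
  have 3: "((\<lambda>t. S * solr x b t) has_field_derivative S * w) (at 0)"
    by (rule DERIV_cmult[OF sr])
  have e1: "- C * w * cs 0 - b * sn 0 = \<beta> * (S * sn 0)"
    by (rule DERIV_unique[OF 1 D(1)])
  have e2: "- C * w * sn 0 + b * cs 0 = - \<beta> * (S * cs 0)"
    by (rule DERIV_unique[OF 2 D(2)])
  have e3: "S * w = 0"
    by (rule DERIV_unique[OF 3 D(3)])
  \<comment> \<open>Component along the first rotated axis, extracted from \<open>e1\<close> and
    \<open>e2\<close>.\<close>
  have "- C * w * ((cs 0)\<^sup>2 + (sn 0)\<^sup>2) = (- C * w * cs 0 - b * sn 0) * cs 0 + (- C * w * sn 0 + b * cs 0) * sn 0"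
    by algebra
  also have "\<dots> = 0"
    unfolding e1 e2 by simp
  finally have Cw: "C * w = 0"
    by (simp add: cs_sn)
  have "w * (S\<^sup>2 + C\<^sup>2) = S * (S * w) + C * (C * w)"
    by algebra
  then have "w = 0"
    unfolding e3 Cw SC by simp
  then have "x = 0"
    using om[OF assms(2) lam] assms(2) by (simp add: w_def)
  moreover have "b = 0" if "S = 0"
  proof -
    have "b * ((cs 0)\<^sup>2 + (sn 0)\<^sup>2) = (- C * w * sn 0 + b * cs 0) * cs 0 - (- C * w * cs 0 - b * sn 0) * sn 0"
      by algebra
    then show ?thesis
      unfolding e1 e2 that cs_sn by simp
  qed
  ultimately show ?thesis
    by blast
qed

end


section \<open>Right-invariant fields\<close>

lemma slice_derivative:
  fixes F :: "'e::euclidean_space \<times> 'e \<Rightarrow> real"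
  assumes "F differentiable (at (x, y))"
  shows "frechet_derivative (\<lambda>x. F (x, y)) (at x) d = frechet_derivative F (at (x, y)) (d, 0)"
    and "frechet_derivative (\<lambda>y. F (x, y)) (at y) d = frechet_derivative F (at (x, y)) (0, d)"
proof -
  have F: "(F has_derivative frechet_derivative F (at (x, y))) (at (x, y))"
    using assms frechet_derivative_works by blast
  have "((\<lambda>x. (x, y)) has_derivative (\<lambda>d. (d, 0))) (at x)" "((\<lambda>y. (x, y)) has_derivative (\<lambda>d. (0, d))) (at y)"
    by (auto intro!: derivative_eq_intros)
  note h = diff_chain_at[OF this(1) F] diff_chain_at[OF this(2) F]
  show "frechet_derivative (\<lambda>x. F (x, y)) (at x) d = frechet_derivative F (at (x, y)) (d, 0)"
    using fun_cong[OF frechet_derivative_at[OF h(1)], of d] by (simp add: o_def)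
  show "frechet_derivative (\<lambda>y. F (x, y)) (at y) d = frechet_derivative F (at (x, y)) (0, d)"
    using fun_cong[OF frechet_derivative_at[OF h(2)], of d] by (simp add: o_def)
qed

lemma smooth_on_slice:
  fixes F :: "'e::euclidean_space \<times> 'e \<Rightarrow> real"
  assumes "open T" "smooth_on T F"
  shows "open {x. (x, y) \<in> T}" "smooth_on {x. (x, y) \<in> T} (\<lambda>x. F (x, y))"
    and "open {y. (x, y) \<in> T}" "smooth_on {y. (x, y) \<in> T} (\<lambda>y. F (x, y))"
proof -
  have o: "open ((\<lambda>x. (x, y)) -` T)" "open ((\<lambda>y. (x, y)) -` T)"
    by (intro open_vimage assms(1) continuous_intros)+
  then show o1: "open {x. (x, y) \<in> T}" and o2: "open {y. (x, y) \<in> T}"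
    by (simp_all add: vimage_def)
  show "smooth_on {x. (x, y) \<in> T} (\<lambda>x. F (x, y))"
    by (rule smooth_on_compose[OF o1 assms(1) smooth_on_Pair[OF o1 smooth_on_ident smooth_on_const] assms(2)]) auto
  show "smooth_on {y. (x, y) \<in> T} (\<lambda>y. F (x, y))"
    by (rule smooth_on_compose[OF o2 assms(1) smooth_on_Pair[OF o2 smooth_on_const smooth_on_ident] assms(2)]) auto
qed

section \<open>Lie groups and right translations\<close>

locale smooth_group = smooth_manifold A
  for A :: "('a::{t2_space, second_countable_topology}, 'e::euclidean_space) atlas" +
  fixes G :: "'a monoid"
  assumes lie_group: "lie_group A G"
begin

abbreviation mul :: "'a \<Rightarrow> 'a \<Rightarrow> 'a" (infixl "\<cdot>" 70) where "a \<cdot> b \<equiv> a \<otimes>\<^bsub>G\<^esub> b"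
abbreviation e :: 'a where "e \<equiv> \<one>\<^bsub>G\<^esub>"

lemma one_mul: "e \<cdot> p = p"
  using lie_group unfolding lie_group_def by (simp add: monoid.l_one[OF group.is_monoid])

lemma mul_continuous: "continuous_on UNIV (\<lambda>(x, y). x \<cdot> y)"
  using lie_group unfolding lie_group_def smooth_map_on_def by blast

lemma mul_smooth:
  assumes "(U, \<phi>) \<in> A" "(V, \<psi>) \<in> A" "(W, \<eta>) \<in> A"
  shows "smooth_on (map_prod \<phi> \<psi> ` (U \<times> V \<inter> (\<lambda>(x, y). x \<cdot> y) -` W))
    (\<lambda>x. \<eta> (case inv_into (U \<times> V) (map_prod \<phi> \<psi>) x of (x, y) \<Rightarrow> x \<cdot> y))"
proof -
  have 1: "(U \<times> V, map_prod \<phi> \<psi>) \<in> prod_atlas A A"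
    using assms unfolding prod_atlas_def by blast
  have 2: "\<forall>(U, \<phi>)\<in>prod_atlas A A. \<forall>(V, \<psi>)\<in>A.
      smooth_on (\<phi> ` (U \<inter> UNIV \<inter> (\<lambda>(x, y). x \<cdot> y) -` V)) (\<psi> \<circ> (\<lambda>(x, y). x \<cdot> y) \<circ> inv_into U \<phi>)"
    using lie_group unfolding lie_group_def smooth_map_on_def by blast
  from bspec[OF bspec[OF 2 1, unfolded prod.case] assms(3), unfolded prod.case]
  show ?thesis
    by (simp add: o_def)
qed

text \<open>\<open>lie_group\<close> speaks of charts of \<open>prod_atlas\<close>, whose inverse is
  \<open>inv_into\<close> of a \<open>map_prod\<close>; on products of chart images it splits into a
  pair of inverses. Continuity keeps the product inside a chart in which \<open>f\<close> is
  smooth.\<close>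

lemma mul_chart:
  assumes U: "(U, \<phi>) \<in> A" "a \<in> U" and V: "(V, \<psi>) \<in> A" "b \<in> V" and f: "smooth_near A (a \<cdot> b) f"
  obtains T where "open T" "(\<phi> a, \<psi> b) \<in> T" "T \<subseteq> \<phi> ` U \<times> \<psi> ` V"
    "smooth_on T (\<lambda>(x, y). f (inv_into U \<phi> x \<cdot> inv_into V \<psi> y))"
proof -
  obtain W \<eta> where W: "(W, \<eta>) \<in> A" "a \<cdot> b \<in> W"
    by (rule chart_ex)
  obtain T0 where T0: "open T0" "\<eta> (a \<cdot> b) \<in> T0" "smooth_on T0 (\<lambda>x. f (inv_into W \<eta> x))"
    using f unfolding smooth_near_chart[OF W] by blast
  define M where "M = (\<lambda>(x, y). inv_into U \<phi> x \<cdot> inv_into V \<psi> y)"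
  have cM: "continuous_on (\<phi> ` U \<times> \<psi> ` V) M"
  proof -
    have "continuous_on (\<phi> ` U \<times> \<psi> ` V) (\<lambda>x. (inv_into U \<phi> (fst x), inv_into V \<psi> (snd x)))"
      by (intro continuous_on_Pair continuous_on_compose2[OF chart_inv_continuous[OF U(1)]]
          continuous_on_compose2[OF chart_inv_continuous[OF V(1)]] continuous_intros) auto
    from continuous_on_compose2[OF mul_continuous this] show ?thesis
      by (simp add: M_def case_prod_beta)
  qed
  have oUV: "open (\<phi> ` U \<times> \<psi> ` V)"
    using chart_open(2)[OF U(1)] chart_open(2)[OF V(1)] by (rule open_Times)
  define D where "D = \<phi> ` U \<times> \<psi> ` V \<inter> M -` W"
  have oD: "open D"
    unfolding D_def by (rule continuous_open_preimage[OF cM oUV chart_open(1)[OF W(1)]])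
  have inj: "inj_on (map_prod \<phi> \<psi>) (U \<times> V)"
    using inj_on_inverseI[of U "inv_into U \<phi>" \<phi>] inj_on_inverseI[of V "inv_into V \<psi>" \<psi>]
      chart_inv[OF U(1)] chart_inv[OF V(1)] by (intro map_prod_inj_on) auto
  have inv: "inv_into (U \<times> V) (map_prod \<phi> \<psi>) (x, y) = (inv_into U \<phi> x, inv_into V \<psi> y)"
    if "x \<in> \<phi> ` U" "y \<in> \<psi> ` V" for x y
    by (rule inv_into_f_eq[OF inj])
      (use that chart_inv_in[OF U(1)] chart_inv_in[OF V(1)] chart_inv'[OF U(1)] chart_inv'[OF V(1)] in auto)
  have D_sub: "D \<subseteq> map_prod \<phi> \<psi> ` (U \<times> V \<inter> (\<lambda>(x, y). x \<cdot> y) -` W)"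
  proof
    fix z assume "z \<in> D"
    then obtain x y where z: "z = (x, y)" "x \<in> \<phi> ` U" "y \<in> \<psi> ` V" "M (x, y) \<in> W"
      unfolding D_def by blast
    have "map_prod \<phi> \<psi> (inv_into U \<phi> x, inv_into V \<psi> y) = z"
      using z chart_inv'[OF U(1)] chart_inv'[OF V(1)] by simp
    moreover have "(inv_into U \<phi> x, inv_into V \<psi> y) \<in> U \<times> V \<inter> (\<lambda>(x, y). x \<cdot> y) -` W"
      using z chart_inv_in[OF U(1)] chart_inv_in[OF V(1)] by (simp add: M_def)
    ultimately show "z \<in> map_prod \<phi> \<psi> ` (U \<times> V \<inter> (\<lambda>(x, y). x \<cdot> y) -` W)"
      by (metis imageI)
  qed
  have sD: "smooth_on D (\<lambda>z. \<eta> (M z))"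
    by (rule smooth_on_cong[OF oD _ smooth_on_subset[OF mul_smooth[OF U(1) V(1) W(1)] D_sub]])
      (auto simp: D_def inv M_def)
  define T where "T = D \<inter> (\<lambda>z. \<eta> (M z)) -` T0"
  have oT: "open T"
    unfolding T_def by (rule continuous_open_preimage[OF smooth_on_imp_continuous_on[OF sD] oD T0(1)])
  have "smooth_on T (\<lambda>z. f (inv_into W \<eta> (\<eta> (M z))))"
    by (rule smooth_on_compose[OF oT T0(1) smooth_on_subset[OF sD] T0(3)]) (auto simp: T_def)
  then have "smooth_on T (\<lambda>(x, y). f (inv_into U \<phi> x \<cdot> inv_into V \<psi> y))"
    by (rule smooth_on_cong[OF oT, rotated]) (auto simp: T_def D_def chart_inv[OF W(1)] M_def)
  note sT = this
  have mem: "(\<phi> a, \<psi> b) \<in> T"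
    using U V W T0 by (simp add: T_def D_def M_def chart_inv[OF U(1)] chart_inv[OF V(1)])
  have sub: "T \<subseteq> \<phi> ` U \<times> \<psi> ` V"
    by (auto simp: T_def D_def)
  show ?thesis
    by (rule that[OF oT mem sub sT])
qed

lemma smooth_near_translate:
  assumes "smooth_near A (a \<cdot> b) f"
  shows "smooth_near A a (\<lambda>q. f (q \<cdot> b))"
proof -
  obtain U \<phi> where U: "(U, \<phi>) \<in> A" "a \<in> U"
    by (rule chart_ex)
  obtain V \<psi> where V: "(V, \<psi>) \<in> A" "b \<in> V"
    by (rule chart_ex)
  obtain T where T: "open T" "(\<phi> a, \<psi> b) \<in> T" "T \<subseteq> \<phi> ` U \<times> \<psi> ` V"
    "smooth_on T (\<lambda>(x, y). f (inv_into U \<phi> x \<cdot> inv_into V \<psi> y))"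
    using mul_chart[OF U V assms] .
  show ?thesis
    unfolding smooth_near_chart[OF U]
    using smooth_on_slice(1,2)[OF T(1,4), of "\<psi> b"] T(2) chart_inv[OF V]
    by (intro exI[of _ "{x. (x, \<psi> b) \<in> T}"]) simp
qed

text \<open>The push of \<open>v\<close> to \<open>p\<close> by right translation. Its flow consists
  of left translations, so it is Killing for a left-invariant metric.\<close>

definition right_field :: "'a tvec \<Rightarrow> 'a vfield"
  where "right_field v = (\<lambda>p f. if smooth_near A p f then v (\<lambda>q. f (q \<cdot> p)) else 0)"

lemma right_field_one:
  assumes "v \<in> tangent_space A e"
  shows "right_field v e = v"
proof
  fix f
  have "q \<cdot> e = q" for q
    using lie_group unfolding lie_group_def by (simp add: monoid.r_one[OF group.is_monoid])
  then show "right_field v e f = v f"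
    using tangent_not_smooth[OF assms] by (simp add: right_field_def)
qed

lemma right_field_tangent:
  assumes "v \<in> tangent_space A e"
  shows "right_field v p \<in> tangent_space A p"
proof -
  obtain U \<phi> where U: "(U, \<phi>) \<in> A" "e \<in> U"
    by (rule chart_ex)
  obtain d where v: "v = chart_vector A U \<phi> e d"
    using assms unfolding tangent_space_chart[OF U] by blast
  define h where "h = (\<lambda>x. inv_into U \<phi> x \<cdot> p)"
  have h0: "h (\<phi> e) = p"
    by (simp add: h_def chart_inv[OF U] one_mul)
  have sm: "smooth_near A e (\<lambda>q. f (q \<cdot> p))" if "smooth_near A p f" for f
    using smooth_near_translate[of e p f] that by (simp add: one_mul)
  have "continuous_on (\<phi> ` U) h"
  proof -
    have "continuous_on (\<phi> ` U) (\<lambda>x. (inv_into U \<phi> x, p))"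
      by (intro continuous_on_Pair chart_inv_continuous[OF U(1)] continuous_on_const)
    from continuous_on_compose2[OF mul_continuous this] show ?thesis
      by (simp add: h_def)
  qed
  then have "continuous (at (\<phi> e)) h"
    using chart_open(2)[OF U(1)] U(2) continuous_on_eq_continuous_at by blast
  then have "(\<lambda>f. if smooth_near A (h (\<phi> e)) f then frechet_derivative (\<lambda>x. f (h x)) (at (\<phi> e)) d else 0)
      \<in> tangent_space A (h (\<phi> e))"
  proof (rule push_tangent_space)
    fix f assume "smooth_near A (h (\<phi> e)) f"
    then have "smooth_near A p f"
      unfolding h0 .
    then show "(\<lambda>x. f (h x)) differentiable (at (\<phi> e))"
      unfolding h_def by (rule smooth_near_differentiable[OF U sm])
  qed
  moreover have "right_field v p =
      (\<lambda>f. if smooth_near A (h (\<phi> e)) f then frechet_derivative (\<lambda>x. f (h x)) (at (\<phi> e)) d else 0)"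
  proof
    fix f
    show "right_field v p f =
        (if smooth_near A (h (\<phi> e)) f then frechet_derivative (\<lambda>x. f (h x)) (at (\<phi> e)) d else 0)"
      using sm[of f] by (simp add: right_field_def v chart_vector_def o_def h0) (simp add: h_def)
  qed
  ultimately show ?thesis
    by (simp add: h0)
qed

text \<open>In charts the field applied to \<open>f\<close> is a partial derivative of
  \<open>(x, y) \<mapsto> f (x \<cdot> y)\<close> on the slice where \<open>x\<close> represents the
  identity. Smoothness of the field and its commutation with left-invariant fields both rest on
  this.\<close>

lemma right_field_chart:
  assumes U: "(U, \<phi>) \<in> A" "e \<in> U" and V: "(V, \<psi>) \<in> A" "p \<in> V" and f: "smooth_near A p f"
    and v: "v = chart_vector A U \<phi> e d"
  obtains T N where "open T" "(\<phi> e, \<psi> p) \<in> T" "T \<subseteq> \<phi> ` U \<times> \<psi> ` V"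
    "smooth_on T (\<lambda>(x, y). f (inv_into U \<phi> x \<cdot> inv_into V \<psi> y))" "open N" "\<psi> p \<in> N"
    "\<forall>y\<in>N. (\<phi> e, y) \<in> T"
    "\<forall>y\<in>N. right_field v (inv_into V \<psi> y) f =
      frechet_derivative (\<lambda>(x, y). f (inv_into U \<phi> x \<cdot> inv_into V \<psi> y)) (at (\<phi> e, y)) (d, 0)"
proof -
  define F where "F = (\<lambda>(x, y). f (inv_into U \<phi> x \<cdot> inv_into V \<psi> y))"
  obtain T where T: "open T" "(\<phi> e, \<psi> p) \<in> T" "T \<subseteq> \<phi> ` U \<times> \<psi> ` V" "smooth_on T F"
    using mul_chart[OF U V, of f, unfolded one_mul, OF f, folded F_def] .
  obtain W where W: "open W" "p \<in> W" "\<And>q. q \<in> W \<Longrightarrow> smooth_near A q f"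
    using smooth_near_eventually[OF f] by blast
  define N where "N = {y. (\<phi> e, y) \<in> T} \<inter> \<psi> ` (V \<inter> W)"
  have oN: "open N"
    unfolding N_def using smooth_on_slice(3)[OF T(1,4)] chart_image_open[OF V(1) W(1)] by (rule open_Int)
  have "right_field v (inv_into V \<psi> y) f = frechet_derivative F (at (\<phi> e, y)) (d, 0)" if y: "y \<in> N" for y
  proof -
    have q: "smooth_near A (inv_into V \<psi> y) f" "(\<phi> e, y) \<in> T"
      using y W(3) chart_inv[OF V(1)] unfolding N_def by auto
    then have s: "smooth_near A e (\<lambda>q. f (q \<cdot> inv_into V \<psi> y))"
      using smooth_near_translate[of e "inv_into V \<psi> y" f] by (simp add: one_mul)
    have "right_field v (inv_into V \<psi> y) f = frechet_derivative (\<lambda>x. F (x, y)) (at (\<phi> e)) d"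
      using q s by (simp add: right_field_def v chart_vector_def o_def F_def)
    also have "\<dots> = frechet_derivative F (at (\<phi> e, y)) (d, 0)"
      by (rule slice_derivative(1)[OF smooth_on_imp_differentiable[OF T(4) q(2)]])
    finally show ?thesis .
  qed
  note r = this
  have mem: "\<psi> p \<in> N"
    using T(2) V(2) W(2) by (auto simp: N_def)
  have sub: "\<forall>y\<in>N. (\<phi> e, y) \<in> T"
    by (auto simp: N_def)
  show ?thesis
    by (rule that[OF T(1-3) _ oN mem sub]) (use T(4) r in \<open>simp_all add: F_def\<close>)
qed

lemma right_field_vector_field:
  assumes "v \<in> tangent_space A e"
  shows "right_field v \<in> vector_fields A"
proof (rule vector_fieldsI[OF right_field_tangent[OF assms]])
  fix p f assume f: "smooth_near A p f"
  obtain U \<phi> where U: "(U, \<phi>) \<in> A" "e \<in> U"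
    by (rule chart_ex)
  obtain V \<psi> where V: "(V, \<psi>) \<in> A" "p \<in> V"
    by (rule chart_ex)
  obtain d where v: "v = chart_vector A U \<phi> e d"
    using assms unfolding tangent_space_chart[OF U] by blast
  obtain T N where T: "open T" "(\<phi> e, \<psi> p) \<in> T" "T \<subseteq> \<phi> ` U \<times> \<psi> ` V"
    "smooth_on T (\<lambda>(x, y). f (inv_into U \<phi> x \<cdot> inv_into V \<psi> y))" and N: "open N" "\<psi> p \<in> N"
    "\<forall>y\<in>N. (\<phi> e, y) \<in> T"
    "\<forall>y\<in>N. right_field v (inv_into V \<psi> y) f =
      frechet_derivative (\<lambda>(x, y). f (inv_into U \<phi> x \<cdot> inv_into V \<psi> y)) (at (\<phi> e, y)) (d, 0)"
    using right_field_chart[OF U V f v] .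
  have "N \<subseteq> {y. (\<phi> e, y) \<in> T}"
    using N(3) by blast
  from smooth_on_subset[OF smooth_on_slice(4)[OF T(1) smooth_on_frechet_derivative[OF T(4), of "(d, 0)"]] this]
  have "smooth_on N (\<lambda>y. right_field v (inv_into V \<psi> y) f)"
    by (rule smooth_on_cong[OF N(1), rotated]) (rule bspec[OF N(4), symmetric])
  then show "smooth_near A p (\<lambda>q. right_field v q f)"
    unfolding smooth_near_chart[OF V] using N(1,2) by (intro exI[of _ N]) simp
qed

text \<open>Left and right translations commute, so the two sides are the two mixed second derivatives of
  \<open>(a, b) \<mapsto> f (a \<cdot> b)\<close>.\<close>

lemma right_field_commutes:
  assumes v: "v \<in> tangent_space A e" and X: "X \<in> vector_fields A"
    and left: "\<And>a p. X (a \<cdot> p) = left_push G a (X p)"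
  shows "lie_bracket A (right_field v) X p f = 0"
proof (cases "smooth_near A p f")
  case f: True
  obtain U \<phi> where U: "(U, \<phi>) \<in> A" "e \<in> U"
    by (rule chart_ex)
  obtain V \<psi> where V: "(V, \<psi>) \<in> A" "p \<in> V"
    by (rule chart_ex)
  obtain d where vd: "v = chart_vector A U \<phi> e d"
    using v unfolding tangent_space_chart[OF U] by blast
  obtain d' where Xd: "X p = chart_vector A V \<psi> p d'"
    using vector_field_tangent[OF X, of p] unfolding tangent_space_chart[OF V] by blast
  define F where "F = (\<lambda>(x, y). f (inv_into U \<phi> x \<cdot> inv_into V \<psi> y))"
  obtain T N where T: "open T" "(\<phi> e, \<psi> p) \<in> T" "T \<subseteq> \<phi> ` U \<times> \<psi> ` V" "smooth_on T F"
    and N: "open N" "\<psi> p \<in> N" "\<forall>y\<in>N. (\<phi> e, y) \<in> T"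
    "\<forall>y\<in>N. right_field v (inv_into V \<psi> y) f = frechet_derivative F (at (\<phi> e, y)) (d, 0)"
    using right_field_chart[OF U V f vd] unfolding F_def .
  have cong: "frechet_derivative f1 (at z) = frechet_derivative f2 (at z)"
    if "open B" "z \<in> B" "\<And>w. w \<in> B \<Longrightarrow> f1 w = f2 w" "f1 differentiable (at z)" for B z and f1 f2 :: "'e \<Rightarrow> real"
  proof -
    have "(f1 has_derivative frechet_derivative f1 (at z)) (at z)"
      using that(4) frechet_derivative_works by blast
    then have "(f2 has_derivative frechet_derivative f1 (at z)) (at z)"
      by (rule has_derivative_transform_within_open[OF _ that(1-3)])
    then show ?thesis
      by (rule frechet_derivative_at)
  qed
  define D1 where "D1 = (\<lambda>z. frechet_derivative F (at z) (d, 0))"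
  define D2 where "D2 = (\<lambda>z. frechet_derivative F (at z) (0, d'))"
  have sD: "smooth_on T D1" "smooth_on T D2"
    unfolding D1_def D2_def by (rule smooth_on_frechet_derivative[OF T(4)])+
  have "X p (\<lambda>q. right_field v q f) = frechet_derivative (\<lambda>y. right_field v (inv_into V \<psi> y) f) (at (\<psi> p)) d'"
    using vector_field_smooth[OF right_field_vector_field[OF v] f] by (simp add: Xd chart_vector_def o_def)
  also have "\<dots> = frechet_derivative (\<lambda>y. D1 (\<phi> e, y)) (at (\<psi> p)) d'"
  proof -
    have "frechet_derivative (\<lambda>y. right_field v (inv_into V \<psi> y) f) (at (\<psi> p)) =
        frechet_derivative (\<lambda>y. D1 (\<phi> e, y)) (at (\<psi> p))"
    proof (rule cong[OF N(1,2)])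
      show "right_field v (inv_into V \<psi> y) f = D1 (\<phi> e, y)" if "y \<in> N" for y
        using N(4) that by (simp add: D1_def)
      show "(\<lambda>y. right_field v (inv_into V \<psi> y) f) differentiable (at (\<psi> p))"
        by (rule smooth_near_differentiable[OF V vector_field_smooth[OF right_field_vector_field[OF v] f]])
    qed
    then show ?thesis
      by (rule fun_cong)
  qed
  also have "\<dots> = frechet_derivative D1 (at (\<phi> e, \<psi> p)) (0, d')"
    by (rule slice_derivative(2)[OF smooth_on_imp_differentiable[OF sD(1) T(2)]])
  finally have 1: "X p (\<lambda>q. right_field v q f) = frechet_derivative D1 (at (\<phi> e, \<psi> p)) (0, d')" .
  have Xf: "smooth_near A p (\<lambda>q. X q f)"
    by (rule vector_field_smooth[OF X f])
  then have s: "smooth_near A e (\<lambda>q. X (q \<cdot> p) f)"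
    using smooth_near_translate[of e p "\<lambda>q. X q f"] by (simp add: one_mul)
  have "right_field v p (\<lambda>q. X q f) = frechet_derivative (\<lambda>x. X (inv_into U \<phi> x \<cdot> p) f) (at (\<phi> e)) d"
    using Xf s by (simp add: right_field_def vd chart_vector_def o_def)
  also have "\<dots> = frechet_derivative (\<lambda>x. D2 (x, \<psi> p)) (at (\<phi> e)) d"
  proof -
    define B where "B = {x. (x, \<psi> p) \<in> T}"
    have B: "open B" "\<phi> e \<in> B"
      unfolding B_def using smooth_on_slice(1)[OF T(1,4)] T(2) by auto
    \<comment> \<open>Left invariance: \<open>X\<close> at the translated point is
      \<open>X p\<close> applied to the translated \<open>f\<close>, that is, the partial derivative
      of \<open>F\<close> in direction \<open>(0, d')\<close>.\<close>
    have "X (inv_into U \<phi> x \<cdot> p) f = D2 (x, \<psi> p)" if x: "x \<in> B" for x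
    proof -
      have xT: "(x, \<psi> p) \<in> T"
        using x by (simp add: B_def)
      have "smooth_near A p (\<lambda>r. f (inv_into U \<phi> x \<cdot> r))"
        unfolding smooth_near_chart[OF V]
        using smooth_on_slice(3,4)[OF T(1,4), of x] xT unfolding F_def
        by (intro exI[of _ "{y. (x, y) \<in> T}"]) simp
      then have "X (inv_into U \<phi> x \<cdot> p) f = frechet_derivative (\<lambda>y. F (x, y)) (at (\<psi> p)) d'"
        unfolding left left_push_def by (simp add: Xd chart_vector_def o_def F_def)
      also have "\<dots> = D2 (x, \<psi> p)"
        unfolding D2_def by (rule slice_derivative(2)[OF smooth_on_imp_differentiable[OF T(4) xT]])
      finally show ?thesis .
    qed
    note eq = this
    have "frechet_derivative (\<lambda>x. X (inv_into U \<phi> x \<cdot> p) f) (at (\<phi> e)) =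
        frechet_derivative (\<lambda>x. D2 (x, \<psi> p)) (at (\<phi> e))"
    proof (rule cong[OF B])
      show "X (inv_into U \<phi> x \<cdot> p) f = D2 (x, \<psi> p)" if "x \<in> B" for x
        by (rule eq[OF that])
      show "(\<lambda>x. X (inv_into U \<phi> x \<cdot> p) f) differentiable (at (\<phi> e))"
        by (rule smooth_near_differentiable[OF U s])
    qed
    then show ?thesis
      by (rule fun_cong)
  qed
  also have "\<dots> = frechet_derivative D2 (at (\<phi> e, \<psi> p)) (d, 0)"
    by (rule slice_derivative(1)[OF smooth_on_imp_differentiable[OF sD(2) T(2)]])
  also have "\<dots> = frechet_derivative D1 (at (\<phi> e, \<psi> p)) (0, d')"
    unfolding D1_def D2_def by (rule smooth_on_second_derivative_symmetric[OF T(1,4,2)])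
  finally show ?thesis
    using 1 f by (simp add: lie_bracket_def)
qed (simp add: lie_bracket_def)

end


section \<open>Conjugate points\<close>

lemma sin_half_eq_0_iff:
  assumes "s > 0"
  shows "sin (s / 2) = 0 \<longleftrightarrow> (\<exists>p::nat. p \<ge> 1 \<and> s = 2 * real p * pi)"
proof
  assume "sin (s / 2) = 0"
  then obtain i :: int where i: "s / 2 = of_int i * pi"
    using sin_zero_iff_int2 by blast
  then have "of_int i * pi > 0"
    using assms by linarith
  then have "i > 0"
    by (simp add: zero_less_mult_iff)
  then show "\<exists>p::nat. p \<ge> 1 \<and> s = 2 * real p * pi"
    using i by (intro exI[of _ "nat i"]) simp
next
  assume "\<exists>p::nat. p \<ge> 1 \<and> s = 2 * real p * pi"
  then show "sin (s / 2) = 0"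
    by auto
qed

text \<open>\<open>sin\<close> and \<open>cos\<close> have no common zero, so the equation without
  denominators already excludes the poles of \<open>tan\<close>.\<close>

lemma tan_solution_iff: "tan_solution m s \<longleftrightarrow> sin (s / 2) = m * s * cos (s / 2)"
proof
  assume t: "tan_solution m s"
  have "cos (s / 2) \<noteq> 0"
    using t unfolding tan_solution_def by blast
  then have "sin (s / 2) = tan (s / 2) * cos (s / 2)"
    by (simp add: tan_def)
  also have "tan (s / 2) = m * s"
    using t unfolding tan_solution_def by blast
  finally show "sin (s / 2) = m * s * cos (s / 2)" .
next
  assume *: "sin (s / 2) = m * s * cos (s / 2)"
  then have "cos (s / 2) \<noteq> 0"
    using sin_cos_squared_add[of "s / 2"] by auto
  then show "tan_solution m s"
    unfolding tan_solution_def tan_def using * by simp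
qed

lemma dim_range_scaleR:
  fixes v :: "'b::real_vector"
  assumes "v \<noteq> 0"
  shows "dim (range (\<lambda>k. k *\<^sub>R v)) = 1"
proof -
  have "dim (range (\<lambda>k. k *\<^sub>R v)) = dim {v}"
    unfolding span_singleton[symmetric] by (rule real_vector.dim_span)
  also have "\<dots> = card {v}"
    by (rule real_vector.dim_eq_card_independent) (use assms in simp)
  finally show ?thesis
    by simp
qed

section \<open>Right-invariant Killing fields and the rotation about the fiber\<close>

locale M3_group = M3_frame A g u1 u2 u3 \<tau> c + smooth_group A G
  for A :: "('a::{t2_space, second_countable_topology}, real^3) atlas"
    and g :: "'a metric" and u1 u2 u3 :: "'a vfield" and \<tau> c :: real and G :: "'a monoid" +
  assumes left_invariant: "u1 (a \<cdot> p) = left_push G a (u1 p)" "u2 (a \<cdot> p) = left_push G a (u2 p)"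
      "u3 (a \<cdot> p) = left_push G a (u3 p)"
    and connected: "connected (UNIV :: 'a set)"
begin

text \<open>Right-invariant fields commute with the left-invariant frame, which is the case
  \<open>b = 0\<close> of the system.\<close>

lemma right_field_fsys:
  assumes "v \<in> tangent_space A e"
  shows "fsys 0 (\<lambda>p. co1 p (right_field v p)) (\<lambda>p. co2 p (right_field v p)) (\<lambda>p. co3 p (right_field v p))"
proof -
  note R = right_field_vector_field[OF assms]
  note L = lie_bracket_frame_right[where x = "\<lambda>p. co1 p (right_field v p)" and y = "\<lambda>p. co2 p (right_field v p)"
      and z = "\<lambda>p. co3 p (right_field v p)", OF R]
  have ex: "right_field v p = fr p (co1 p (right_field v p)) (co2 p (right_field v p)) (co3 p (right_field v p))" for p
    by (rule frame_expand[OF vector_field_tangent[OF R]])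
  have z: "lie_bracket A (right_field v) u1 p = 0" "lie_bracket A (right_field v) u2 p = 0"
    "lie_bracket A (right_field v) u3 p = 0" for p
    using right_field_commutes[OF assms frame_vf(1) left_invariant(1)]
      right_field_commutes[OF assms frame_vf(2) left_invariant(2)]
      right_field_commutes[OF assms frame_vf(3) left_invariant(3)] by (auto simp: zero_fun_def)
  have "u1 p (\<lambda>p. co1 p (right_field v p)) = 0 \<and> u1 p (\<lambda>p. co2 p (right_field v p)) = c * co3 p (right_field v p) - 0 \<and>
      u1 p (\<lambda>p. co3 p (right_field v p)) = - \<tau> * co2 p (right_field v p) \<and>
      u2 p (\<lambda>p. co1 p (right_field v p)) = 0 - c * co3 p (right_field v p) \<and> u2 p (\<lambda>p. co2 p (right_field v p)) = 0 \<and>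
      u2 p (\<lambda>p. co3 p (right_field v p)) = \<tau> * co1 p (right_field v p) \<and>
      u3 p (\<lambda>p. co1 p (right_field v p)) = c * co2 p (right_field v p) \<and>
      u3 p (\<lambda>p. co2 p (right_field v p)) = - c * co1 p (right_field v p) \<and> u3 p (\<lambda>p. co3 p (right_field v p)) = 0" for p
    using trans[OF L(1)[OF ex, symmetric] z(1), of p] trans[OF L(2)[OF ex, symmetric] z(2), of p]
      trans[OF L(3)[OF ex, symmetric] z(3), of p]
    unfolding fr_eq_0_iff by auto
  then show ?thesis
    unfolding fsys_def using co_smooth[OF R] by blast
qed

text \<open>For \<open>c \<noteq> 0\<close> the rotation about \<open>\<xi>\<close> is generated by the difference of the left and the right
  invariant field that agree with \<open>\<xi>\<close> at the identity. For \<open>c = 0\<close> (Heisenberg group) the horizontal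
  coordinates \<open>X\<close>, \<open>Y\<close> can be read off the \<open>u\<^sub>3\<close>-components of right-invariant fields.\<close>

lemma rotation_field:
  assumes \<tau>: "\<tau> > 0"
  obtains b x y z where "b \<noteq> 0" "fsys b x y z" "x e = 0" "y e = 0" "z e = 0"
proof (cases "c = 0")
  case False
  define R where "R = right_field (u3 e)"
  have f: "fsys 0 (\<lambda>p. co1 p (R p)) (\<lambda>p. co2 p (R p)) (\<lambda>p. co3 p (R p))"
    unfolding R_def by (rule right_field_fsys[OF frame_tangent(3)])
  have R0: "R e = fr e 0 0 1"
    unfolding R_def right_field_one[OF frame_tangent(3)] by (rule frame_eq_fr)
  have s: "smooth_near A p (\<lambda>p. co1 p (R p))" "smooth_near A p (\<lambda>p. co2 p (R p))" "smooth_near A p (\<lambda>p. co3 p (R p))" for p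
    using f unfolding fsys_def by blast+
  note m = vector_field_apply_minus[OF frame_vf(1) s(1)] vector_field_apply_minus[OF frame_vf(1) s(2)]
    vector_field_apply_minus[OF frame_vf(2) s(1)] vector_field_apply_minus[OF frame_vf(2) s(2)]
    vector_field_apply_minus[OF frame_vf(3) s(1)] vector_field_apply_minus[OF frame_vf(3) s(2)]
    vector_field_apply_diff[OF frame_vf(1) smooth_near_const s(3)] vector_field_apply_const[OF frame_vf(1)]
    vector_field_apply_diff[OF frame_vf(2) smooth_near_const s(3)] vector_field_apply_const[OF frame_vf(2)]
    vector_field_apply_diff[OF frame_vf(3) smooth_near_const s(3)] vector_field_apply_const[OF frame_vf(3)]
  \<comment> \<open>This is \<open>\<xi> - R\<close>: it vanishes at the identity, and
    \<open>b = c\<close> since \<open>[u\<^sub>3, u\<^sub>1] = c u\<^sub>2\<close>.\<close>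
  have "fsys c (\<lambda>p. - co1 p (R p)) (\<lambda>p. - co2 p (R p)) (\<lambda>p. 1 - co3 p (R p))"
    using f s unfolding fsys_def m
    by (auto intro: smooth_near_minus smooth_near_diff smooth_near_const simp: algebra_simps)
  then show ?thesis
    by (rule that[OF False]) (simp_all add: R0)
next
  case True
  define Q where "Q = right_field (u1 e)"
  define R where "R = right_field (u2 e)"
  have fQ: "fsys 0 (\<lambda>p. co1 p (Q p)) (\<lambda>p. co2 p (Q p)) (\<lambda>p. co3 p (Q p))"
    unfolding Q_def by (rule right_field_fsys[OF frame_tangent(1)])
  have fR: "fsys 0 (\<lambda>p. co1 p (R p)) (\<lambda>p. co2 p (R p)) (\<lambda>p. co3 p (R p))"
    unfolding R_def by (rule right_field_fsys[OF frame_tangent(2)])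
  have Q0: "Q e = fr e 1 0 0" and R0: "R e = fr e 0 1 0"
    unfolding Q_def R_def right_field_one[OF frame_tangent(1)] right_field_one[OF frame_tangent(2)]
    by (rule frame_eq_fr)+
  have s: "smooth_near A p (\<lambda>p. co1 p (Q p))" "smooth_near A p (\<lambda>p. co2 p (Q p))" "smooth_near A p (\<lambda>p. co3 p (Q p))"
    "smooth_near A p (\<lambda>p. co1 p (R p))" "smooth_near A p (\<lambda>p. co2 p (R p))" "smooth_near A p (\<lambda>p. co3 p (R p))" for p
    using fQ fR unfolding fsys_def by blast+
  \<comment> \<open>For \<open>c = 0\<close> the horizontal coefficients of right-invariant fields
    have zero derivatives, so connectedness fixes them by their values at the identity.\<close>
  have const: "F p = F e" if "\<And>p. smooth_near A p F" "\<And>p. u1 p F = 0 \<and> u2 p F = 0 \<and> u3 p F = 0" for F p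
    using zero_derivative_imp_constant[OF connected that(1)] that(2) by blast
  note dQ = fQ[unfolded fsys_def, unfolded True] and dR = fR[unfolded fsys_def, unfolded True]
  have "co1 p (Q p) = co1 e (Q e)" for p
    by (rule const[where F = "\<lambda>p. co1 p (Q p)", OF s(1)]) (use dQ in simp)
  moreover have "co2 p (Q p) = co2 e (Q e)" for p
    by (rule const[where F = "\<lambda>p. co2 p (Q p)", OF s(2)]) (use dQ in simp)
  ultimately have Q: "co1 p (Q p) = 1" "co2 p (Q p) = 0" for p
    by (simp_all add: Q0)
  have "co1 p (R p) = co1 e (R e)" for p
    by (rule const[where F = "\<lambda>p. co1 p (R p)", OF s(4)]) (use dR in simp)
  moreover have "co2 p (R p) = co2 e (R e)" for p
    by (rule const[where F = "\<lambda>p. co2 p (R p)", OF s(5)]) (use dR in simp)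
  ultimately have R: "co1 p (R p) = 0" "co2 p (R p) = 1" for p
    by (simp_all add: R0)
  \<comment> \<open>The equations for the third coefficients of \<open>Q\<close> and
    \<open>R\<close> make \<open>X\<close> and \<open>Y\<close> functions with derivatives
    \<open>(1, 0, 0)\<close> and \<open>(0, 1, 0)\<close> along the frame.\<close>
  define Y where "Y = (\<lambda>p. 1 / \<tau> * co3 p (Q p))"
  define X where "X = (\<lambda>p. - 1 / \<tau> * co3 p (R p))"
  have sX: "smooth_near A p X" and sY: "smooth_near A p Y" for p
    unfolding X_def Y_def by (intro smooth_near_mult smooth_near_const s)+
  have dY: "u1 p Y = 0" "u2 p Y = 1" "u3 p Y = 0" for p
    unfolding Y_def vector_field_apply_cmult[OF frame_vf(1) s(3)] vector_field_apply_cmult[OF frame_vf(2) s(3)]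
      vector_field_apply_cmult[OF frame_vf(3) s(3)]
    using dQ Q \<tau> by simp_all
  have dX: "u1 p X = 1" "u2 p X = 0" "u3 p X = 0" for p
    unfolding X_def vector_field_apply_cmult[OF frame_vf(1) s(6)] vector_field_apply_cmult[OF frame_vf(2) s(6)]
      vector_field_apply_cmult[OF frame_vf(3) s(6)]
    using dR R \<tau> by simp_all
  \<comment> \<open>Chosen so that \<open>u1 Z = \<tau> X\<close> and
    \<open>u2 Z = \<tau> Y\<close>, as the system asks of the third coefficient of
    \<open>Y u\<^sub>1 - X u\<^sub>2 + Z u\<^sub>3\<close>.\<close>
  define Z where "Z = (\<lambda>p. \<tau> / 2 * (X p * X p + Y p * Y p))"
  have sXY: "smooth_near A p (\<lambda>p. X p * X p + Y p * Y p)" for p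
    by (intro smooth_near_add smooth_near_mult sX sY)
  have sZ: "smooth_near A p Z" for p
    unfolding Z_def by (intro smooth_near_mult[OF smooth_near_const sXY])
  have dZ: "V p Z = \<tau> * (X p * V p X + Y p * V p Y)" if V: "V \<in> vector_fields A" for V p
    unfolding Z_def vector_field_apply_cmult[OF V sXY]
      vector_field_apply_add[OF V smooth_near_mult[OF sX sX] smooth_near_mult[OF sY sY]]
      vector_field_apply_mult[OF V sX sX] vector_field_apply_mult[OF V sY sY]
    by (simp add: algebra_simps)
  have "fsys 1 Y (\<lambda>p. - X p) Z"
    unfolding fsys_def
    unfolding dZ[OF frame_vf(1)] dZ[OF frame_vf(2)] dZ[OF frame_vf(3)] dX dY
      vector_field_apply_minus[OF frame_vf(1) sX] vector_field_apply_minus[OF frame_vf(2) sX]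
      vector_field_apply_minus[OF frame_vf(3) sX] True
    using sX sY sZ smooth_near_minus[OF sX] by simp
  moreover have "Y e = 0" "X e = 0"
    by (simp_all add: X_def Y_def Q0 R0)
  ultimately show ?thesis
    by (intro that[of 1 Y "\<lambda>p. - X p" Z]) (simp_all add: Z_def)
qed

text \<open>Linearity lets the rotation field be matched to a Jacobi field of any amplitude.\<close>

lemma fsys_scale:
  assumes "fsys b x y z"
  shows "fsys (k * b) (\<lambda>p. k * x p) (\<lambda>p. k * y p) (\<lambda>p. k * z p)"
proof -
  have s: "smooth_near A p x" "smooth_near A p y" "smooth_near A p z" for p
    using assms unfolding fsys_def by blast+
  note e = vector_field_apply_cmult[OF _ s(1)] vector_field_apply_cmult[OF _ s(2)] vector_field_apply_cmult[OF _ s(3)]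
  have d: "u1 p x = 0" "u1 p y = c * z p - b" "u1 p z = - \<tau> * y p" "u2 p x = b - c * z p" "u2 p y = 0"
    "u2 p z = \<tau> * x p" "u3 p x = c * y p" "u3 p y = - c * x p" "u3 p z = 0" for p
    using assms unfolding fsys_def by blast+
  show ?thesis
    using s unfolding fsys_def e[OF frame_vf(1)] e[OF frame_vf(2)] e[OF frame_vf(3)] d
    by (auto intro: smooth_near_mult[OF smooth_near_const] simp: algebra_simps)
qed

end

section \<open>Conjugate points along a geodesic from the origin\<close>

locale M3_group_geodesic = M3_group A g u1 u2 u3 \<tau> c G + M3_geodesic A g u1 u2 u3 \<tau> c \<gamma> S C \<phi>0
  for A :: "('a::{t2_space, second_countable_topology}, real^3) atlas"
    and g :: "'a metric" and u1 u2 u3 :: "'a vfield" and \<tau> c :: real and G :: "'a monoid"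
    and \<gamma> :: "real \<Rightarrow> 'a" and S C \<phi>0 :: real +
  assumes \<tau>: "\<tau> > 0" and c_neq: "c \<noteq> \<tau>" and origin: "\<gamma> 0 = e"
begin

text \<open>The assumption \<open>\<kappa> \<noteq> \<tau>\<^sup>2\<close>, here
  \<open>c \<noteq> \<tau>\<close>, leaves \<open>S\<^sup>2\<close> as the only factor that can
  vanish.\<close>

lemma mu_eq_0_iff: "mu = 0 \<longleftrightarrow> S = 0"
proof -
  have "\<tau>\<^sup>2 - c * \<tau> = \<tau> * (\<tau> - c)"
    by (simp add: power2_eq_square algebra_simps)
  then show ?thesis
    unfolding mu_def using \<tau> c_neq by simp
qed

lemma sol_scale: "sol (k * x) (k * b) = k *\<^sub>R sol x b"
  using sol_linear[of "k * x" "k * b"] sol_linear[of x b] by (simp add: scaleR_add_right)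

context
  assumes lam: "lam > 0"
begin

lemma conjugate_iff:
  "conjugate_at A g \<gamma> T \<longleftrightarrow>
    T > 0 \<and> (sin (om * T / 2) = 0 \<or> sin (om * T / 2) = mu * (om * T) * cos (om * T / 2))"
proof
  assume "conjugate_at A g \<gamma> T"
  then show "T > 0 \<and> (sin (om * T / 2) = 0 \<or> sin (om * T / 2) = mu * (om * T) * cos (om * T / 2))"
    unfolding conjugate_at_def using vanishing_trivial[OF \<tau> lam, of T] by blast
next
  assume T: "T > 0 \<and> (sin (om * T / 2) = 0 \<or> sin (om * T / 2) = mu * (om * T) * cos (om * T / 2))"
  have "\<exists>J\<in>vanishing_jacobi_fields A g \<gamma> T. J \<noteq> 0"
  proof (cases "sin (om * T / 2) = 0")
    case True
    have "sol 0 1 \<in> vanishing_jacobi_fields A g \<gamma> T"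
    proof (cases "mu = 0")
      case True
      then show ?thesis
        using vanishing_at_period_fiber[OF \<tau> lam] T \<open>sin (om * T / 2) = 0\<close> by blast
    next
      case False
      then show ?thesis
        using vanishing_at_period[OF \<tau> lam] T \<open>sin (om * T / 2) = 0\<close> by blast
    qed
    moreover have "sol 0 1 \<noteq> 0"
      using sol_eq_0_iff[OF \<tau> lam] by simp
    ultimately show ?thesis
      by blast
  next
    case False
    then have "sol (1 * cos (om * T / 2)) (- 1 * sin (om * T / 2)) \<in> vanishing_jacobi_fields A g \<gamma> T"
      using vanishing_at_tan[OF \<tau> lam, of T] T by blast
    moreover have "sol (1 * cos (om * T / 2)) (- 1 * sin (om * T / 2)) \<noteq> 0"
      using sol_eq_0_iff[OF \<tau> lam] False by simp
    ultimately show ?thesis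
      by blast
  qed
  then show "conjugate_at A g \<gamma> T"
    unfolding conjugate_at_def using T by blast
qed

text \<open>Rotations about \<open>\<xi>\<close> fix the fiber and induce no nonzero Jacobi field on
  it: for \<open>S = 0\<close>, \<open>killing_sol\<close> removes both parameters.\<close>

lemma fiber_conjugate:
  assumes "S = 0" "conjugate_at A g \<gamma> T"
  shows "conj_mult A g \<gamma> T = 2 \<and> \<not> isotropic_at A g \<gamma> T"
proof -
  have mu: "mu = 0"
    using assms(1) mu_eq_0_iff by blast
  have T: "T > 0" "sin (om * T / 2) = 0"
    using assms(2) unfolding conjugate_iff mu by auto
  note V = vanishing_at_period_fiber[OF \<tau> lam T mu]
  have "J = 0" if J: "J \<in> vanishing_jacobi_fields A g \<gamma> T" "isotropic_jacobi_field A g \<gamma> J" for J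
  proof -
    obtain x b where "J = sol x b"
      using J(1) unfolding V by blast
    moreover obtain K where "killing_field A g K" "J = (\<lambda>t. K (\<gamma> t))"
      using J(2) unfolding isotropic_jacobi_field_def by blast
    ultimately have "x = 0 \<and> b = 0"
      using killing_sol[OF _ \<tau> c_neq lam, of K x b] assms(1) by simp
    then show ?thesis
      using \<open>J = sol x b\<close> sol_eq_0_iff[OF \<tau> lam] by simp
  qed
  then show ?thesis
    unfolding conj_mult_def isotropic_at_def V using dim_sol_plane[OF \<tau> lam] by blast
qed

text \<open>The solutions have \<open>x = 0\<close>, and since \<open>S \<noteq> 0\<close> a
  multiple of the rotation field restricts to each of them.\<close>

lemma period_conjugate:
  assumes "S \<noteq> 0" "T > 0" "sin (om * T / 2) = 0"
  shows "strictly_isotropic_at A g \<gamma> T \<and> conj_mult A g \<gamma> T = 1"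
proof
  have mu: "mu \<noteq> 0"
    using assms(1) mu_eq_0_iff by blast
  note V = vanishing_at_period[OF \<tau> lam assms(2,3) mu]
  obtain b x y z where r: "b \<noteq> 0" "fsys b x y z" "x e = 0" "y e = 0" "z e = 0"
    using rotation_field[OF \<tau>] .
  have "isotropic_jacobi_field A g \<gamma> J" if J: "J \<in> vanishing_jacobi_fields A g \<gamma> T" for J
  proof -
    obtain d where d: "J = sol 0 d"
      using J unfolding V by blast
    \<comment> \<open>Solves \<open>- (k b) S = d\<close>, matching \<open>q' (0)\<close> of the
      scaled rotation to that of \<open>J\<close>.\<close>
    define k where "k = - d / (b * S)"
    have kd: "- (k * b) * S = d"
      using r(1) assms(1) by (simp add: k_def)
    note f = fsys_scale[OF r(2), of k]
    have "(\<lambda>t. fr (\<gamma> t) (k * x (\<gamma> t)) (k * y (\<gamma> t)) (k * z (\<gamma> t))) = sol 0 (- (k * b) * S)"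
      by (rule fsys_along[OF f _ _ _ \<tau> lam]) (simp_all add: origin r)
    then have "J = (\<lambda>t. fr (\<gamma> t) (k * x (\<gamma> t)) (k * y (\<gamma> t)) (k * z (\<gamma> t)))"
      unfolding d kd by simp
    then show ?thesis
      using fsys_killing[OF f] J unfolding isotropic_jacobi_field_def vanishing_jacobi_fields_def by blast
  qed
  then show "strictly_isotropic_at A g \<gamma> T"
    unfolding strictly_isotropic_at_def conjugate_iff using assms by blast
  have "sol 0 d = d *\<^sub>R sol 0 1" for d
    by (subst sol_linear) simp
  then have "range (\<lambda>b. sol 0 b) = range (\<lambda>k. k *\<^sub>R sol 0 1)"
    by (rule arg_cong[where f = range, OF ext])
  then show "conj_mult A g \<gamma> T = 1"
    unfolding conj_mult_def V using dim_range_scaleR[of "sol 0 1"] sol_eq_0_iff[OF \<tau> lam, of 0 1] by simp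
qed

text \<open>The solutions have \<open>x = k cos (s / 2)\<close> with nonzero cosine, whereas a
  Killing field forces \<open>x = 0\<close>.\<close>

lemma tan_conjugate:
  assumes "S \<noteq> 0" "T > 0" "tan_solution mu (om * T)"
  shows "\<not> isotropic_at A g \<gamma> T \<and> conj_mult A g \<gamma> T = 1"
proof
  have cos: "cos (om * T / 2) \<noteq> 0"
    using assms(3) by (simp add: tan_solution_def)
  have sin_eq: "sin (om * T / 2) = mu * (om * T) * cos (om * T / 2)"
    using assms(3) unfolding tan_solution_iff .
  have mu: "mu \<noteq> 0"
    using assms(1) mu_eq_0_iff by blast
  have sin: "sin (om * T / 2) \<noteq> 0"
    unfolding sin_eq using mu cos assms(2) om(1)[OF \<tau> lam] by simp
  note V = vanishing_at_tan[OF \<tau> lam assms(2) sin sin_eq]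
  have "J = 0" if J: "J \<in> vanishing_jacobi_fields A g \<gamma> T" "isotropic_jacobi_field A g \<gamma> J" for J
  proof -
    obtain k where k: "J = sol (k * cos (om * T / 2)) (- k * sin (om * T / 2))"
      using J(1) unfolding V by blast
    moreover obtain K where "killing_field A g K" "J = (\<lambda>t. K (\<gamma> t))"
      using J(2) unfolding isotropic_jacobi_field_def by blast
    ultimately have "k * cos (om * T / 2) = 0"
      using killing_sol[OF _ \<tau> c_neq lam, of K "k * cos (om * T / 2)" "- k * sin (om * T / 2)"] by simp
    then show ?thesis
      using k sol_eq_0_iff[OF \<tau> lam] cos by simp
  qed
  then show "\<not> isotropic_at A g \<gamma> T"
    unfolding isotropic_at_def by blast
  have "sol (k * cos (om * T / 2)) (- k * sin (om * T / 2)) = k *\<^sub>R sol (cos (om * T / 2)) (- sin (om * T / 2))" for k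
    using sol_scale[of k "cos (om * T / 2)" "- sin (om * T / 2)"] by simp
  moreover have "sol (cos (om * T / 2)) (- sin (om * T / 2)) \<noteq> 0"
    using sol_eq_0_iff[OF \<tau> lam] sin by simp
  ultimately show "conj_mult A g \<gamma> T = 1"
    unfolding conj_mult_def V using dim_range_scaleR by simp
qed

end

end

theorem theorem5p2:
  fixes \<kappa> \<tau> \<theta> :: real
    and A :: "('a::{t2_space, second_countable_topology}, real^3) atlas"
    and G :: "'a monoid"
    and u1 u2 u3 :: "'a vfield"
    and g :: "'a metric"
    and \<gamma> :: "real \<Rightarrow> 'a"
  assumes "\<tau> > 0" and "\<kappa> \<noteq> \<tau>\<^sup>2"
    and "M3 \<kappa> \<tau> A G u1 u2 u3 g"
    and "0 \<le> \<theta>" and "\<theta> \<le> pi"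
    and "geodesic A g \<gamma>" and "unit_speed A g \<gamma>" and "\<gamma> 0 = \<one>\<^bsub>G\<^esub>"
    and "slope_angle A g u3 \<gamma> = \<theta>"
  shows
    "((\<exists>t. conjugate_at A g \<gamma> t) \<longleftrightarrow> slope_lambda \<kappa> \<tau> \<theta> > 0) \<and>
     (\<theta> \<in> {0, pi} \<longrightarrow>
        {t. conjugate_at A g \<gamma> t} = {2 * pi * real p / \<tau> | p::nat. p \<ge> 1} \<and>
        (\<forall>t. conjugate_at A g \<gamma> t \<longrightarrow> conj_mult A g \<gamma> t = 2 \<and> \<not> isotropic_at A g \<gamma> t)) \<and>
     (0 < \<theta> \<and> \<theta> < pi \<and> slope_lambda \<kappa> \<tau> \<theta> > 0 \<longrightarrow>
        {t. conjugate_at A g \<gamma> t} =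
          {s / sqrt (slope_lambda \<kappa> \<tau> \<theta>) | s. s > 0 \<and>
             ((\<exists>p::nat. p \<ge> 1 \<and> s = 2 * real p * pi) \<or> tan_solution (slope_mu \<kappa> \<tau> \<theta>) s)} \<and>
        (\<forall>p::nat. p \<ge> 1 \<longrightarrow>
           strictly_isotropic_at A g \<gamma> (2 * real p * pi / sqrt (slope_lambda \<kappa> \<tau> \<theta>)) \<and>
           conj_mult A g \<gamma> (2 * real p * pi / sqrt (slope_lambda \<kappa> \<tau> \<theta>)) = 1) \<and>
        (\<forall>s>0. tan_solution (slope_mu \<kappa> \<tau> \<theta>) s \<longrightarrow>
           \<not> isotropic_at A g \<gamma> (s / sqrt (slope_lambda \<kappa> \<tau> \<theta>)) \<and>
           conj_mult A g \<gamma> (s / sqrt (slope_lambda \<kappa> \<tau> \<theta>)) = 1))"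
proof -
  note M3 = assms(3)[unfolded M3_def]
  have lg: "lie_group A G" and lin: "left_invariant_metric A G g"
    using M3 by blast+
  have span: "span {u1, u2, u3} = lie_algebra A G"
    using M3 by blast
  have la: "u1 \<in> lie_algebra A G" "u2 \<in> lie_algebra A G" "u3 \<in> lie_algebra A G"
    unfolding span[symmetric] by (rule span_base, simp)+
  have sm: "smooth_manifold A"
    using lg unfolding lie_group_def by unfold_locales blast
  interpret M3_frame A g u1 u2 u3 \<tau> "\<kappa> / \<tau>"
  proof (intro M3_frame.intro[OF sm] M3_frame_axioms.intro)
    show "riemannian_metric A g"
      using lin unfolding left_invariant_metric_def by blast
    show "u1 \<in> vector_fields A" "u2 \<in> vector_fields A" "u3 \<in> vector_fields A"
      using la unfolding lie_algebra_def by blast+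
  qed (use M3 in blast)+
  interpret M3_group A g u1 u2 u3 \<tau> "\<kappa> / \<tau>" G
  proof (unfold_locales)
    show "lie_group A G" "connected (UNIV :: 'a set)"
      using M3 by blast+
    show "u1 (a \<otimes>\<^bsub>G\<^esub> p) = left_push G a (u1 p)" "u2 (a \<otimes>\<^bsub>G\<^esub> p) = left_push G a (u2 p)"
      "u3 (a \<otimes>\<^bsub>G\<^esub> p) = left_push G a (u3 p)" for a p
      using la unfolding lie_algebra_def by blast+
  qed
  interpret M3_curve A g u1 u2 u3 \<tau> "\<kappa> / \<tau>" \<gamma>
    using assms(6) unfolding geodesic_def by unfold_locales blast
  have cov0: "cov (velocity A \<gamma>) = 0"
    using assms(6) unfolding geodesic_def covariant_derivative_along_eq by blast
  have unit: "v1 0 * v1 0 + v2 0 * v2 0 + v3 0 * v3 0 = 1"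
    using assms(7) metric_eq_co[OF velocity_tangent velocity_tangent, of 0] unfolding unit_speed_def by simp
  define S where "S = sin \<theta>"
  define C where "C = cos \<theta>"
  have "slope_angle A g u3 \<gamma> = arccos (v3 0)"
    using assms(7) orthonormal(3) unfolding slope_angle_def Let_def unit_speed_def co3_def by simp
  \<comment> \<open>Allows \<open>arccos\<close> to be inverted; a consequence of unit
    speed.\<close>
  moreover have "\<bar>v3 0\<bar> \<le> 1"
  proof -
    have "(v3 0)\<^sup>2 \<le> 1"
      using unit zero_le_square[of "v1 0"] zero_le_square[of "v2 0"] unfolding power2_eq_square by linarith
    then show ?thesis
      by (simp add: abs_square_le_1)
  qed
  ultimately have v3: "v3 0 = C"
    using assms(9) cos_arccos[of "v3 0"] unfolding C_def by simp
  have SC: "S\<^sup>2 + C\<^sup>2 = 1"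
    by (simp add: S_def C_def)
  have S_nonneg: "S \<ge> 0"
    using sin_ge_zero[OF assms(4,5)] by (simp add: S_def)
  have h: "v1 0 * v1 0 + v2 0 * v2 0 = S * S"
    using unit SC unfolding v3 power2_eq_square by linarith
  \<comment> \<open>Polar angle of the horizontal velocity at the origin; for \<open>S = 0\<close>
    that part is 0 and any angle will do.\<close>
  obtain \<phi>0 where \<phi>0: "v1 0 = S * cos \<phi>0" "v2 0 = S * sin \<phi>0"
  proof (cases "S = 0")
    case True
    then have "v1 0 = 0" "v2 0 = 0"
      using h by (simp_all add: sum_squares_eq_zero_iff)
    then show ?thesis
      using that[of 0] True by simp
  next
    case False
    have "(v1 0 / S)\<^sup>2 + (v2 0 / S)\<^sup>2 = 1"
      using h False by (simp add: power2_eq_square field_simps)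
    then obtain t where "v1 0 / S = cos t" "v2 0 / S = sin t"
      using sincos_total_2pi[OF \<open>(v1 0 / S)\<^sup>2 + (v2 0 / S)\<^sup>2 = 1\<close>] by blast
    then show ?thesis
      using that[of t] False by (simp add: field_simps)
  qed
  interpret M3_group_geodesic A g u1 u2 u3 \<tau> "\<kappa> / \<tau>" G \<gamma> S C \<phi>0
  proof unfold_locales
    show "\<kappa> / \<tau> \<noteq> \<tau>"
      using assms(1,2) by (simp add: field_simps power2_eq_square)
  qed (use cov0 \<phi>0 v3 SC assms in auto)
  have lam_eq: "slope_lambda \<kappa> \<tau> \<theta> = lam"
    unfolding slope_lambda_def lam_def using assms(1) by (simp add: S_def C_def)
  have mu_eq: "slope_mu \<kappa> \<tau> \<theta> = mu"
    unfolding slope_mu_def mu_def using assms(1) by (simp add: S_def)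
  have om_eq: "sqrt lam = om"
    by (simp add: om_def)
  have conj: "conjugate_at A g \<gamma> T \<longleftrightarrow> T > 0 \<and> ((\<exists>p::nat. p \<ge> 1 \<and> om * T = 2 * real p * pi) \<or> tan_solution mu (om * T))"
    if "lam > 0" for T
  proof (cases "T > 0")
    case True
    then have "om * T > 0"
      using om(1)[OF assms(1) that] by simp
    show ?thesis
      unfolding conjugate_iff[OF that] tan_solution_iff sin_half_eq_0_iff[OF \<open>om * T > 0\<close>]
      by (rule refl)
  next
    case False
    then show ?thesis
      unfolding conjugate_iff[OF that] by simp
  qed
  have 1: "(\<exists>t. conjugate_at A g \<gamma> t) \<longleftrightarrow> lam > 0"
  proof
    assume "\<exists>t. conjugate_at A g \<gamma> t"
    then show "lam > 0"
      using no_conjugate_points by (cases "lam \<le> 0") simp_all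
  next
    assume l: "lam > 0"
    have "conjugate_at A g \<gamma> (2 * pi / om)"
      unfolding conjugate_iff[OF l] using om(1)[OF assms(1) l] by simp
    then show "\<exists>t. conjugate_at A g \<gamma> t" ..
  qed
  have 2: "{t. conjugate_at A g \<gamma> t} = {2 * pi * real p / \<tau> | p::nat. p \<ge> 1} \<and>
      (\<forall>t. conjugate_at A g \<gamma> t \<longrightarrow> conj_mult A g \<gamma> t = 2 \<and> \<not> isotropic_at A g \<gamma> t)"
    if "\<theta> \<in> {0, pi}"
  proof -
    have S0: "S = 0"
      using that by (auto simp: S_def)
    then have "C\<^sup>2 = 1"
      using SC by simp
    then have lam: "lam = \<tau>\<^sup>2"
      unfolding lam_def using S0 by simp
    then have l: "lam > 0" and o: "om = \<tau>"
      using assms(1) by (simp_all add: om_def)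
    have "conjugate_at A g \<gamma> T \<longleftrightarrow> (\<exists>p::nat. T = 2 * pi * real p / \<tau> \<and> p \<ge> 1)" for T
    proof -
      \<comment> \<open>With \<open>mu = 0\<close> the tangent equation reads
        \<open>sin (s / 2) = 0\<close> as well, so the two alternatives coincide.\<close>
      have "conjugate_at A g \<gamma> T \<longleftrightarrow> T > 0 \<and> sin (\<tau> * T / 2) = 0"
        unfolding conjugate_iff[OF l] o using mu_eq_0_iff S0 by auto
      also have "\<dots> \<longleftrightarrow> T > 0 \<and> (\<exists>p::nat. p \<ge> 1 \<and> \<tau> * T = 2 * real p * pi)"
        using sin_half_eq_0_iff[of "\<tau> * T"] assms(1) by auto
      also have "\<dots> \<longleftrightarrow> (\<exists>p::nat. T = 2 * pi * real p / \<tau> \<and> p \<ge> 1)"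
      proof
        assume "T > 0 \<and> (\<exists>p::nat. p \<ge> 1 \<and> \<tau> * T = 2 * real p * pi)"
        then obtain p :: nat where "p \<ge> 1" "\<tau> * T = 2 * real p * pi"
          by blast
        then show "\<exists>p::nat. T = 2 * pi * real p / \<tau> \<and> p \<ge> 1"
          using assms(1) by (intro exI[of _ p]) (simp add: field_simps)
      next
        assume "\<exists>p::nat. T = 2 * pi * real p / \<tau> \<and> p \<ge> 1"
        then obtain p :: nat where "T = 2 * pi * real p / \<tau>" "p \<ge> 1"
          by blast
        then show "T > 0 \<and> (\<exists>p::nat. p \<ge> 1 \<and> \<tau> * T = 2 * real p * pi)"
          using assms(1) by (intro conjI exI[of _ p]) simp_all
      qed
      finally show ?thesis .
    qed
    then show ?thesis
      using fiber_conjugate[OF l S0] by blast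
  qed
  have 3: "{t. conjugate_at A g \<gamma> t} =
          {s / om | s. s > 0 \<and> ((\<exists>p::nat. p \<ge> 1 \<and> s = 2 * real p * pi) \<or> tan_solution mu s)} \<and>
        (\<forall>p::nat. p \<ge> 1 \<longrightarrow>
           strictly_isotropic_at A g \<gamma> (2 * real p * pi / om) \<and> conj_mult A g \<gamma> (2 * real p * pi / om) = 1) \<and>
        (\<forall>s>0. tan_solution mu s \<longrightarrow>
           \<not> isotropic_at A g \<gamma> (s / om) \<and> conj_mult A g \<gamma> (s / om) = 1)"
    if \<theta>: "0 < \<theta>" "\<theta> < pi" and l: "lam > 0"
  proof (intro conjI)
    have S: "S \<noteq> 0"
      using sin_gt_zero[OF \<theta>] by (simp add: S_def)
    have o: "om > 0"
      by (rule om(1)[OF assms(1) l])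
    show "{t. conjugate_at A g \<gamma> t} =
        {s / om | s. s > 0 \<and> ((\<exists>p::nat. p \<ge> 1 \<and> s = 2 * real p * pi) \<or> tan_solution mu s)}"
    proof (intro equalityI subsetI)
      fix T assume "T \<in> {t. conjugate_at A g \<gamma> t}"
      then have T: "T > 0" "(\<exists>p::nat. p \<ge> 1 \<and> om * T = 2 * real p * pi) \<or> tan_solution mu (om * T)"
        unfolding mem_Collect_eq conj[OF l] by blast+
      have "T = om * T / om" "om * T > 0"
        using o T(1) by simp_all
      then show "T \<in> {s / om | s. s > 0 \<and> ((\<exists>p::nat. p \<ge> 1 \<and> s = 2 * real p * pi) \<or> tan_solution mu s)}"
        using T(2) by blast
    next
      fix T assume "T \<in> {s / om | s. s > 0 \<and> ((\<exists>p::nat. p \<ge> 1 \<and> s = 2 * real p * pi) \<or> tan_solution mu s)}"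
      then obtain s where s: "T = s / om" "s > 0" "(\<exists>p::nat. p \<ge> 1 \<and> s = 2 * real p * pi) \<or> tan_solution mu s"
        by blast
      have "om * T = s" "T > 0"
        using o s(1,2) by simp_all
      then show "T \<in> {t. conjugate_at A g \<gamma> t}"
        unfolding mem_Collect_eq conj[OF l] using s(3) by blast
    qed
    show "\<forall>p::nat. p \<ge> 1 \<longrightarrow>
        strictly_isotropic_at A g \<gamma> (2 * real p * pi / om) \<and> conj_mult A g \<gamma> (2 * real p * pi / om) = 1"
    proof (intro allI impI)
      fix p :: nat assume p: "p \<ge> 1"
      show "strictly_isotropic_at A g \<gamma> (2 * real p * pi / om) \<and> conj_mult A g \<gamma> (2 * real p * pi / om) = 1"
        by (rule period_conjugate[OF l S]) (use o p in simp_all)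
    qed
    show "\<forall>s>0. tan_solution mu s \<longrightarrow> \<not> isotropic_at A g \<gamma> (s / om) \<and> conj_mult A g \<gamma> (s / om) = 1"
    proof (intro allI impI)
      fix s :: real assume s: "s > 0" "tan_solution mu s"
      show "\<not> isotropic_at A g \<gamma> (s / om) \<and> conj_mult A g \<gamma> (s / om) = 1"
        by (rule tan_conjugate[OF l S]) (use o s in simp_all)
    qed
  qed
  show ?thesis
    unfolding lam_eq mu_eq om_eq
    by (rule conjI[OF 1 conjI[OF impI[OF 2]]]) (assumption, rule impI, elim conjE, rule 3)
qed

end
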